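(* Let $\nu$ be a measure on $\mathbb{R}^n$ such that $f=\log\frac{d\nu}{d\gamma}$ for some twice-differentiable function $f$. Then $$\mathcal{I}(\nu)-2\mathrm{D}_{\mathrm{KL}}(\nu\Vert\gamma)\le 2\mathcal{D}(\nu)^{2/3}\mathcal{I}(\nu)^{1/3}+\max\left(-\inf_{x\in\mathbb{R}^n}\Delta f(x),0\right).$$
   Context: $\gamma$ is the standard Gaussian measure on $\mathbb{R}^n$. For $d\nu=e^f d\gamma$: $\mathrm{D}_{\mathrm{KL}}(\nu\Vert\gamma)=\int f\,d\nu$ and $\mathcal{I}(\nu)=\int|\nabla f|^2d\nu$ (Fisher information). The Gaussian width of $K\subset\mathbb{R}^n$ is $\mathbf{GW}(K)=\mathbb{E}\sup_{x\in K}\langle x,\Gamma\rangle$ with $\Gamma\sim N(0,\mathrm{Id}_n)$, and $\mathcal{D}(\nu)=\mathcal{D}(f)=\mathbf{GW}(\{\nabla f(x):x\in\mathbb{R}^n\})$.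
   Formalization: The measure ν is taken to be a probability measure (for ν = γ/2 the inequality as worded fails), and the KL divergence and Fisher information are taken to be finite; otherwise the inequality is trivial or its left side undefined. *)

theory Defs
  imports "HOL-Probability.Probability"
begin

definition std_gaussian :: "'a::euclidean_space measure" where
  "std_gaussian = density lborel
     (\<lambda>x. ennreal ((2 * pi) powr (- real DIM('a) / 2) * exp (- (norm x)\<^sup>2 / 2)))"

definition gauss_tilt :: "('a::euclidean_space \<Rightarrow> real) \<Rightarrow> 'a measure" where
  "gauss_tilt f = density std_gaussian (\<lambda>x. ennreal (exp (f x)))"

definition KL_gauss :: "('a::euclidean_space \<Rightarrow> real) \<Rightarrow> real" where
  "KL_gauss f = (LINT x|gauss_tilt f. f x)"

definition fisher_info :: "('a::euclidean_space \<Rightarrow> real) \<Rightarrow> ('a \<Rightarrow> 'a) \<Rightarrow> real" where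
  "fisher_info f gradf = (LINT x|gauss_tilt f. (norm (gradf x))\<^sup>2)"

text \<open>Gaussian width GW(K) = E sup_{x in K} <x, Gamma>, in the extended reals.
  When the supremum is not (a.e. finite and) integrable, the width is +infinity
  (for nonempty K the supremum is bounded below by an integrable function).\<close>
definition gaussian_width :: "'a::euclidean_space set \<Rightarrow> ereal" where
  "gaussian_width K =
    (let S = (\<lambda>g. SUP x\<in>K. ereal (inner x g)) in
     if (AE g in std_gaussian. \<bar>S g\<bar> \<noteq> \<infinity>) \<and>
        integrable std_gaussian (\<lambda>g. real_of_ereal (S g))
     then ereal (LINT g|std_gaussian. real_of_ereal (S g))
     else \<infinity>)"

text \<open>Laplacian of f at x, given the derivative f2 x of the gradient field at x.\<close>
definition laplacian :: "('a::euclidean_space \<Rightarrow> 'a \<Rightarrow> 'a) \<Rightarrow> 'a \<Rightarrow> real" where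
  "laplacian f2 x = (\<Sum>b\<in>Basis. inner (f2 x b) b)"

end

theory Submission
  imports Defs
begin

text \<open>
  Write \<open>G\<close> for a standard Gaussian vector and \<open>D\<close> for the Gaussian width. If \<open>D\<close> is finite, the gradient
  of \<open>f\<close> is bounded, so \<open>f\<close> is Lipschitz. It suffices to show \<open>I - 2 KL \<le> D - L\<close> for a lower bound \<open>L\<close> of
  the Laplacian: since \<open>KL \<ge> 0\<close>, also \<open>I - 2 KL \<le> I\<close>, and the minimum of \<open>D\<close> and \<open>I\<close> is at most
  \<open>D\<close> to the power \<open>2/3\<close> times \<open>I\<close> to the power \<open>1/3\<close>.

  The bound \<open>E\<^sub>\<nu> \<langle>\<nabla>f, x\<rangle> \<le> 2 KL + D\<close> is the derivative at \<open>a = 1\<close> of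
  \<open>ln E exp (f (a G)) \<le> ln E exp (a\<^sup>2 f (G)) / a\<^sup>2 + (a - 1) D\<close>.
  This inequality follows from the stochastic control representation of \<open>ln E exp f\<close>, because
  \<open>f\<close> changes by at most \<open>(a - 1) sup \<langle>\<nabla>f, B\<rangle>\<close> when the driving noise \<open>B\<close> is replaced by \<open>a B\<close>;
  here the control problem is discretised in time.

  The bound \<open>I + L \<le> E\<^sub>\<nu> \<langle>\<nabla>f, x\<rangle>\<close> is an integration by parts. As the second derivatives need not be
  integrable, the maximum principle first gives \<open>E f (x + T G) \<ge> f x + L T\<^sup>2 / 2\<close>; the heat flow is then
  compared with \<open>f\<close> along an exchangeable Gaussian pair.
\<close>

section \<open>The standard Gaussian measure\<close>

text \<open>The exponent of \<open>a\<close> is forced by the cost of the drift. Under noise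
  \<open>a B\<close>, moving at velocity a^2 v costs a^2 |v|^2 / 2 per unit time; under noise
  \<open>B\<close> the same velocity costs a^4 |v|^2 / 2. Weighting \<open>f\<close> by a^2 on the
  second side and dividing the value by a^2 equalises the costs, so that only the excess noise (a -
  1) B remains, and the support function of the gradients pays for it.

  The discretised control argument needs a quadratic Taylor remainder that is uniform in space. A
  Lipschitz function with pointwise second derivatives need not have one, as its Hessian may be
  unbounded. Hence \<open>f\<close> is mollified by a Gaussian for this half of the proof: the
  constants that blow up with the mollification disappear when the time step tends to zero, before
  the mollification itself is removed.

  The bound on the Laplacian enters only through a lower bound for the heat flow, so it is never
  integrated against the measure.\<close>

definition gauss_dens :: "'a::euclidean_space \<Rightarrow> real" where
  "gauss_dens x = (2 * pi) powr (- real DIM('a) / 2) * exp (- (norm x)\<^sup>2 / 2)"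

lemma gauss_dens_pos [simp]: "gauss_dens x > 0"
  by (simp add: gauss_dens_def)

lemma gauss_dens_nonneg [simp]: "gauss_dens x \<ge> 0"
  by (simp add: less_imp_le)

lemma gauss_dens_measurable [measurable]: "gauss_dens \<in> borel_measurable borel"
  unfolding gauss_dens_def by measurable

lemma std_gaussian_eq: "std_gaussian = density lborel (\<lambda>x. ennreal (gauss_dens x))"
  by (simp add: std_gaussian_def gauss_dens_def)

lemma sets_std_gaussian [simp, measurable_cong]: "sets std_gaussian = sets borel"
  by (simp add: std_gaussian_eq)

lemma space_std_gaussian [simp]: "space std_gaussian = UNIV"
  by (simp add: std_gaussian_eq)

lemma nn_integral_std_gaussian:
  "F \<in> borel_measurable borel \<Longrightarrow>
    (\<integral>\<^sup>+x. F x \<partial>std_gaussian) = (\<integral>\<^sup>+x. ennreal (gauss_dens x) * F x \<partial>lborel)"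
  by (simp add: std_gaussian_eq nn_integral_density)

lemma nn_integral_lborel_affine:
  fixes t :: "'a::euclidean_space"
  assumes [measurable]: "F \<in> borel_measurable borel" and "c \<noteq> 0"
  shows "(\<integral>\<^sup>+x. F x \<partial>lborel) = ennreal (\<bar>c\<bar> ^ DIM('a)) * (\<integral>\<^sup>+x. F (t + c *\<^sub>R x) \<partial>lborel)"
  by (subst lborel_affine[OF assms(2), of t])
     (simp add: nn_integral_density nn_integral_distr nn_integral_cmult)

lemma gauss_dens_prod:
  "gauss_dens x = (\<Prod>b\<in>Basis. std_normal_density (x \<bullet> b))" for x :: "'a::euclidean_space"
proof -
  have "(\<Prod>b\<in>Basis. std_normal_density (x \<bullet> b))
      = (\<Prod>b\<in>(Basis::'a set). (2 * pi) powr (- 1 / 2)) * (\<Prod>b\<in>Basis. exp (- (x \<bullet> b)\<^sup>2 / 2))"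
    unfolding prod.distrib[symmetric]
    by (simp add: normal_density_def powr_minus powr_half_sqrt field_simps)
  also have "(\<Prod>b\<in>(Basis::'a set). (2 * pi) powr (- 1 / 2)) = (2 * pi) powr (- real DIM('a) / 2)"
    by (simp add: powr_realpow[symmetric] powr_powr)
  also have "(\<Prod>b\<in>Basis. exp (- (x \<bullet> b)\<^sup>2 / 2)) = exp (- (norm x)\<^sup>2 / 2)"
    by (subst exp_sum[symmetric])
       (simp_all add: sum_negf sum_divide_distrib[symmetric] norm_eq_sqrt_inner
          euclidean_inner[of x x] power2_eq_square sum_nonneg)
  finally show ?thesis by (simp add: gauss_dens_def)
qed

lemma prob_space_std_gaussian: "prob_space (std_gaussian :: 'a::euclidean_space measure)"
proof
  have "emeasure (std_gaussian :: 'a measure) UNIV = (\<integral>\<^sup>+x. ennreal (gauss_dens (x::'a)) \<partial>lborel)"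
    by (simp add: std_gaussian_eq emeasure_density)
  also have "\<dots> = (\<integral>\<^sup>+x. (\<Prod>b\<in>Basis. ennreal (std_normal_density (x \<bullet> b))) \<partial>(lborel :: 'a measure))"
    by (simp add: gauss_dens_prod prod_ennreal)
  also have "\<dots> = (\<Prod>b\<in>(Basis::'a set). (\<integral>\<^sup>+x. ennreal (std_normal_density x) \<partial>lborel))"
    by (rule nn_integral_lborel_prod) auto
  also have "(\<integral>\<^sup>+x. ennreal (std_normal_density x) \<partial>lborel) = 1"
    using prob_space.emeasure_space_1[OF prob_space_normal_density[of 1 0]]
    by (simp add: emeasure_density)
  finally show "emeasure (std_gaussian :: 'a measure) (space std_gaussian) = 1" by simp
qed

interpretation gauss: prob_space "std_gaussian :: 'a::euclidean_space measure"
  by (rule prob_space_std_gaussian)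

interpretation gauss_pair: pair_prob_space
  "std_gaussian :: 'a::euclidean_space measure" "std_gaussian :: 'b::euclidean_space measure" ..

text \<open>Cameron-Martin formula: completing the square turns the translated density into the
  original one times an exponential weight. Drifts, Gaussian smoothing and covariances are all
  reduced to it.\<close>

lemma gauss_shift:
  fixes u :: "'a::euclidean_space"
  shows "distr std_gaussian borel (\<lambda>y. y + u)
       = density std_gaussian (\<lambda>y. ennreal (exp (u \<bullet> y - (norm u)\<^sup>2 / 2)))"
proof (rule measure_eqI)
  fix A assume "A \<in> sets (distr std_gaussian borel (\<lambda>y. y + u))"
  hence [measurable]: "A \<in> sets borel" by simp
  have "emeasure (distr std_gaussian borel (\<lambda>y. y + u)) A
      = (\<integral>\<^sup>+y. indicator A (y + u) \<partial>std_gaussian)"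
    by (subst nn_integral_indicator[symmetric], simp, subst nn_integral_distr) simp_all
  also have "\<dots> = (\<integral>\<^sup>+y. ennreal (gauss_dens y) * indicator A (y + u) \<partial>lborel)"
    by (rule nn_integral_std_gaussian) measurable
  also have "\<dots> = (\<integral>\<^sup>+y. ennreal (gauss_dens (y - u)) * indicator A y \<partial>lborel)"
    by (subst nn_integral_lborel_affine[where c = 1 and t = "-u"]) simp_all
  also have "\<dots> = (\<integral>\<^sup>+y. ennreal (gauss_dens y) * (ennreal (exp (u \<bullet> y - (norm u)\<^sup>2 / 2)) * indicator A y) \<partial>lborel)"
  proof (intro nn_integral_cong)
    fix y
    have "gauss_dens (y - u) = gauss_dens y * exp (u \<bullet> y - (norm u)\<^sup>2 / 2)"
      unfolding gauss_dens_def mult.assoc exp_add[symmetric]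
      by (simp add: power2_norm_eq_inner inner_diff inner_commute diff_divide_distrib add_divide_distrib)
    thus "ennreal (gauss_dens (y - u)) * indicator A y
        = ennreal (gauss_dens y) * (ennreal (exp (u \<bullet> y - (norm u)\<^sup>2 / 2)) * indicator A y)"
      by (simp add: ennreal_mult mult.assoc)
  qed
  also have "\<dots> = (\<integral>\<^sup>+y. ennreal (exp (u \<bullet> y - (norm u)\<^sup>2 / 2)) * indicator A y \<partial>std_gaussian)"
    by (rule nn_integral_std_gaussian[symmetric]) measurable
  also have "\<dots> = emeasure (density std_gaussian (\<lambda>y. ennreal (exp (u \<bullet> y - (norm u)\<^sup>2 / 2)))) A"
    by (simp add: emeasure_density)
  finally show "emeasure (distr std_gaussian borel (\<lambda>y. y + u)) A = \<dots>" .
qed simp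

lemma gauss_uminus: "distr std_gaussian borel uminus = (std_gaussian :: 'a::euclidean_space measure)"
proof (rule measure_eqI)
  fix A assume "A \<in> sets (distr std_gaussian borel uminus :: 'a measure)"
  hence [measurable]: "A \<in> sets borel" by simp
  have "emeasure (distr std_gaussian borel uminus) A
      = (\<integral>\<^sup>+y. indicator A (- y) \<partial>std_gaussian)"
    by (subst nn_integral_indicator[symmetric], simp, subst nn_integral_distr) simp_all
  also have "\<dots> = (\<integral>\<^sup>+y. ennreal (gauss_dens y) * indicator A (- y) \<partial>lborel)"
    by (rule nn_integral_std_gaussian) measurable
  also have "\<dots> = (\<integral>\<^sup>+y. ennreal (gauss_dens y) * indicator A y \<partial>lborel)"
    by (subst nn_integral_lborel_affine[where c = "-1" and t = 0]) (simp_all add: gauss_dens_def)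
  also have "\<dots> = emeasure std_gaussian A"
    by (simp add: std_gaussian_eq emeasure_density)
  finally show "emeasure (distr std_gaussian borel uminus) A = \<dots>" .
qed simp

text \<open>The joint density of \<open>X\<close> and \<open>c X + s Y\<close> is proportional to
  exp (- (|x|^2 - 2 c <x, z> + |z|^2) / (2 s^2)), a form of the Mehler kernel, which is symmetric in
  \<open>x\<close> and \<open>z\<close>. Rotation invariance of the Gaussian and the Dirichlet form
  estimate both rest on this symmetry.\<close>

lemma gauss_exchangeable:
  fixes c s :: real
  assumes cs: "c\<^sup>2 + s\<^sup>2 = 1" and s: "s > 0"
  shows "distr (std_gaussian \<Otimes>\<^sub>M std_gaussian) borel (\<lambda>(x, y). (x, c *\<^sub>R x + s *\<^sub>R y))
       = distr (std_gaussian \<Otimes>\<^sub>M std_gaussian) borel (\<lambda>(x, y). (c *\<^sub>R x + s *\<^sub>R y, x :: 'a::euclidean_space))"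
    (is "distr ?P borel ?f = distr ?P borel ?g")
proof (rule measure_eqI)
  let ?k = "\<lambda>x z::'a. gauss_dens x * gauss_dens ((1 / s) *\<^sub>R (z - c *\<^sub>R x))"
  have meas: "?f \<in> ?P \<rightarrow>\<^sub>M borel" "?g \<in> ?P \<rightarrow>\<^sub>M borel"
    unfolding borel_prod[symmetric] by measurable
  \<comment> \<open>The power of \<open>s\<close> is the Jacobian of the substitution z = c x + s y
    for fixed \<open>x\<close>. Kept as a factor on the Gaussian side, it avoids a division in
    \<open>ennreal\<close> and cancels at the very end.\<close>
  have *: "ennreal (s ^ DIM('a)) * (\<integral>\<^sup>+x. (\<integral>\<^sup>+y. F x (c *\<^sub>R x + s *\<^sub>R y) \<partial>std_gaussian) \<partial>std_gaussian)
      = (\<integral>\<^sup>+x. (\<integral>\<^sup>+z. ennreal (?k x z) * F x z \<partial>lborel) \<partial>lborel)"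
    if [measurable]: "(\<lambda>(x, y). F x y) \<in> borel_measurable (borel \<Otimes>\<^sub>M borel)"
    for F :: "'a \<Rightarrow> 'a \<Rightarrow> ennreal"
  proof -
    have "ennreal (s ^ DIM('a)) * (\<integral>\<^sup>+x. (\<integral>\<^sup>+y. F x (c *\<^sub>R x + s *\<^sub>R y) \<partial>std_gaussian) \<partial>std_gaussian)
       = (\<integral>\<^sup>+x. ennreal (gauss_dens x) * (ennreal (s ^ DIM('a)) *
            (\<integral>\<^sup>+y. ennreal (gauss_dens y) * F x (c *\<^sub>R x + s *\<^sub>R y) \<partial>lborel)) \<partial>lborel)"
      by (simp add: nn_integral_std_gaussian nn_integral_cmult[symmetric] mult_ac)
    also have "\<dots> = (\<integral>\<^sup>+x. ennreal (gauss_dens x) *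
            (\<integral>\<^sup>+z. ennreal (gauss_dens ((1 / s) *\<^sub>R (z - c *\<^sub>R x))) * F x z \<partial>lborel) \<partial>lborel)"
    proof (intro nn_integral_cong arg_cong2[where f = "(*)"] refl)
      fix x
      show "ennreal (s ^ DIM('a)) * (\<integral>\<^sup>+y. ennreal (gauss_dens y) * F x (c *\<^sub>R x + s *\<^sub>R y) \<partial>lborel)
          = (\<integral>\<^sup>+z. ennreal (gauss_dens ((1 / s) *\<^sub>R (z - c *\<^sub>R x))) * F x z \<partial>lborel)"
        using s by (subst nn_integral_lborel_affine[where c = s and t = "c *\<^sub>R x"]) simp_all
    qed
    also have "\<dots> = (\<integral>\<^sup>+x. (\<integral>\<^sup>+z. ennreal (?k x z) * F x z \<partial>lborel) \<partial>lborel)"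
      by (simp add: nn_integral_cmult[symmetric] ennreal_mult mult_ac)
    finally show ?thesis .
  qed
  have k_sym: "?k x z = ?k z x" for x z
  proof -
    have "(norm x)\<^sup>2 + (norm ((1 / s) *\<^sub>R (z - c *\<^sub>R x)))\<^sup>2
        = (norm z)\<^sup>2 + (norm ((1 / s) *\<^sub>R (x - c *\<^sub>R z)))\<^sup>2"
    proof -
      have "(norm x)\<^sup>2 + (norm ((1 / s) *\<^sub>R (z - c *\<^sub>R x)))\<^sup>2
         = (s\<^sup>2 * (x \<bullet> x) + (z \<bullet> z - 2 * c * (x \<bullet> z) + c\<^sup>2 * (x \<bullet> x))) / s\<^sup>2" for x z :: 'a
        using s unfolding power2_norm_eq_inner
        by (simp add: inner_diff inner_commute power2_eq_square field_simps)
      moreover have "s\<^sup>2 = 1 - c\<^sup>2" using cs by simp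
      ultimately show ?thesis by (simp add: algebra_simps inner_commute)
    qed
    thus ?thesis
      unfolding gauss_dens_def
      by (simp add: algebra_simps exp_add[symmetric] flip: add_divide_distrib)
  qed
  fix A assume "A \<in> sets (distr ?P borel ?f)"
  hence "A \<in> sets borel" by simp
  hence [measurable]: "A \<in> sets (borel \<Otimes>\<^sub>M borel)" unfolding borel_prod .
  have e1: "emeasure (distr ?P borel ?f) A
      = (\<integral>\<^sup>+x. (\<integral>\<^sup>+y. indicator A (x, c *\<^sub>R x + s *\<^sub>R y) \<partial>std_gaussian) \<partial>std_gaussian)"
    using meas by (subst nn_integral_indicator[symmetric], simp add: borel_prod[symmetric], subst nn_integral_distr)
      (simp_all add: borel_prod[symmetric] gauss.nn_integral_fst[symmetric])
  have e2: "emeasure (distr ?P borel ?g) A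
      = (\<integral>\<^sup>+x. (\<integral>\<^sup>+y. indicator A (c *\<^sub>R x + s *\<^sub>R y, x) \<partial>std_gaussian) \<partial>std_gaussian)"
    using meas by (subst nn_integral_indicator[symmetric], simp add: borel_prod[symmetric], subst nn_integral_distr)
      (simp_all add: borel_prod[symmetric] gauss.nn_integral_fst[symmetric])
  have "ennreal (s ^ DIM('a)) * emeasure (distr ?P borel ?f) A
      = (\<integral>\<^sup>+x. (\<integral>\<^sup>+z. ennreal (?k x z) * indicator A (x, z) \<partial>lborel) \<partial>lborel)"
    unfolding e1 by (rule *) measurable
  also have "\<dots> = (\<integral>\<^sup>+z. (\<integral>\<^sup>+x. ennreal (?k x z) * indicator A (x, z) \<partial>lborel) \<partial>lborel)"
    by (rule lborel_pair.Fubini') measurable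
  also have "\<dots> = (\<integral>\<^sup>+z. (\<integral>\<^sup>+x. ennreal (?k z x) * indicator A (x, z) \<partial>lborel) \<partial>lborel)"
    by (subst k_sym) (rule refl)
  also have "\<dots> = ennreal (s ^ DIM('a)) * emeasure (distr ?P borel ?g) A"
    unfolding e2 by (rule *[symmetric]) measurable
  finally show "emeasure (distr ?P borel ?f) A = emeasure (distr ?P borel ?g) A"
    using s by (simp add: ennreal_mult_cancel_left)
qed simp

section \<open>Functions of exponential growth\<close>

text \<open>One class for nearly all integrability claims: it is stable under sums, products and
  affine substitutions, and it contains Lipschitz functions and the exponentials of their multiples.
  The bound is a single exponential so that the constants of a product simply add.\<close>

definition exp_growth :: "('a::euclidean_space \<Rightarrow> real) \<Rightarrow> bool" where
  "exp_growth \<phi> \<longleftrightarrow> \<phi> \<in> borel_measurable borel \<and>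
     (\<exists>C c. 0 \<le> c \<and> (\<forall>y. \<bar>\<phi> y\<bar> \<le> exp (C + c * norm y)))"

lemma exp_growthI:
  "\<phi> \<in> borel_measurable borel \<Longrightarrow> 0 \<le> c \<Longrightarrow> (\<And>y. \<bar>\<phi> y\<bar> \<le> exp (C + c * norm y)) \<Longrightarrow> exp_growth \<phi>"
  unfolding exp_growth_def by blast

lemma exp_growthE:
  assumes "exp_growth \<phi>"
  obtains C c where "0 \<le> c" "0 \<le> C" "\<And>y. \<bar>\<phi> y\<bar> \<le> exp (C + c * norm y)"
proof -
  obtain C c where c: "0 \<le> c" "\<And>y. \<bar>\<phi> y\<bar> \<le> exp (C + c * norm y)"
    using assms unfolding exp_growth_def by blast
  have "\<bar>\<phi> y\<bar> \<le> exp (\<bar>C\<bar> + c * norm y)" for y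
    using c(2)[of y] by (rule order_trans) simp
  thus thesis using that[of c "\<bar>C\<bar>"] c(1) by simp
qed

lemma exp_growth_measurable: "exp_growth \<phi> \<Longrightarrow> \<phi> \<in> borel_measurable borel"
  by (simp add: exp_growth_def)

text \<open>By c |y| \<le> c^2 + |y|^2 / 4, half of the Gaussian exponent survives. What is left is
  a multiple of a centred Gaussian of variance 2, whose mass is found by rescaling with
  \<open>sqrt 2\<close>.\<close>

lemma nn_integral_exp_norm_finite:
  "(\<integral>\<^sup>+y. ennreal (exp (C + c * norm y)) \<partial>(std_gaussian :: 'a::euclidean_space measure)) < \<infinity>"
proof -
  have "(\<integral>\<^sup>+y. ennreal (exp (C + c * norm y)) \<partial>(std_gaussian :: 'a measure))
      = (\<integral>\<^sup>+y. ennreal (gauss_dens (y::'a)) * ennreal (exp (C + c * norm y)) \<partial>lborel)"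
    by (rule nn_integral_std_gaussian) measurable
  also have "\<dots> \<le> (\<integral>\<^sup>+y. ennreal (exp (C + c\<^sup>2)) * ennreal (gauss_dens ((1 / sqrt 2) *\<^sub>R (y::'a))) \<partial>lborel)"
  proof (intro nn_integral_mono)
    fix y :: 'a
    have "0 \<le> (c - norm y / 2)\<^sup>2" by simp
    hence "c * norm y \<le> c\<^sup>2 + (norm y)\<^sup>2 / 4" by (simp add: power2_eq_square algebra_simps)
    hence "- (norm y)\<^sup>2 / 2 + (C + c * norm y) \<le> (C + c\<^sup>2) + (- (norm ((1 / sqrt 2) *\<^sub>R y))\<^sup>2 / 2)"
      by (simp add: power_divide)
    hence "exp (- (norm y)\<^sup>2 / 2) * exp (C + c * norm y)
        \<le> exp (C + c\<^sup>2) * exp (- (norm ((1 / sqrt 2) *\<^sub>R y))\<^sup>2 / 2)"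
      by (simp only: exp_add[symmetric] exp_le_cancel_iff)
    hence "gauss_dens y * exp (C + c * norm y) \<le> exp (C + c\<^sup>2) * gauss_dens ((1 / sqrt 2) *\<^sub>R y)"
      unfolding gauss_dens_def mult.assoc mult.left_commute[of "exp (C + c\<^sup>2)"]
      by (intro mult_left_mono) auto
    thus "ennreal (gauss_dens y) * ennreal (exp (C + c * norm y))
        \<le> ennreal (exp (C + c\<^sup>2)) * ennreal (gauss_dens ((1 / sqrt 2) *\<^sub>R y))"
      by (simp add: ennreal_mult[symmetric] ennreal_leI)
  qed
  also have "\<dots> = ennreal (exp (C + c\<^sup>2)) *
      (ennreal (\<bar>sqrt 2\<bar> ^ DIM('a)) * (\<integral>\<^sup>+y. ennreal (gauss_dens (y::'a)) * 1 \<partial>lborel))"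
    by (subst nn_integral_cmult, simp, subst nn_integral_lborel_affine[where c = "sqrt 2" and t = 0]) simp_all
  also have "(\<integral>\<^sup>+y. ennreal (gauss_dens (y::'a)) * 1 \<partial>lborel) = 1"
    by (subst nn_integral_std_gaussian[symmetric]) (simp_all add: gauss.emeasure_space_1[simplified])
  finally show ?thesis
    by (rule order_le_less_trans) (simp add: ennreal_mult[symmetric] del: ennreal_mult)
qed

lemma exp_norm_integrable: "integrable std_gaussian (\<lambda>y::'a::euclidean_space. exp (C + c * norm y))"
  using nn_integral_exp_norm_finite[of C c]
  by (intro integrableI_bounded) simp_all

lemma exp_growth_integrable:
  assumes "exp_growth \<phi>"
  shows "integrable std_gaussian \<phi>"
proof -
  obtain C c where "\<And>y. \<bar>\<phi> y\<bar> \<le> exp (C + c * norm y)"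
    using assms by (rule exp_growthE) blast
  thus ?thesis using exp_growth_measurable[OF assms]
    by (intro Bochner_Integration.integrable_bound[OF exp_norm_integrable[of C c]]) simp_all
qed

lemma exp_growth_const [intro, simp]: "exp_growth (\<lambda>y. k)"
proof (rule exp_growthI[of _ 0 "\<bar>k\<bar>"])
  show "\<bar>k\<bar> \<le> exp (\<bar>k\<bar> + 0 * norm y)" for y :: 'a
    using exp_ge_add_one_self[of "\<bar>k\<bar>"] by (auto simp del: exp_ge_add_one_self)
qed simp_all

lemma exp_growth_norm [intro, simp]: "exp_growth norm"
proof (rule exp_growthI[of _ 1 0])
  show "\<bar>norm y\<bar> \<le> exp (0 + 1 * norm y)" for y :: 'a
    using exp_ge_add_one_self[of "norm y"] by (auto simp del: exp_ge_add_one_self)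
qed simp_all

lemma exp_growth_bound:
  assumes "exp_growth \<psi>" "\<phi> \<in> borel_measurable borel" "\<And>y. \<bar>\<phi> y\<bar> \<le> \<psi> y"
  shows "exp_growth \<phi>"
proof -
  obtain C c where "0 \<le> c" "\<And>y. \<bar>\<psi> y\<bar> \<le> exp (C + c * norm y)"
    using assms(1) by (rule exp_growthE) blast
  thus ?thesis using assms(2,3)
    by (intro exp_growthI[of _ c C]) (auto intro: order_trans[OF assms(3) order_trans[OF abs_ge_self]])
qed

lemma exp_growth_mult [intro]:
  fixes \<phi> \<psi> :: "'a::euclidean_space \<Rightarrow> real"
  assumes "exp_growth \<phi>" "exp_growth \<psi>"
  shows "exp_growth (\<lambda>y. \<phi> y * \<psi> y)"
proof -
  obtain C c where 1: "0 \<le> c" "\<And>y. \<bar>\<phi> y\<bar> \<le> exp (C + c * norm y)"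
    using assms(1) by (rule exp_growthE) blast
  obtain D d where 2: "0 \<le> d" "\<And>y. \<bar>\<psi> y\<bar> \<le> exp (D + d * norm y)"
    using assms(2) by (rule exp_growthE) blast
  have [measurable]: "\<phi> \<in> borel_measurable borel" "\<psi> \<in> borel_measurable borel"
    using assms by (simp_all add: exp_growth_measurable)
  show ?thesis
  proof (rule exp_growthI[of _ "c + d" "C + D"])
    fix y :: 'a
    have "\<bar>\<phi> y * \<psi> y\<bar> \<le> exp (C + c * norm y) * exp (D + d * norm y)"
      unfolding abs_mult by (intro mult_mono 1 2) auto
    thus "\<bar>\<phi> y * \<psi> y\<bar> \<le> exp (C + D + (c + d) * norm y)"
      by (simp add: exp_add[symmetric] algebra_simps)
  qed (use 1 2 in auto)
qed

lemma exp_growth_add [intro]: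
  fixes \<phi> \<psi> :: "'a::euclidean_space \<Rightarrow> real"
  assumes "exp_growth \<phi>" "exp_growth \<psi>"
  shows "exp_growth (\<lambda>y. \<phi> y + \<psi> y)"
proof -
  obtain C c where 1: "0 \<le> c" "0 \<le> C" "\<And>y. \<bar>\<phi> y\<bar> \<le> exp (C + c * norm y)"
    using assms(1) by (rule exp_growthE) blast
  obtain D d where 2: "0 \<le> d" "0 \<le> D" "\<And>y. \<bar>\<psi> y\<bar> \<le> exp (D + d * norm y)"
    using assms(2) by (rule exp_growthE) blast
  have [measurable]: "\<phi> \<in> borel_measurable borel" "\<psi> \<in> borel_measurable borel"
    using assms by (simp_all add: exp_growth_measurable)
  show ?thesis
  proof (rule exp_growthI[of _ "c + d" "1 + C + D"])
    fix y :: 'a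
    let ?E = "exp (C + D + (c + d) * norm y)"
    have "C + c * norm y \<le> C + D + (c + d) * norm y" "D + d * norm y \<le> C + D + (c + d) * norm y"
      using 1 2 by (simp_all add: algebra_simps)
    hence "\<bar>\<phi> y\<bar> \<le> ?E" "\<bar>\<psi> y\<bar> \<le> ?E"
      using 1(3)[of y] 2(3)[of y] by (meson exp_le_cancel_iff order_trans)+
    hence "\<bar>\<phi> y + \<psi> y\<bar> \<le> 2 * ?E" by linarith
    also have "\<dots> \<le> exp 1 * ?E"
      using exp_ge_add_one_self[of 1] by (intro mult_right_mono) auto
    finally show "\<bar>\<phi> y + \<psi> y\<bar> \<le> exp (1 + C + D + (c + d) * norm y)"
      by (simp add: exp_add[symmetric] algebra_simps)
  qed (use 1 2 in auto)
qed

lemma exp_growth_uminus [intro]: "exp_growth \<phi> \<Longrightarrow> exp_growth (\<lambda>y. - \<phi> y)"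
  using exp_growth_mult[of "\<lambda>_. -1" \<phi>] by simp

lemma exp_growth_diff [intro]:
  "exp_growth \<phi> \<Longrightarrow> exp_growth \<psi> \<Longrightarrow> exp_growth (\<lambda>y. \<phi> y - \<psi> y)"
  using exp_growth_add[of \<phi> "\<lambda>y. - \<psi> y"] by auto

lemma exp_growth_divide [intro]: "exp_growth \<phi> \<Longrightarrow> exp_growth (\<lambda>y. \<phi> y / k)"
  using exp_growth_mult[of \<phi> "\<lambda>_. 1 / k"] by simp

lemma exp_growth_power [intro]: "exp_growth \<phi> \<Longrightarrow> exp_growth (\<lambda>y. \<phi> y ^ k)"
  by (induction k) auto

lemma exp_growth_abs [intro]: "exp_growth \<phi> \<Longrightarrow> exp_growth (\<lambda>y. \<bar>\<phi> y\<bar>)"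
  unfolding exp_growth_def by auto

lemma exp_growth_inner [intro]: "exp_growth (\<lambda>y. u \<bullet> y)"
  by (rule exp_growth_bound[of "\<lambda>y. norm u * norm y"])
     (auto simp: Cauchy_Schwarz_ineq2 intro!: exp_growth_mult)

lemma exp_growth_exp_linear [intro]: "exp_growth (\<lambda>y. exp (C + c * norm y))"
  by (rule exp_growthI[of _ "\<bar>c\<bar>" C]) (auto intro: mult_right_mono)

lemma exp_growth_affine:
  assumes "exp_growth \<phi>"
  shows "exp_growth (\<lambda>y. \<phi> (u + r *\<^sub>R y))"
proof -
  obtain C c where 1: "0 \<le> c" "\<And>y. \<bar>\<phi> y\<bar> \<le> exp (C + c * norm y)"
    using assms by (rule exp_growthE) blast
  have [measurable]: "\<phi> \<in> borel_measurable borel"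
    using assms by (simp add: exp_growth_measurable)
  show ?thesis
  proof (rule exp_growthI[of _ "c * \<bar>r\<bar>" "C + c * norm u"])
    fix y :: 'a
    have "c * norm (u + r *\<^sub>R y) \<le> c * (norm u + \<bar>r\<bar> * norm y)"
      using 1(1) norm_triangle_ineq[of u "r *\<^sub>R y"] by (intro mult_left_mono) auto
    thus "\<bar>\<phi> (u + r *\<^sub>R y)\<bar> \<le> exp (C + c * norm u + c * \<bar>r\<bar> * norm y)"
      by (intro order_trans[OF 1(2)]) (simp add: algebra_simps)
  qed (use 1 in auto)
qed

lemma exp_growth_affine':
  "exp_growth \<phi> \<Longrightarrow> exp_growth (\<lambda>y. \<phi> (y + u))"
  "exp_growth \<phi> \<Longrightarrow> exp_growth (\<lambda>y. \<phi> (r *\<^sub>R y))"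
  using exp_growth_affine[of \<phi> u 1] exp_growth_affine[of \<phi> 0 r] by (simp_all add: add_ac)

section \<open>Lipschitz functions and their exponentials\<close>

lemma lipschitz_measurable:
  fixes f :: "'a::euclidean_space \<Rightarrow> real"
  shows "\<Lambda>-lipschitz_on UNIV f \<Longrightarrow> f \<in> borel_measurable borel"
  by (intro borel_measurable_continuous_onI lipschitz_on_continuous_on)

lemma lipschitz_bound:
  fixes f :: "'a::euclidean_space \<Rightarrow> real"
  assumes "\<Lambda>-lipschitz_on UNIV f"
  shows "\<bar>f x - f y\<bar> \<le> \<Lambda> * norm (x - y)"
  using lipschitz_onD[OF assms, of x y] by (simp add: dist_norm)

lemma lipschitz_growth:
  fixes f :: "'a::euclidean_space \<Rightarrow> real"
  assumes "\<Lambda>-lipschitz_on UNIV f"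
  shows "\<bar>f y\<bar> \<le> \<bar>f 0\<bar> + \<Lambda> * norm y"
  using lipschitz_bound[OF assms, of y 0] by simp

lemma exp_growth_lipschitz:
  fixes f :: "'a::euclidean_space \<Rightarrow> real"
  assumes "\<Lambda>-lipschitz_on UNIV f"
  shows "exp_growth f" "exp_growth (\<lambda>y. exp (f y))" "exp_growth (\<lambda>y. exp (a * f y))"
proof -
  note [measurable] = lipschitz_measurable[OF assms]
  show "exp_growth f"
    by (rule exp_growth_bound[of "\<lambda>y. \<bar>f 0\<bar> + \<Lambda> * norm y"])
       (use lipschitz_growth[OF assms] in \<open>auto intro!: exp_growth_add exp_growth_mult\<close>)
  show *: "exp_growth (\<lambda>y. exp (a * f y))" for a
  proof (rule exp_growth_bound[of "\<lambda>y. exp (\<bar>a\<bar> * \<bar>f 0\<bar> + (\<bar>a\<bar> * \<Lambda>) * norm y)"])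
    fix y :: 'a
    have "a * f y \<le> \<bar>a\<bar> * \<bar>f y\<bar>" by (metis abs_ge_self abs_mult)
    also have "\<dots> \<le> \<bar>a\<bar> * (\<bar>f 0\<bar> + \<Lambda> * norm y)"
      by (intro mult_left_mono lipschitz_growth[OF assms]) auto
    finally show "\<bar>exp (a * f y)\<bar> \<le> exp (\<bar>a\<bar> * \<bar>f 0\<bar> + (\<bar>a\<bar> * \<Lambda>) * norm y)"
      by (simp add: algebra_simps)
  qed auto
  show "exp_growth (\<lambda>y. exp (f y))" using *[of 1] by simp
qed

section \<open>Gaussian integrals under translation, reflection and rotation; the covariance\<close>

lemma integral_gauss_shift:
  fixes \<phi> :: "'a::euclidean_space \<Rightarrow> real"
  assumes [measurable]: "\<phi> \<in> borel_measurable borel"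
  shows "(LINT y|std_gaussian. \<phi> (y + u)) = (LINT y|std_gaussian. \<phi> y * exp (u \<bullet> y - (norm u)\<^sup>2 / 2))"
proof -
  have "(LINT y|std_gaussian. \<phi> (y + u)) = (LINT y|distr std_gaussian borel (\<lambda>y. y + u). \<phi> y)"
    by (simp add: integral_distr)
  also have "\<dots> = (LINT y|std_gaussian. exp (u \<bullet> y - (norm u)\<^sup>2 / 2) *\<^sub>R \<phi> y)"
    unfolding gauss_shift by (rule integral_density) simp_all
  finally show ?thesis by (simp add: mult.commute)
qed

lemma integral_gauss_uminus:
  fixes \<phi> :: "'a::euclidean_space \<Rightarrow> real"
  assumes [measurable]: "\<phi> \<in> borel_measurable borel"
  shows "(LINT y|std_gaussian. \<phi> (- y)) = (LINT y|std_gaussian. \<phi> y)"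
  by (subst (2) gauss_uminus[symmetric]) (simp add: integral_distr)

lemma integral_gauss_inner: "(LINT y|std_gaussian. u \<bullet> y) = 0"
  using integral_gauss_uminus[of "\<lambda>y. u \<bullet> y"] by simp

lemma pair_growth_integrable:
  fixes F :: "'a::euclidean_space \<Rightarrow> 'b::euclidean_space \<Rightarrow> real"
  assumes [measurable]: "(\<lambda>(x, y). F x y) \<in> borel_measurable (borel \<Otimes>\<^sub>M borel)"
    and bound: "\<And>x y. \<bar>F x y\<bar> \<le> exp (C + c * (norm x + norm y))"
  shows "integrable (std_gaussian \<Otimes>\<^sub>M std_gaussian) (\<lambda>(x, y). F x y)"
proof (rule Bochner_Integration.integrable_bound)
  have [simp]: "integrable std_gaussian (\<lambda>x::'a. exp (C + c * norm x))"
    "integrable std_gaussian (\<lambda>x::'b. exp (c * norm x))"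
    using exp_norm_integrable[of C c] exp_norm_integrable[of 0 c] by simp_all
  show "integrable (std_gaussian \<Otimes>\<^sub>M std_gaussian)
      (\<lambda>(x::'a, y::'b). exp (C + c * norm x) * exp (c * norm y))"
    by (intro gauss_pair.Fubini_integrable) (simp_all add: abs_mult)
  show "AE z in std_gaussian \<Otimes>\<^sub>M std_gaussian. norm (case z of (x, y) \<Rightarrow> F x y)
      \<le> norm (case z of (x, y) \<Rightarrow> exp (C + c * norm x) * exp (c * norm y))"
    using bound by (auto simp: exp_add[symmetric] algebra_simps)
qed simp

lemma pair_integral_fst:
  fixes F :: "'a::euclidean_space \<Rightarrow> 'b::euclidean_space \<Rightarrow> real"
  assumes "integrable (std_gaussian \<Otimes>\<^sub>M std_gaussian) (\<lambda>(x, y). F x y)"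
  shows "(LINT x|std_gaussian. (LINT y|std_gaussian. F x y))
       = (LINT z|(std_gaussian \<Otimes>\<^sub>M std_gaussian). (case z of (x, y) \<Rightarrow> F x y))"
  using gauss_pair.integral_fst[OF assms] by simp

text \<open>The two marginals of an exchangeable pair agree, and the first marginal of
  \<open>(X, c X + s Y)\<close> is the law of \<open>X\<close>.\<close>

lemma distr_gauss_rotate:
  fixes c s :: real
  assumes cs: "c\<^sup>2 + s\<^sup>2 = 1" and s: "s > 0"
  shows "distr (std_gaussian \<Otimes>\<^sub>M std_gaussian) borel (\<lambda>(x, y). c *\<^sub>R x + s *\<^sub>R y)
       = (std_gaussian :: 'a::euclidean_space measure)"
proof -
  let ?P = "std_gaussian \<Otimes>\<^sub>M std_gaussian :: ('a \<times> 'a) measure"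
  have [measurable]: "(\<lambda>(x, y). (x, c *\<^sub>R x + s *\<^sub>R y)) \<in> ?P \<rightarrow>\<^sub>M borel"
    "(\<lambda>(x, y). (c *\<^sub>R x + s *\<^sub>R y, x)) \<in> ?P \<rightarrow>\<^sub>M borel"
    "snd \<in> (borel :: ('a \<times> 'a) measure) \<rightarrow>\<^sub>M borel"
    unfolding borel_prod[symmetric] by measurable
  have "distr ?P borel (\<lambda>(x, y). c *\<^sub>R x + s *\<^sub>R y)
      = distr (distr ?P borel (\<lambda>(x, y). (x, c *\<^sub>R x + s *\<^sub>R y))) borel snd"
    by (subst distr_distr) (auto simp: comp_def case_prod_unfold)
  also have "\<dots> = distr ?P borel fst"
    by (subst gauss_exchangeable[OF assms], subst distr_distr) (auto simp: comp_def case_prod_unfold)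
  also have "\<dots> = distr ?P std_gaussian fst"
    by (rule distr_cong) simp_all
  also have "\<dots> = std_gaussian"
    by (rule gauss.distr_pair_fst)
  finally show ?thesis .
qed

lemma gauss_convolution:
  fixes \<phi> :: "'a::euclidean_space \<Rightarrow> real"
  assumes \<phi>: "exp_growth \<phi>" and pq: "p\<^sup>2 + q\<^sup>2 = r\<^sup>2" and "p \<ge> 0" "q \<ge> 0" "r \<ge> 0"
  shows "(LINT x|std_gaussian. (LINT y|std_gaussian. \<phi> (u + p *\<^sub>R x + q *\<^sub>R y)))
       = (LINT x|std_gaussian. \<phi> (u + r *\<^sub>R x))"
proof (cases "q = 0")
  \<comment> \<open>The rotation lemma requires a strictly positive second weight, so
    \<open>q = 0\<close> is treated separately; there \<open>p = r\<close> and the inner integral is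
    constant.\<close>
  case True
  hence "p = r" using assms by (simp add: power2_eq_iff_nonneg)
  thus ?thesis using True by (simp add: gauss.prob_space[simplified])
next
  case False
  hence "q > 0" using assms by simp
  have "r \<noteq> 0" using pq \<open>q > 0\<close> by (auto simp: add_nonneg_eq_0_iff)
  hence "r > 0" using assms by simp
  let ?P = "std_gaussian \<Otimes>\<^sub>M std_gaussian :: ('a \<times> 'a) measure"
  have [measurable]: "\<phi> \<in> borel_measurable borel"
    using \<phi> by (simp add: exp_growth_measurable)
  have D: "distr ?P borel (\<lambda>(x, y). (p / r) *\<^sub>R x + (q / r) *\<^sub>R y) = std_gaussian"
    using pq \<open>q > 0\<close> \<open>r > 0\<close> by (intro distr_gauss_rotate) (auto simp: power_divide simp flip: add_divide_distrib)
  have eq: "u + r *\<^sub>R ((p / r) *\<^sub>R x + (q / r) *\<^sub>R y) = u + p *\<^sub>R x + q *\<^sub>R y" for x y :: 'a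
    using \<open>r > 0\<close> by (simp add: algebra_simps)
  have "integrable (distr ?P borel (\<lambda>(x, y). (p / r) *\<^sub>R x + (q / r) *\<^sub>R y)) (\<lambda>x. \<phi> (u + r *\<^sub>R x))"
    unfolding D using \<phi> by (intro exp_growth_integrable exp_growth_affine)
  hence "integrable ?P (\<lambda>(x, y). \<phi> (u + p *\<^sub>R x + q *\<^sub>R y))"
    by (subst (asm) integrable_distr_eq) (simp_all add: case_prod_unfold eq)
  hence "(LINT x|std_gaussian. (LINT y|std_gaussian. \<phi> (u + p *\<^sub>R x + q *\<^sub>R y)))
      = (LINT z|?P. (case z of (x, y) \<Rightarrow> \<phi> (u + p *\<^sub>R x + q *\<^sub>R y)))"
    by (rule pair_integral_fst)
  also have "\<dots> = (LINT x|distr ?P borel (\<lambda>(x, y). (p / r) *\<^sub>R x + (q / r) *\<^sub>R y). \<phi> (u + r *\<^sub>R x))"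
    by (subst integral_distr) (simp_all add: case_prod_unfold eq)
  finally show ?thesis unfolding D .
qed

text \<open>The majorant factors into a function of \<open>x\<close> and one of \<open>y\<close>, so
  integrating out \<open>y\<close> changes only the constant.\<close>

lemma exp_growth_integral:
  fixes F :: "'a::euclidean_space \<Rightarrow> 'b::euclidean_space \<Rightarrow> real"
  assumes [measurable]: "(\<lambda>(x, y). F x y) \<in> borel_measurable (borel \<Otimes>\<^sub>M borel)"
    and bound: "\<And>x y. \<bar>F x y\<bar> \<le> exp (C + c * (norm x + norm y))" and "c \<ge> 0"
  shows "exp_growth (\<lambda>x. LINT y|std_gaussian. F x y)"
proof (rule exp_growth_bound)
  let ?K = "LINT y|(std_gaussian::'b measure). exp (0 + c * norm y)"
  show "exp_growth (\<lambda>x::'a. exp (C + c * norm x) * ?K)" by auto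
  show "(\<lambda>x. LINT y|std_gaussian. F x y) \<in> borel_measurable borel" by measurable
  fix x
  have b: "\<bar>F x y\<bar> \<le> exp (C + c * norm x) * exp (0 + c * norm y)" for y
    using bound[of x y] by (simp add: exp_add[symmetric] algebra_simps)
  have g: "exp_growth (\<lambda>y::'b. exp (C + c * norm x) * exp (0 + c * norm y))"
    by (intro exp_growth_mult exp_growth_const exp_growth_exp_linear)
  have "\<bar>LINT y|std_gaussian. F x y\<bar> \<le> (LINT y|std_gaussian. \<bar>F x y\<bar>)"
    by (rule integral_abs_bound)
  also have "\<dots> \<le> (LINT y|(std_gaussian::'b measure). exp (C + c * norm x) * exp (0 + c * norm y))"
    by (intro integral_mono exp_growth_integrable g exp_growth_bound[OF g]) (use b in simp_all)
  finally
  show "\<bar>LINT y|std_gaussian. F x y\<bar> \<le> exp (C + c * norm x) * ?K" by simp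
qed

lemma inverse_Suc_at_0: "filterlim (\<lambda>k. 1 / real (Suc k)) (at 0) sequentially"
  unfolding filterlim_at using LIMSEQ_Suc[OF lim_1_over_n[where 'a = real]] by simp

lemma abs_exp_minus_one_le: "\<bar>exp t - 1\<bar> \<le> \<bar>t\<bar> * exp \<bar>t\<bar>" for t :: real
proof (cases "t \<ge> 0")
  case True
  have "1 - t \<le> exp (- t)" using exp_ge_add_one_self[of "-t"] by simp
  hence "exp t * (1 - t) \<le> exp t * exp (- t)" by (intro mult_left_mono) auto
  thus ?thesis using True by (simp add: exp_minus algebra_simps)
next
  case False
  have "1 + t \<le> exp t" by (rule exp_ge_add_one_self)
  moreover have "\<bar>t\<bar> * 1 \<le> \<bar>t\<bar> * exp \<bar>t\<bar>" by (intro mult_left_mono) auto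
  moreover have "\<bar>exp t - 1\<bar> = 1 - exp t" using False by simp
  ultimately show ?thesis using False by linarith
qed

text \<open>The covariance arises by differentiating an exponential moment: the shift formula gives
  E <u, y> exp <w, y> = <u, w> exp (|w|^2 / 2). With w = v / (k + 1), \<open>X k\<close> is the
  integrand of the difference quotient, and dominated convergence passes to the limit.\<close>

lemma integral_gauss_inner_inner:
  fixes u v :: "'a::euclidean_space"
  shows "(LINT y|std_gaussian. (u \<bullet> y) * (v \<bullet> y)) = u \<bullet> v"
proof -
  define X where "X k y = (u \<bullet> y) * ((exp (v \<bullet> y / Suc k) - 1) * Suc k)" for k y
  have "(\<lambda>k. LINT y|std_gaussian. X k y) \<longlonglongrightarrow> (LINT y|std_gaussian. (u \<bullet> y) * (v \<bullet> y))"
  proof (rule integral_dominated_convergence)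
    show "integrable std_gaussian (\<lambda>y::'a. norm u * norm y * (norm v * norm y * exp (0 + norm v * norm y)))"
      by (intro exp_growth_integrable exp_growth_mult exp_growth_const exp_growth_norm exp_growth_exp_linear)
    show "AE y in std_gaussian. norm (X k y) \<le> norm u * norm y * (norm v * norm y * exp (0 + norm v * norm y))" for k
    proof (rule AE_I2)
      fix y :: 'a
      define t where "t = v \<bullet> y / Suc k"
      have vb: "\<bar>v \<bullet> y\<bar> \<le> norm v * norm y" by (rule Cauchy_Schwarz_ineq2)
      have "\<bar>t\<bar> \<le> \<bar>v \<bullet> y\<bar>" unfolding t_def by (simp add: field_simps)
      hence tb: "\<bar>t\<bar> \<le> norm v * norm y" using vb by simp
      have "\<bar>(exp t - 1) * Suc k\<bar> \<le> \<bar>t\<bar> * exp \<bar>t\<bar> * Suc k"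
        unfolding abs_mult using abs_exp_minus_one_le[of t] by (simp add: mult_right_mono)
      also have "\<dots> = \<bar>v \<bullet> y\<bar> * exp \<bar>t\<bar>" unfolding t_def by simp
      also have "\<dots> \<le> norm v * norm y * exp (0 + norm v * norm y)"
        using vb tb by (intro mult_mono) auto
      finally show "norm (X k y) \<le> norm u * norm y * (norm v * norm y * exp (0 + norm v * norm y))"
        unfolding X_def t_def[symmetric] real_norm_def abs_mult[of "u \<bullet> y"]
        by (intro mult_mono Cauchy_Schwarz_ineq2) auto
    qed
    show "AE y in std_gaussian. (\<lambda>k. X k y) \<longlonglongrightarrow> (u \<bullet> y) * (v \<bullet> y)"
    proof (rule AE_I2)
      fix y :: 'a
      have "((\<lambda>t. exp (v \<bullet> y * t)) has_real_derivative v \<bullet> y) (at 0)"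
        by (auto intro!: derivative_eq_intros)
      hence "((\<lambda>h. (exp (v \<bullet> y * h) - 1) / h) \<longlongrightarrow> v \<bullet> y) (at 0)"
        by (simp add: DERIV_def)
      hence "(\<lambda>k. (exp (v \<bullet> y * (1 / real (Suc k))) - 1) / (1 / real (Suc k))) \<longlonglongrightarrow> v \<bullet> y"
        using inverse_Suc_at_0 by (rule filterlim_compose)
      thus "(\<lambda>k. X k y) \<longlonglongrightarrow> (u \<bullet> y) * (v \<bullet> y)"
        unfolding X_def by (intro tendsto_mult tendsto_const) simp
    qed
  qed (simp_all add: X_def)
  moreover have "(LINT y|std_gaussian. X k y) = (u \<bullet> v) * exp ((norm v / Suc k)\<^sup>2 / 2)" for k
  proof -
    define w where "w = (1 / Suc k) *\<^sub>R v"
    have "(LINT y|std_gaussian. (u \<bullet> y) * exp (w \<bullet> y - (norm w)\<^sup>2 / 2)) = (LINT y|std_gaussian. u \<bullet> (y + w))"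
      by (rule integral_gauss_shift[symmetric]) simp
    also have "\<dots> = u \<bullet> w"
      unfolding inner_add_right
      by (subst Bochner_Integration.integral_add) (auto intro: exp_growth_integrable simp: integral_gauss_inner gauss.prob_space[simplified])
    finally have *: "(LINT y|std_gaussian. (u \<bullet> y) * exp (w \<bullet> y)) = (u \<bullet> w) * exp ((norm w)\<^sup>2 / 2)"
      unfolding exp_diff times_divide_eq_right by (simp add: divide_eq_eq)
    have i1: "integrable std_gaussian (\<lambda>y. (u \<bullet> y) * exp (w \<bullet> y))"
    proof (intro exp_growth_integrable exp_growth_mult exp_growth_inner)
      show "exp_growth (\<lambda>y. exp (w \<bullet> y))"
        by (rule exp_growthI[of _ "norm w" 0]) (auto simp: norm_cauchy_schwarz)
    qed
    have "(LINT y|std_gaussian. X k y)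
        = (LINT y|std_gaussian. real (Suc k) * ((u \<bullet> y) * exp (w \<bullet> y) - u \<bullet> y))"
      by (intro Bochner_Integration.integral_cong refl) (simp add: X_def w_def algebra_simps)
    also have "\<dots> = real (Suc k) * ((u \<bullet> w) * exp ((norm w)\<^sup>2 / 2))"
      using i1 by (subst integral_mult_right_zero, subst Bochner_Integration.integral_diff)
        (auto intro: exp_growth_integrable simp: integral_gauss_inner *)
    finally show ?thesis by (simp add: w_def del: of_nat_Suc)
  qed
  moreover have "(\<lambda>k. (u \<bullet> v) * exp ((norm v / real (Suc k))\<^sup>2 / 2)) \<longlonglongrightarrow> (u \<bullet> v) * exp (0\<^sup>2 / 2)"
    by (intro tendsto_intros LIMSEQ_Suc lim_const_over_n) auto
  ultimately show ?thesis using LIMSEQ_unique by force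
qed

section \<open>The logarithmic heat flow\<close>

lemma exp_taylor2:
  fixes y :: real
  shows "\<bar>exp y - 1 - y\<bar> \<le> y\<^sup>2 / 2 * exp \<bar>y\<bar>"
proof -
  obtain t where t: "\<bar>t\<bar> \<le> \<bar>y\<bar>" "exp y = (\<Sum>m<2. y ^ m / fact m) + exp t / fact 2 * y ^ 2"
    using Maclaurin_exp_le[of y 2] by blast
  have "exp y - 1 - y = exp t * (y\<^sup>2 / 2)"
    using t(2) by (simp add: lessThan_nat_numeral lessThan_Suc numeral_2_eq_2 fact_2)
  moreover have "exp t * (y\<^sup>2 / 2) \<le> exp \<bar>y\<bar> * (y\<^sup>2 / 2)"
    using t(1) by (intro mult_right_mono) auto
  moreover have "0 \<le> exp t * (y\<^sup>2 / 2)" by simp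
  ultimately show ?thesis by (simp only: abs_of_nonneg mult.commute)
qed

lemma (in prob_space) exp_expectation_le:
  fixes Y :: "'a \<Rightarrow> real"
  assumes "integrable M Y" "integrable M (\<lambda>x. exp (Y x))"
  shows "exp (expectation Y) \<le> expectation (\<lambda>x. exp (Y x))"
proof -
  define m where "m = expectation Y"
  have "exp m = expectation (\<lambda>x. exp m * (1 + (Y x - m)))"
    using assms(1) by (simp add: m_def prob_space)
  also have "\<dots> \<le> expectation (\<lambda>x. exp (Y x))"
  proof (rule integral_mono)
    fix x
    have "exp m * (1 + (Y x - m)) \<le> exp m * exp (Y x - m)"
      by (intro mult_left_mono exp_ge_add_one_self) auto
    thus "exp m * (1 + (Y x - m)) \<le> exp (Y x)" by (simp add: exp_diff)
  qed (use assms in auto)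
  finally show ?thesis by (simp add: m_def)
qed

lemma (in prob_space) expectation_exp_pos:
  fixes Y :: "'a \<Rightarrow> real"
  assumes "integrable M Y" "integrable M (\<lambda>x. exp (Y x))"
  shows "expectation (\<lambda>x. exp (Y x)) > 0"
  using exp_expectation_le[OF assms] exp_gt_zero[of "expectation Y"] by linarith

lemma (in prob_space) expectation_le_ln_exp:
  fixes Y :: "'a \<Rightarrow> real"
  assumes "integrable M Y" "integrable M (\<lambda>x. exp (Y x))"
  shows "expectation Y \<le> ln (expectation (\<lambda>x. exp (Y x)))"
  using exp_expectation_le[OF assms] expectation_exp_pos[OF assms]
  by (simp add: ln_ge_iff)

text \<open>Converse of Jensen's inequality up to a quadratic error, from ln t \<le> t - 1 and the
  second-order expansion of exp. As the error is quadratic in \<open>Y\<close>, a \<open>Y\<close>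
  of order \<sigma>^2 costs only order \<sigma>^4.\<close>

lemma (in prob_space) ln_exp_le:
  fixes Y :: "'a \<Rightarrow> real"
  assumes "integrable M Y" "integrable M (\<lambda>x. exp (Y x))"
    and "integrable M (\<lambda>x. (Y x)\<^sup>2 * exp \<bar>Y x\<bar>)"
  shows "ln (expectation (\<lambda>x. exp (Y x))) \<le> expectation Y + expectation (\<lambda>x. (Y x)\<^sup>2 * exp \<bar>Y x\<bar>) / 2"
proof -
  have "ln (expectation (\<lambda>x. exp (Y x))) \<le> expectation (\<lambda>x. exp (Y x)) - 1"
    using expectation_exp_pos[OF assms(1,2)] by (rule ln_le_minus_one)
  also have "expectation (\<lambda>x. exp (Y x)) \<le> expectation (\<lambda>x. 1 + Y x + (Y x)\<^sup>2 * exp \<bar>Y x\<bar> / 2)"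
  proof (rule integral_mono)
    show "exp (Y x) \<le> 1 + Y x + (Y x)\<^sup>2 * exp \<bar>Y x\<bar> / 2" for x
      using exp_taylor2[of "Y x"] by linarith
  qed (use assms in auto)
  also have "\<dots> = 1 + expectation Y + expectation (\<lambda>x. (Y x)\<^sup>2 * exp \<bar>Y x\<bar>) / 2"
    using assms by (simp add: prob_space)
  finally show ?thesis by simp
qed

text \<open>One half of the Gibbs variational principle, for translates of the Gaussian: the law of
  \<open>y + u\<close> has relative entropy |u|^2 / 2, and the rest is Jensen's inequality.
  Translates suffice because the drift is frozen during each time step.\<close>

lemma gauss_gibbs:
  fixes H :: "'a::euclidean_space \<Rightarrow> real"
  assumes H: "\<Lambda>-lipschitz_on UNIV H"
  shows "(LINT y|std_gaussian. H (y + u)) - (norm u)\<^sup>2 / 2 \<le> ln (LINT y|std_gaussian. exp (H y))"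
proof -
  note [measurable] = lipschitz_measurable[OF H]
  let ?Y = "\<lambda>y. H (y + u) - u \<bullet> y - (norm u)\<^sup>2 / 2"
  have "(LINT y|std_gaussian. exp (H (y + u)) * exp (- (u \<bullet> (y + u)) + (norm u)\<^sup>2 / 2))
      = (LINT y|std_gaussian. exp (H y) * exp (- (u \<bullet> y) + (norm u)\<^sup>2 / 2) * exp (u \<bullet> y - (norm u)\<^sup>2 / 2))"
    by (rule integral_gauss_shift[where \<phi> = "\<lambda>y. exp (H y) * exp (- (u \<bullet> y) + (norm u)\<^sup>2 / 2)"]) measurable
  hence eq: "(LINT y|std_gaussian. exp (?Y y)) = (LINT y|std_gaussian. exp (H y))"
    by (simp add: exp_add[symmetric] mult.assoc inner_add_right power2_norm_eq_inner[symmetric] algebra_simps)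
  have gY: "exp_growth ?Y"
    by (intro exp_growth_diff exp_growth_inner exp_growth_const exp_growth_affine'(1) exp_growth_lipschitz(1)[OF H])
  have "exp_growth (\<lambda>y. exp (H (y + u)) * exp (0 + norm u * norm y))"
    by (intro exp_growth_mult exp_growth_exp_linear exp_growth_affine'(1)[where \<phi> = "\<lambda>y. exp (H y)"] exp_growth_lipschitz(2)[OF H])
  hence geY: "exp_growth (\<lambda>y. exp (?Y y))"
  proof (rule exp_growth_bound)
    fix y
    have "- (u \<bullet> y) - (norm u)\<^sup>2 / 2 \<le> norm u * norm y"
      using Cauchy_Schwarz_ineq2[of u y] zero_le_power2[of "norm u"] by linarith
    thus "\<bar>exp (?Y y)\<bar> \<le> exp (H (y + u)) * exp (0 + norm u * norm y)"
      unfolding exp_add[symmetric] by simp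
  qed simp
  have "(LINT y|std_gaussian. ?Y y) \<le> ln (LINT y|std_gaussian. exp (?Y y))"
    by (intro gauss.expectation_le_ln_exp exp_growth_integrable gY geY)
  moreover have "(LINT y|std_gaussian. ?Y y) = (LINT y|std_gaussian. H (y + u)) - (norm u)\<^sup>2 / 2"
    using exp_growth_integrable[OF exp_growth_affine'(1)[OF exp_growth_lipschitz(1)[OF H]], of u]
      exp_growth_integrable[OF exp_growth_inner[of u]]
    by (simp add: integral_gauss_inner gauss.prob_space[simplified])
  ultimately show ?thesis by (simp add: eq)
qed

lemma lipschitz_affine:
  fixes f :: "'a::euclidean_space \<Rightarrow> real"
  assumes "\<Lambda>-lipschitz_on UNIV f"
  shows "(\<Lambda> * \<bar>r\<bar>)-lipschitz_on UNIV (\<lambda>y. f (u + r *\<^sub>R y))"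
proof (rule lipschitz_onI)
  show "dist (f (u + r *\<^sub>R x)) (f (u + r *\<^sub>R y)) \<le> \<Lambda> * \<bar>r\<bar> * dist x y" for x y
  proof -
    have "dist (f (u + r *\<^sub>R x)) (f (u + r *\<^sub>R y)) \<le> \<Lambda> * dist (u + r *\<^sub>R x) (u + r *\<^sub>R y)"
      by (rule lipschitz_onD[OF assms]) auto
    also have "dist (u + r *\<^sub>R x) (u + r *\<^sub>R y) = \<bar>r\<bar> * dist x y"
      by (simp add: dist_norm flip: scaleR_diff_right)
    finally show ?thesis by simp
  qed
  show "0 \<le> \<Lambda> * \<bar>r\<bar>" using lipschitz_on_nonneg[OF assms] by simp
qed

lemma exp_growth_lipschitz_affine:
  fixes f :: "'a::euclidean_space \<Rightarrow> real"
  assumes "\<Lambda>-lipschitz_on UNIV f"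
  shows "exp_growth (\<lambda>y. f (u + r *\<^sub>R y))" "exp_growth (\<lambda>y. exp (f (u + r *\<^sub>R y)))"
    "exp_growth (\<lambda>y. exp (a * f (u + r *\<^sub>R y)))"
  using exp_growth_lipschitz[OF lipschitz_affine[OF assms, where u = u and r = r]] by auto

text \<open>The Hopf-Cole transform of the heat flow, which is the value function of the control
  problem. The parameter is a standard deviation, so \<open>\<sigma>\<^sup>2\<close> plays the role
  of time, and composition adds squares.\<close>

definition log_heat :: "real \<Rightarrow> ('a::euclidean_space \<Rightarrow> real) \<Rightarrow> 'a \<Rightarrow> real" where
  "log_heat \<sigma> f x = ln (LINT y|std_gaussian. exp (f (x + \<sigma> *\<^sub>R y)))"

lemma integral_exp_lipschitz_pos:
  fixes f :: "'a::euclidean_space \<Rightarrow> real"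
  assumes "\<Lambda>-lipschitz_on UNIV f"
  shows "0 < (LINT y|std_gaussian. exp (f (x + \<sigma> *\<^sub>R y)))"
  by (intro gauss.expectation_exp_pos exp_growth_integrable exp_growth_lipschitz_affine[OF assms])

text \<open>Shifting the Gaussian by \<open>\<sigma> w\<close> absorbs the linear term of \<open>g\<close> exactly, so only the remainder
  \<open>Z = O(\<sigma>\<^sup>2)\<close> is left and the error is \<open>ln E exp Z - E Z = O(\<sigma>\<^sup>4)\<close>.\<close>
lemma log_heat_step:
  fixes g :: "'a::euclidean_space \<Rightarrow> real"
  assumes g: "\<Lambda>-lipschitz_on UNIV g"
    and quad: "\<And>h. \<bar>g (x + h) - g x - w \<bullet> h\<bar> \<le> M * (norm h)\<^sup>2"
    and w: "norm w \<le> W" and \<sigma>: "0 \<le> \<sigma>" "\<sigma> \<le> s0" and "M \<ge> 0"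
  shows "log_heat \<sigma> g x \<le> (LINT y|std_gaussian. g (x + \<sigma>\<^sup>2 *\<^sub>R w + \<sigma> *\<^sub>R y)) - \<sigma>\<^sup>2 * (norm w)\<^sup>2 / 2
     + \<sigma> ^ 4 * (LINT y|(std_gaussian :: 'a measure).
          M\<^sup>2 * (norm y + s0 * W) ^ 4 * exp ((\<Lambda> + W) * s0 * (s0 * W) + (\<Lambda> + W) * s0 * norm y)) / 2"
proof -
  note [measurable] = lipschitz_measurable[OF g]
  define Z where "Z h = g (x + h) - g x - w \<bullet> h" for h
  have [measurable]: "Z \<in> borel_measurable borel" unfolding Z_def by measurable
  define k where "k y = \<sigma> *\<^sub>R y + \<sigma>\<^sup>2 *\<^sub>R w" for y
  define Y where "Y y = Z (k y)" for y
  have [measurable]: "Y \<in> borel_measurable borel" unfolding Y_def k_def by measurable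
  have "W \<ge> 0" using w norm_ge_zero[of w] by linarith
  have "\<Lambda> \<ge> 0" using g by (rule lipschitz_on_nonneg)
  have "s0 \<ge> 0" using \<sigma> by simp
  have knorm: "norm (k y) \<le> \<sigma> * (norm y + s0 * W)" for y
  proof -
    have "norm (k y) \<le> \<sigma> * norm y + \<sigma>\<^sup>2 * norm w"
      unfolding k_def using \<sigma> by (metis abs_of_nonneg norm_scaleR norm_triangle_ineq zero_le_power2)
    also have "\<sigma>\<^sup>2 * norm w \<le> \<sigma> * (s0 * W)"
      unfolding power2_eq_square mult.assoc using \<sigma> w \<open>s0 \<ge> 0\<close> by (intro mult_left_mono mult_mono) auto
    finally show ?thesis by (simp add: algebra_simps)
  qed
  have knorm': "norm (k y) \<le> s0 * (norm y + s0 * W)" for y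
    by (rule order_trans[OF knorm mult_right_mono]) (use \<sigma> \<open>W \<ge> 0\<close> in auto)
  have Z1: "\<bar>Z h\<bar> \<le> M * (norm h)\<^sup>2" for h unfolding Z_def by (rule quad)
  \<comment> \<open>Inside an exponential the quadratic bound could outgrow the Gaussian weight.
    This linear bound keeps \<open>exp \<bar>Y y\<bar>\<close> integrable, and the quadratic one is
    used only for the factor \<open>(Y y)\<^sup>2\<close>.\<close>
  have Z2: "\<bar>Z h\<bar> \<le> (\<Lambda> + W) * norm h" for h
  proof -
    have "\<bar>g (x + h) - g x\<bar> \<le> \<Lambda> * norm h" using lipschitz_bound[OF g, of "x + h" x] by simp
    moreover have "\<bar>w \<bullet> h\<bar> \<le> W * norm h"
      using Cauchy_Schwarz_ineq2[of w h] mult_right_mono[OF w norm_ge_zero[of h]] by linarith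
    ultimately show ?thesis unfolding Z_def by (simp add: algebra_simps)
  qed
  have gg: "exp_growth (\<lambda>y. g (x + \<sigma>\<^sup>2 *\<^sub>R w + \<sigma> *\<^sub>R y))"
    by (rule exp_growth_lipschitz_affine[OF g])
  have Yalt: "Y y = g (x + \<sigma>\<^sup>2 *\<^sub>R w + \<sigma> *\<^sub>R y) - g x - \<sigma> *\<^sub>R w \<bullet> y - \<sigma>\<^sup>2 * (norm w)\<^sup>2" for y
    unfolding Y_def Z_def k_def by (simp add: inner_add_right power2_norm_eq_inner add_ac)
  have gY: "exp_growth Y"
    unfolding Yalt[abs_def] by (intro exp_growth_diff exp_growth_inner exp_growth_const gg)
  let ?ee = "\<lambda>y::'a. exp ((\<Lambda> + W) * s0 * (s0 * W) + (\<Lambda> + W) * s0 * norm y)"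
  have absY: "exp \<bar>Y y\<bar> \<le> ?ee y" for y
  proof -
    have "\<bar>Y y\<bar> \<le> (\<Lambda> + W) * (s0 * (norm y + s0 * W))"
      unfolding Y_def using Z2[of "k y"] mult_left_mono[OF knorm'[of y], of "\<Lambda> + W"] \<open>\<Lambda> \<ge> 0\<close> \<open>W \<ge> 0\<close> by linarith
    thus ?thesis by (simp add: algebra_simps)
  qed
  have geY: "exp_growth (\<lambda>y. exp \<bar>Y y\<bar>)"
    by (rule exp_growth_bound[OF exp_growth_exp_linear]) (use absY in auto)
  hence geY': "exp_growth (\<lambda>y. exp (Y y))"
    by (rule exp_growth_bound) auto
  \<comment> \<open>The majorant is free of \<open>x\<close>, \<open>w\<close> and
    \<open>\<sigma>\<close>, so one integral bounds the error of every time step.\<close>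
  let ?D = "\<lambda>y::'a. M\<^sup>2 * (norm y + s0 * W) ^ 4 * ?ee y"
  have gD: "exp_growth ?D"
    by (intro exp_growth_mult exp_growth_const exp_growth_power exp_growth_add exp_growth_norm exp_growth_exp_linear)
  have Ysq: "(Y y)\<^sup>2 * exp \<bar>Y y\<bar> \<le> \<sigma> ^ 4 * ?D y" for y
  proof -
    have "\<bar>Y y\<bar> \<le> M * (\<sigma> * (norm y + s0 * W))\<^sup>2"
      unfolding Y_def using Z1[of "k y"] mult_left_mono[OF power_mono[OF knorm[of y], of 2] \<open>M \<ge> 0\<close>] by simp
    hence "(Y y)\<^sup>2 \<le> (M * (\<sigma> * (norm y + s0 * W))\<^sup>2)\<^sup>2"
      by (metis abs_ge_zero power2_abs power_mono)
    also have "\<dots> = \<sigma> ^ 4 * (M\<^sup>2 * (norm y + s0 * W) ^ 4)"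
      by (simp add: power_mult_distrib flip: power_mult)
    finally have "(Y y)\<^sup>2 * exp \<bar>Y y\<bar> \<le> \<sigma> ^ 4 * (M\<^sup>2 * (norm y + s0 * W) ^ 4) * ?ee y"
      by (intro mult_mono absY) auto
    thus ?thesis by (simp add: mult_ac)
  qed
  have "(LINT y|std_gaussian. exp (g (x + \<sigma> *\<^sub>R y)))
      = (LINT y|std_gaussian. exp (g x) * (exp (Z (\<sigma> *\<^sub>R y)) * exp (\<sigma> *\<^sub>R w \<bullet> y)))"
    by (intro Bochner_Integration.integral_cong refl) (simp add: Z_def flip: exp_add)
  also have "\<dots> = exp (g x) * (LINT y|std_gaussian. exp (Z (\<sigma> *\<^sub>R y)) * exp (\<sigma> *\<^sub>R w \<bullet> y))"
    by simp
  also have "(LINT y|std_gaussian. exp (Z (\<sigma> *\<^sub>R y)) * exp (\<sigma> *\<^sub>R w \<bullet> y))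
      = (LINT y|std_gaussian. exp ((norm (\<sigma> *\<^sub>R w))\<^sup>2 / 2) * (exp (Z (\<sigma> *\<^sub>R y)) * exp (\<sigma> *\<^sub>R w \<bullet> y - (norm (\<sigma> *\<^sub>R w))\<^sup>2 / 2)))"
    by (intro Bochner_Integration.integral_cong refl) (simp flip: exp_add)
  also have "\<dots> = exp ((norm (\<sigma> *\<^sub>R w))\<^sup>2 / 2) * (LINT y|std_gaussian. exp (Z (\<sigma> *\<^sub>R (y + \<sigma> *\<^sub>R w))))"
    by (subst integral_gauss_shift[where \<phi> = "\<lambda>y. exp (Z (\<sigma> *\<^sub>R y))"]) simp_all
  also have "(LINT y|std_gaussian. exp (Z (\<sigma> *\<^sub>R (y + \<sigma> *\<^sub>R w)))) = (LINT y|std_gaussian. exp (Y y))"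
    by (simp add: Y_def k_def scaleR_add_right power2_eq_square)
  finally have "log_heat \<sigma> g x = ln (exp (g x + (norm (\<sigma> *\<^sub>R w))\<^sup>2 / 2) * (LINT y|std_gaussian. exp (Y y)))"
    unfolding log_heat_def by (simp add: exp_add mult.assoc)
  also have "\<dots> = g x + \<sigma>\<^sup>2 * (norm w)\<^sup>2 / 2 + ln (LINT y|std_gaussian. exp (Y y))"
    using gauss.expectation_exp_pos[OF exp_growth_integrable[OF gY] exp_growth_integrable[OF geY']]
    by (subst ln_mult) (simp_all add: power_mult_distrib)
  also have "ln (LINT y|std_gaussian. exp (Y y))
      \<le> (LINT y|std_gaussian. Y y) + (LINT y|std_gaussian. (Y y)\<^sup>2 * exp \<bar>Y y\<bar>) / 2"
    by (intro gauss.ln_exp_le exp_growth_integrable gY geY' exp_growth_mult exp_growth_power geY)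
  also have "(LINT y|std_gaussian. (Y y)\<^sup>2 * exp \<bar>Y y\<bar>) \<le> (LINT y|std_gaussian. \<sigma> ^ 4 * ?D y)"
    by (intro integral_mono exp_growth_integrable gY geY exp_growth_mult[of _ ?D] gD exp_growth_mult[of "\<lambda>y. (Y y)\<^sup>2"] exp_growth_power exp_growth_const Ysq)
  also have "(LINT y|std_gaussian. \<sigma> ^ 4 * ?D y) = \<sigma> ^ 4 * (LINT y|std_gaussian. ?D y)"
    by simp
  also have "(LINT y|std_gaussian. Y y)
      = (LINT y|std_gaussian. g (x + \<sigma>\<^sup>2 *\<^sub>R w + \<sigma> *\<^sub>R y)) - g x - \<sigma>\<^sup>2 * (norm w)\<^sup>2"
    unfolding Yalt[abs_def]
    using exp_growth_integrable[OF gg] exp_growth_integrable[OF exp_growth_inner[of "\<sigma> *\<^sub>R w"]]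
    by (simp add: integral_gauss_inner gauss.prob_space[simplified] del: inner_scaleR_left)
  finally show ?thesis by (simp add: algebra_simps)
qed

lemma log_heat_0 [simp]: "log_heat 0 f x = f x"
  by (simp add: log_heat_def gauss.prob_space[simplified])

text \<open>An increment of the logarithmic heat flow is the log-Laplace transform of an increment
  of \<open>f\<close> under the tilted measure \<open>\<mu> x\<close>. The Lipschitz bound therefore
  passes through, and Jensen's inequality together with its converse \<open>ln_exp_le\<close>
  transfers the quadratic remainder. The resulting constant does not depend on
  \<open>\<sigma>\<close>, so it is available at every time of the discretisation.\<close>

lemma
  fixes f :: "'a::euclidean_space \<Rightarrow> real"
  assumes f: "\<Lambda>-lipschitz_on UNIV f"
  shows log_heat_lipschitz: "\<Lambda>-lipschitz_on UNIV (log_heat \<sigma> f)"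
    and log_heat_quad: "w \<in> borel_measurable borel \<Longrightarrow> (\<And>x. norm (w x) \<le> W) \<Longrightarrow> M \<ge> 0 \<Longrightarrow>
      (\<And>x h. \<bar>f (x + h) - f x - w x \<bullet> h\<bar> \<le> M * (norm h)\<^sup>2) \<Longrightarrow>
      \<exists>v. norm v \<le> W \<and> (\<forall>h. \<bar>log_heat \<sigma> f (x + h) - log_heat \<sigma> f x - v \<bullet> h\<bar>
         \<le> (M + \<Lambda>\<^sup>2 / 2 * exp \<Lambda> + \<Lambda> + W) * (norm h)\<^sup>2)"
proof -
  note [measurable] = lipschitz_measurable[OF f]
  have \<Lambda>: "\<Lambda> \<ge> 0" using f by (rule lipschitz_on_nonneg)
  define Zc where "Zc x = (LINT y|std_gaussian. exp (f (x + \<sigma> *\<^sub>R y)))" for x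
  have Zpos: "Zc x > 0" for x unfolding Zc_def by (rule integral_exp_lipschitz_pos[OF f])
  define \<mu> where "\<mu> x = density std_gaussian (\<lambda>y. ennreal (exp (f (x + \<sigma> *\<^sub>R y)) / Zc x))" for x
  have [simp, measurable_cong]: "sets (\<mu> x) = sets borel" for x by (simp add: \<mu>_def)
  have [simp]: "space (\<mu> x) = UNIV" for x by (simp add: \<mu>_def)
  have "prob_space (\<mu> x)" for x
  proof
    have "emeasure (\<mu> x) (space (\<mu> x)) = (\<integral>\<^sup>+y. ennreal (exp (f (x + \<sigma> *\<^sub>R y)) / Zc x) \<partial>std_gaussian)"
      unfolding \<mu>_def by (simp add: emeasure_density)
    also have "\<dots> = ennreal (LINT y|std_gaussian. exp (f (x + \<sigma> *\<^sub>R y)) / Zc x)"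
      by (intro nn_integral_eq_integral exp_growth_integrable exp_growth_divide exp_growth_lipschitz_affine[OF f])
         (simp add: Zpos less_imp_le)
    also have "\<dots> = 1" using Zpos[of x] by (simp add: Zc_def)
    finally show "emeasure (\<mu> x) (space (\<mu> x)) = 1" .
  qed
  then interpret P: prob_space "\<mu> x" for x .
  define Y where "Y x h y = f (x + h + \<sigma> *\<^sub>R y) - f (x + \<sigma> *\<^sub>R y)" for x h y
  have [measurable]: "Y x h \<in> borel_measurable borel" for x h unfolding Y_def by measurable
  have Yb: "\<bar>Y x h y\<bar> \<le> \<Lambda> * norm h" for x h y
    using lipschitz_bound[OF f, of "x + h + \<sigma> *\<^sub>R y" "x + \<sigma> *\<^sub>R y"] by (simp add: Y_def)
  have inc: "log_heat \<sigma> f (x + h) - log_heat \<sigma> f x = ln (LINT y|\<mu> x. exp (Y x h y))" for x h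
  proof -
    have "(LINT y|\<mu> x. exp (Y x h y)) = (LINT y|std_gaussian. (exp (f (x + \<sigma> *\<^sub>R y)) / Zc x) *\<^sub>R exp (Y x h y))"
      unfolding \<mu>_def using Zpos[of x] by (intro integral_density) (simp_all add: less_imp_le)
    also have "\<dots> = (LINT y|std_gaussian. exp (f (x + h + \<sigma> *\<^sub>R y)) / Zc x)"
      by (intro Bochner_Integration.integral_cong refl) (simp add: Y_def exp_diff)
    also have "\<dots> = Zc (x + h) / Zc x" by (simp add: Zc_def)
    finally show ?thesis
      using Zpos[of x] Zpos[of "x + h"] by (simp add: log_heat_def ln_div Zc_def)
  qed
  have iY: "integrable (\<mu> x) (Y x h)" for x h
    by (rule P.integrable_const_bound[of _ "\<Lambda> * norm h"]) (use Yb in auto)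
  have ieY: "integrable (\<mu> x) (\<lambda>y. exp (Y x h y))" for x h
  proof (rule P.integrable_const_bound[of _ "exp (\<Lambda> * norm h)"])
    show "AE y in \<mu> x. norm (exp (Y x h y)) \<le> exp (\<Lambda> * norm h)"
      using Yb[of x h] by (auto intro: order_trans[OF abs_ge_self])
  qed simp
  have bnd: "\<bar>log_heat \<sigma> f (x + h) - log_heat \<sigma> f x\<bar> \<le> \<Lambda> * norm h" for x h
  proof -
    have "(LINT y|\<mu> x. exp (Y x h y)) \<le> (LINT y|\<mu> x. exp (\<Lambda> * norm h))"
      using Yb[of x h] by (intro integral_mono ieY) (auto intro: order_trans[OF abs_ge_self])
    hence u: "(LINT y|\<mu> x. exp (Y x h y)) \<le> exp (\<Lambda> * norm h)"
      using P.prob_space[of x] by simp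
    have "(LINT y|\<mu> x. exp (- (\<Lambda> * norm h))) \<le> (LINT y|\<mu> x. exp (Y x h y))"
      using Yb[of x h] by (intro integral_mono ieY) (auto simp: abs_le_iff minus_le_iff)
    hence l: "exp (- (\<Lambda> * norm h)) \<le> (LINT y|\<mu> x. exp (Y x h y))"
      using P.prob_space[of x] by simp
    have pos: "(LINT y|\<mu> x. exp (Y x h y)) > 0" using l exp_gt_zero less_le_trans by blast
    have "ln (LINT y|\<mu> x. exp (Y x h y)) \<le> \<Lambda> * norm h" using u pos ln_le_cancel_iff[OF pos exp_gt_zero] by simp
    moreover have "- (\<Lambda> * norm h) \<le> ln (LINT y|\<mu> x. exp (Y x h y))" using l pos by (simp add: ln_ge_iff)
    ultimately show ?thesis unfolding inc by linarith
  qed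
  show "\<Lambda>-lipschitz_on UNIV (log_heat \<sigma> f)"
  proof (rule lipschitz_onI[OF _ \<Lambda>])
    show "dist (log_heat \<sigma> f x) (log_heat \<sigma> f y) \<le> \<Lambda> * dist x y" for x y
      using bnd[of y "x - y"] by (simp add: dist_norm)
  qed
  assume w [measurable]: "w \<in> borel_measurable borel" and W: "\<And>x. norm (w x) \<le> W" and M: "M \<ge> 0"
    and quad: "\<And>x h. \<bar>f (x + h) - f x - w x \<bullet> h\<bar> \<le> M * (norm h)\<^sup>2"
  have W0: "W \<ge> 0" using W[of 0] norm_ge_zero[of "w 0"] by linarith
  have iw: "integrable (\<mu> x) (\<lambda>y. w (x + \<sigma> *\<^sub>R y))"
    by (rule P.integrable_const_bound[of _ W]) (use W in auto)
  \<comment> \<open>Formally, differentiating the logarithm of the integral gives the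
    \<open>\<mu> x\<close>-mean of the gradient field of \<open>f\<close>; \<open>v\<close> is this
    mean for the substitute gradient \<open>w\<close>.\<close>
  define v where "v = (LINT y|\<mu> x. w (x + \<sigma> *\<^sub>R y))"
  show "\<exists>v. norm v \<le> W \<and> (\<forall>h. \<bar>log_heat \<sigma> f (x + h) - log_heat \<sigma> f x - v \<bullet> h\<bar>
         \<le> (M + \<Lambda>\<^sup>2 / 2 * exp \<Lambda> + \<Lambda> + W) * (norm h)\<^sup>2)"
  proof (intro exI[of _ v] conjI allI)
    have "norm v \<le> (LINT y|\<mu> x. norm (w (x + \<sigma> *\<^sub>R y)))"
      unfolding v_def by (rule integral_norm_bound)
    also have "\<dots> \<le> (LINT y|\<mu> x. W)"
      using W by (intro integral_mono integrable_norm iw) auto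
    finally show v: "norm v \<le> W" using P.prob_space[of x] by simp
    fix h
    let ?d = "log_heat \<sigma> f (x + h) - log_heat \<sigma> f x"
    show "\<bar>?d - v \<bullet> h\<bar> \<le> (M + \<Lambda>\<^sup>2 / 2 * exp \<Lambda> + \<Lambda> + W) * (norm h)\<^sup>2"
    proof (cases "norm h \<le> 1")
      case True
      have vh: "v \<bullet> h = (LINT y|\<mu> x. w (x + \<sigma> *\<^sub>R y) \<bullet> h)"
        unfolding v_def using iw by simp
      have "\<bar>(LINT y|\<mu> x. Y x h y) - v \<bullet> h\<bar> = \<bar>LINT y|\<mu> x. Y x h y - w (x + \<sigma> *\<^sub>R y) \<bullet> h\<bar>"
        unfolding vh using iY iw by simp
      also have "\<dots> \<le> (LINT y|\<mu> x. \<bar>Y x h y - w (x + \<sigma> *\<^sub>R y) \<bullet> h\<bar>)"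
        by (rule integral_abs_bound)
      also have "\<dots> \<le> (LINT y|\<mu> x. M * (norm h)\<^sup>2)"
      proof (rule integral_mono)
        show "\<bar>Y x h y - w (x + \<sigma> *\<^sub>R y) \<bullet> h\<bar> \<le> M * (norm h)\<^sup>2" for y
          using quad[of "x + \<sigma> *\<^sub>R y" h] by (simp add: Y_def add_ac)
      qed (use iY iw in auto)
      finally have a: "\<bar>(LINT y|\<mu> x. Y x h y) - v \<bullet> h\<bar> \<le> M * (norm h)\<^sup>2"
        using P.prob_space[of x] by simp
      have b: "(LINT y|\<mu> x. Y x h y) \<le> ?d"
        unfolding inc by (intro P.expectation_le_ln_exp iY ieY)
      have Y2: "(Y x h y)\<^sup>2 * exp \<bar>Y x h y\<bar> \<le> (\<Lambda> * norm h)\<^sup>2 * exp \<Lambda>" for y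
      proof (intro mult_mono)
        show "(Y x h y)\<^sup>2 \<le> (\<Lambda> * norm h)\<^sup>2"
          by (metis Yb abs_ge_zero power2_abs power_mono)
        have "\<Lambda> * norm h \<le> \<Lambda> * 1" using True \<Lambda> by (intro mult_left_mono) auto
        thus "exp \<bar>Y x h y\<bar> \<le> exp \<Lambda>" using Yb[of x h y] by simp
      qed auto
      have iY2: "integrable (\<mu> x) (\<lambda>y. (Y x h y)\<^sup>2 * exp \<bar>Y x h y\<bar>)"
        by (rule P.integrable_const_bound[of _ "(\<Lambda> * norm h)\<^sup>2 * exp \<Lambda>"]) (use Y2 in auto)
      have "?d \<le> (LINT y|\<mu> x. Y x h y) + (LINT y|\<mu> x. (Y x h y)\<^sup>2 * exp \<bar>Y x h y\<bar>) / 2"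
        unfolding inc by (intro P.ln_exp_le iY ieY iY2)
      also have "(LINT y|\<mu> x. (Y x h y)\<^sup>2 * exp \<bar>Y x h y\<bar>) \<le> (LINT y|\<mu> x. (\<Lambda> * norm h)\<^sup>2 * exp \<Lambda>)"
        by (intro integral_mono iY2 Y2) auto
      finally have c: "?d \<le> (LINT y|\<mu> x. Y x h y) + (\<Lambda> * norm h)\<^sup>2 * exp \<Lambda> / 2"
        using P.prob_space[of x] by simp
      have "0 \<le> \<Lambda>\<^sup>2 / 2 * exp \<Lambda> * (norm h)\<^sup>2" "0 \<le> (\<Lambda> + W) * (norm h)\<^sup>2"
        using \<Lambda> W0 by simp_all
      moreover have "(\<Lambda> * norm h)\<^sup>2 * exp \<Lambda> / 2 = \<Lambda>\<^sup>2 / 2 * exp \<Lambda> * (norm h)\<^sup>2"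
        by (simp add: power_mult_distrib)
      ultimately have "\<bar>?d - v \<bullet> h\<bar> \<le> M * (norm h)\<^sup>2 + \<Lambda>\<^sup>2 / 2 * exp \<Lambda> * (norm h)\<^sup>2 + (\<Lambda> + W) * (norm h)\<^sup>2"
        using a b c by linarith
      thus ?thesis by (simp add: algebra_simps)
    next
      \<comment> \<open>Outside the unit ball |h| \<le> |h|^2, so the linear bounds suffice. They
        account for the summand \<open>\<Lambda> + W\<close> of the constant.\<close>
      case False
      have "\<bar>v \<bullet> h\<bar> \<le> W * norm h"
        using Cauchy_Schwarz_ineq2[of v h] mult_right_mono[OF v norm_ge_zero[of h]] by linarith
      hence "\<bar>?d - v \<bullet> h\<bar> \<le> (\<Lambda> + W) * norm h"
        using bnd[of x h] by (simp add: algebra_simps)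
      also have "\<dots> \<le> (\<Lambda> + W) * (norm h)\<^sup>2"
        using False \<Lambda> W0 by (intro mult_left_mono self_le_power) auto
      also have "\<dots> \<le> (M + \<Lambda>\<^sup>2 / 2 * exp \<Lambda> + \<Lambda> + W) * (norm h)\<^sup>2"
        using \<Lambda> M by (intro mult_right_mono) auto
      finally show ?thesis .
    qed
  qed
qed

lemma log_heat_semigroup:
  fixes f :: "'a::euclidean_space \<Rightarrow> real"
  assumes f: "\<Lambda>-lipschitz_on UNIV f" and "p \<ge> 0" "q \<ge> 0" "r \<ge> 0" "p\<^sup>2 + q\<^sup>2 = r\<^sup>2"
  shows "log_heat p (log_heat q f) x = log_heat r f x"
proof -
  have "(LINT y|std_gaussian. exp (log_heat q f (x + p *\<^sub>R y)))
      = (LINT y|std_gaussian. (LINT z|std_gaussian. exp (f (x + p *\<^sub>R y + q *\<^sub>R z))))"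
    unfolding log_heat_def using integral_exp_lipschitz_pos[OF f] by simp
  also have "\<dots> = (LINT y|std_gaussian. exp (f (x + r *\<^sub>R y)))"
    by (rule gauss_convolution[OF exp_growth_lipschitz(2)[OF f]]) (use assms in auto)
  finally show ?thesis by (simp add: log_heat_def)
qed

text \<open>A step of dynamic programming with a drift that need not be optimal: during the time p^2
  the drift \<open>v\<close> displaces the point by p^2 v and costs p^2 |v|^2 / 2.\<close>

lemma log_heat_drift:
  fixes F :: "'a::euclidean_space \<Rightarrow> real"
  assumes F: "\<Lambda>-lipschitz_on UNIV F" and "p \<ge> 0" "q \<ge> 0" "r \<ge> 0" "p\<^sup>2 + q\<^sup>2 = r\<^sup>2"
  shows "(LINT y|std_gaussian. log_heat q F (x + p\<^sup>2 *\<^sub>R v + p *\<^sub>R y)) - p\<^sup>2 * (norm v)\<^sup>2 / 2 \<le> log_heat r F x"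
proof -
  let ?H = "\<lambda>y. log_heat q F (x + p *\<^sub>R y)"
  have "(\<Lambda> * \<bar>p\<bar>)-lipschitz_on UNIV ?H"
    by (rule lipschitz_affine[OF log_heat_lipschitz[OF F]])
  hence "(LINT y|std_gaussian. ?H (y + p *\<^sub>R v)) - (norm (p *\<^sub>R v))\<^sup>2 / 2 \<le> ln (LINT y|std_gaussian. exp (?H y))"
    by (rule gauss_gibbs)
  also have "\<dots> = log_heat p (log_heat q F) x" by (simp add: log_heat_def)
  also have "\<dots> = log_heat r F x" by (rule log_heat_semigroup[OF F]) (use assms in auto)
  finally show ?thesis
    using \<open>p \<ge> 0\<close> by (simp add: scaleR_add_right power2_eq_square add_ac mult_ac)
qed

section \<open>Comparison of noise levels\<close>

text \<open>Induction on the number \<open>k\<close> of time steps of length \<open>1/N\<close>. The same drift is used on both sides; the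
  left process moves with noise \<open>a G = G + (a - 1) G\<close>, and the excess noise is collected in \<open>b\<close>.\<close>
lemma log_heat_width_discrete:
  fixes f :: "'a::euclidean_space \<Rightarrow> real"
  assumes f: "\<Lambda>-lipschitz_on UNIV f"
    and w [measurable]: "w \<in> borel_measurable borel" and W: "\<And>x. norm (w x) \<le> W" and M: "M \<ge> 0"
    and quad: "\<And>x h. \<bar>f (x + h) - f x - w x \<bullet> h\<bar> \<le> M * (norm h)\<^sup>2"
    and S: "exp_growth S" "\<And>x b c. c \<ge> 0 \<Longrightarrow> f (x + c *\<^sub>R b) \<le> f x + c * S b"
    and a: "a \<ge> 1"
  obtains C where "\<And>N k x b. N > 0 \<Longrightarrow> k \<le> N \<Longrightarrow>
      log_heat (a * sqrt (k / N)) f (x + (a - 1) *\<^sub>R b)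
        \<le> log_heat (sqrt (k / N)) (\<lambda>x. a\<^sup>2 * f x) x / a\<^sup>2
          + (a - 1) * (LINT y|std_gaussian. S (b + sqrt (k / N) *\<^sub>R y)) + real k * C / (real N)\<^sup>2"
proof -
  \<comment> \<open>\<open>M'\<close> is the remainder constant of \<open>log_heat_quad\<close>,
    valid at all times. \<open>K\<close> is the error integral of \<open>log_heat_step\<close> with
    \<open>s0 = a\<close>, an upper bound for each step size a / sqrt N; the fourth power of that
    step size explains \<open>C\<close> and the division by N^2.\<close>
  define M' where "M' = M + \<Lambda>\<^sup>2 / 2 * exp \<Lambda> + \<Lambda> + W"
  define K where "K = (LINT y|(std_gaussian :: 'a measure).
          M'\<^sup>2 * (norm y + a * W) ^ 4 * exp ((\<Lambda> + W) * a * (a * W) + (\<Lambda> + W) * a * norm y)) / 2"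
  define C where "C = a ^ 4 * K"
  have \<Lambda>: "\<Lambda> \<ge> 0" using f by (rule lipschitz_on_nonneg)
  have W0: "W \<ge> 0" using W[of 0] norm_ge_zero[of "w 0"] by linarith
  have M': "M' \<ge> 0" unfolding M'_def using M \<Lambda> W0 by simp
  have F: "(a\<^sup>2 * \<Lambda>)-lipschitz_on UNIV (\<lambda>x. a\<^sup>2 * f x)"
    using lipschitz_on_cmult_real[OF f, of "a\<^sup>2"] by simp
  have Sm [measurable]: "S \<in> borel_measurable borel" using S(1) by (rule exp_growth_measurable)
  show thesis
  proof (rule that[of C])
    fix N k :: nat and x b :: 'a
    assume N: "N > 0" and "k \<le> N"
    thus "log_heat (a * sqrt (k / N)) f (x + (a - 1) *\<^sub>R b)
        \<le> log_heat (sqrt (k / N)) (\<lambda>x. a\<^sup>2 * f x) x / a\<^sup>2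
          + (a - 1) * (LINT y|std_gaussian. S (b + sqrt (k / N) *\<^sub>R y)) + real k * C / (real N)\<^sup>2"
    proof (induction k arbitrary: x b)
      case 0
      show ?case using S(2)[of "a - 1" x b] a by (simp add: gauss.prob_space[simplified])
    next
      case (Suc k)
      define d where "d = 1 / sqrt N"
      define t where "t = sqrt (k / N)"
      define t' where "t' = sqrt (Suc k / N)"
      define y0 where "y0 = x + (a - 1) *\<^sub>R b"
      have nn: "d \<ge> 0" "t \<ge> 0" "t' \<ge> 0" by (simp_all add: d_def t_def t'_def)
      have d1: "d \<le> 1" using N by (simp add: d_def)
      have dsq: "d\<^sup>2 = 1 / N" using N by (simp add: d_def power_divide)
      have dt: "d\<^sup>2 + t\<^sup>2 = t'\<^sup>2" using N by (simp add: dsq t_def t'_def field_simps)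
      hence adt: "(a * d)\<^sup>2 + (a * t)\<^sup>2 = (a * t')\<^sup>2"
        by (simp only: power_mult_distrib distrib_left[symmetric])
      define g where "g = log_heat (a * t) f"
      have g: "\<Lambda>-lipschitz_on UNIV g" unfolding g_def by (rule log_heat_lipschitz[OF f])
      \<comment> \<open>\<open>v\<close> replaces the gradient of the value function
        \<open>g\<close> at the left position. It is the nearly optimal drift there, which is why
        the upper bound of \<open>log_heat_step\<close> loses only a fourth-order term.\<close>
      obtain v where v: "norm v \<le> W" "\<And>h. \<bar>g (y0 + h) - g y0 - v \<bullet> h\<bar> \<le> M' * (norm h)\<^sup>2"
        using log_heat_quad[OF f w W M quad, of "a * t" y0] unfolding g_def M'_def by blast
      have ad: "0 \<le> a * d" "a * d \<le> a" using a d1 nn by (simp_all add: mult_left_le)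
      let ?SA = "\<lambda>t b. LINT y|std_gaussian. S (b + t *\<^sub>R y)"
      let ?Q = "log_heat t (\<lambda>x. a\<^sup>2 * f x)"
      have Q: "(a\<^sup>2 * \<Lambda>)-lipschitz_on UNIV ?Q" by (rule log_heat_lipschitz[OF F])
      have iQ: "integrable std_gaussian (\<lambda>y. ?Q (x + d\<^sup>2 *\<^sub>R (a\<^sup>2 *\<^sub>R v) + d *\<^sub>R y))"
        by (intro exp_growth_integrable exp_growth_lipschitz_affine[OF Q])
      have iS: "integrable std_gaussian (\<lambda>y. ?SA t (b + d *\<^sub>R y))"
      proof (rule exp_growth_integrable)
        obtain C c where c: "0 \<le> c" "\<And>y. \<bar>S y\<bar> \<le> exp (C + c * norm y)"
          using S(1) by (rule exp_growthE) blast
        show "exp_growth (\<lambda>y. ?SA t (b + d *\<^sub>R y))"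
        proof (rule exp_growth_integral)
          fix y z :: 'a
          have "norm (b + d *\<^sub>R y + t *\<^sub>R z) \<le> norm b + d * norm y + t * norm z"
            using nn by (intro norm_triangle_le add_mono) auto
          also have "\<dots> \<le> norm b + (d + t) * (norm y + norm z)"
            using nn by (simp add: algebra_simps)
          finally have "c * norm (b + d *\<^sub>R y + t *\<^sub>R z) \<le> c * (norm b + (d + t) * (norm y + norm z))"
            using c(1) by (rule mult_left_mono)
          thus "\<bar>S (b + d *\<^sub>R y + t *\<^sub>R z)\<bar> \<le> exp (C + c * norm b + (c * (d + t)) * (norm y + norm z))"
            by (intro order_trans[OF c(2)]) (simp add: algebra_simps)
        qed (use c nn in auto)
      qed
      have "log_heat (a * t') f y0 = log_heat (a * d) g y0"
        unfolding g_def using nn a adt by (intro log_heat_semigroup[OF f, symmetric]) auto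
      also have "\<dots> \<le> (LINT y|std_gaussian. g (y0 + (a * d)\<^sup>2 *\<^sub>R v + (a * d) *\<^sub>R y))
          - (a * d)\<^sup>2 * (norm v)\<^sup>2 / 2 + (a * d) ^ 4 * K"
        using log_heat_step[OF g v(2) v(1) ad M'] unfolding K_def by simp
      also have "(LINT y|std_gaussian. g (y0 + (a * d)\<^sup>2 *\<^sub>R v + (a * d) *\<^sub>R y))
          \<le> (LINT y|std_gaussian. ?Q (x + d\<^sup>2 *\<^sub>R (a\<^sup>2 *\<^sub>R v) + d *\<^sub>R y) / a\<^sup>2
               + (a - 1) * ?SA t (b + d *\<^sub>R y) + real k * C / (real N)\<^sup>2)"
      proof (rule integral_mono)
        fix y
        \<comment> \<open>Both sides move by the same drift displacement, so their positions now
          differ by (a - 1) (b + d y): the induction hypothesis applies with the enlarged excess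
          noise.\<close>
        have "y0 + (a * d)\<^sup>2 *\<^sub>R v + (a * d) *\<^sub>R y
            = (x + d\<^sup>2 *\<^sub>R (a\<^sup>2 *\<^sub>R v) + d *\<^sub>R y) + (a - 1) *\<^sub>R (b + d *\<^sub>R y)"
          by (simp add: y0_def algebra_simps power_mult_distrib)
        thus "g (y0 + (a * d)\<^sup>2 *\<^sub>R v + (a * d) *\<^sub>R y) \<le> ?Q (x + d\<^sup>2 *\<^sub>R (a\<^sup>2 *\<^sub>R v) + d *\<^sub>R y) / a\<^sup>2
               + (a - 1) * ?SA t (b + d *\<^sub>R y) + real k * C / (real N)\<^sup>2"
          unfolding g_def t_def using Suc.IH Suc.prems by simp
      qed (use iQ iS in \<open>auto intro!: exp_growth_integrable exp_growth_lipschitz_affine[OF g]\<close>)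
      also have "\<dots> = (LINT y|std_gaussian. ?Q (x + d\<^sup>2 *\<^sub>R (a\<^sup>2 *\<^sub>R v) + d *\<^sub>R y)) / a\<^sup>2
               + (a - 1) * (LINT y|std_gaussian. ?SA t (b + d *\<^sub>R y)) + real k * C / (real N)\<^sup>2"
        using iQ iS by (simp add: gauss.prob_space[simplified])
      also have "(LINT y|std_gaussian. ?SA t (b + d *\<^sub>R y)) = ?SA t' b"
        using nn dt by (intro gauss_convolution S)
      also have "(LINT y|std_gaussian. ?Q (x + d\<^sup>2 *\<^sub>R (a\<^sup>2 *\<^sub>R v) + d *\<^sub>R y)) / a\<^sup>2
          \<le> (log_heat t' (\<lambda>x. a\<^sup>2 * f x) x + d\<^sup>2 * (norm (a\<^sup>2 *\<^sub>R v))\<^sup>2 / 2) / a\<^sup>2"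
        using log_heat_drift[OF F, of d t t' x "a\<^sup>2 *\<^sub>R v"] nn dt by (intro divide_right_mono) auto
      \<comment> \<open>The cost a^4 d^2 |v|^2 / 2 of the right side, divided by a^2, is exactly the
        term (a d)^2 |v|^2 / 2 subtracted on the left. The drift cancels without further
        estimate.\<close>
      also have "\<dots> = log_heat t' (\<lambda>x. a\<^sup>2 * f x) x / a\<^sup>2 + (a * d)\<^sup>2 * (norm v)\<^sup>2 / 2"
        using a by (simp add: field_simps power_mult_distrib)
      also have "(a * d) ^ 4 * K = C / (real N)\<^sup>2"
      proof -
        have "d ^ 4 = (d\<^sup>2)\<^sup>2" by (simp flip: power_mult)
        thus ?thesis by (simp add: C_def power_mult_distrib dsq power_divide)
      qed
      finally show ?case
        unfolding t_def t'_def y0_def by (simp add: add_divide_distrib distrib_right)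
    qed
  qed
qed

text \<open>After all \<open>N\<close> steps the accumulated error is N C / N^2. Although
  \<open>C\<close> depends on \<open>M\<close>, the limit in \<open>N\<close> removes it, so no
  trace of the quadratic remainder is left in the conclusion.\<close>

lemma log_heat_width_smooth:
  fixes f :: "'a::euclidean_space \<Rightarrow> real"
  assumes f: "\<Lambda>-lipschitz_on UNIV f"
    and w: "w \<in> borel_measurable borel" and W: "\<And>x. norm (w x) \<le> W" and M: "M \<ge> 0"
    and quad: "\<And>x h. \<bar>f (x + h) - f x - w x \<bullet> h\<bar> \<le> M * (norm h)\<^sup>2"
    and S: "exp_growth S" "\<And>x b c. c \<ge> 0 \<Longrightarrow> f (x + c *\<^sub>R b) \<le> f x + c * S b"
    and a: "a \<ge> 1"
  shows "log_heat a f 0 \<le> log_heat 1 (\<lambda>x. a\<^sup>2 * f x) 0 / a\<^sup>2 + (a - 1) * (LINT y|std_gaussian. S y)"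
proof -
  obtain C where C: "\<And>N k x b. N > 0 \<Longrightarrow> k \<le> N \<Longrightarrow>
      log_heat (a * sqrt (k / N)) f (x + (a - 1) *\<^sub>R b)
        \<le> log_heat (sqrt (k / N)) (\<lambda>x. a\<^sup>2 * f x) x / a\<^sup>2
          + (a - 1) * (LINT y|std_gaussian. S (b + sqrt (k / N) *\<^sub>R y)) + real k * C / (real N)\<^sup>2"
    using log_heat_width_discrete[OF f w W M quad S a] by blast
  let ?R = "log_heat 1 (\<lambda>x. a\<^sup>2 * f x) 0 / a\<^sup>2 + (a - 1) * (LINT y|std_gaussian. S y)"
  have "log_heat a f 0 \<le> ?R + C / real (Suc N)" for N
    using C[of "Suc N" "Suc N" 0 0] by (simp add: power2_eq_square del: of_nat_Suc)
  moreover have "(\<lambda>N. ?R + C / real (Suc N)) \<longlonglongrightarrow> ?R + 0"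
    by (intro tendsto_intros LIMSEQ_Suc lim_const_over_n)
  ultimately show ?thesis
    by (metis (mono_tags, lifting) LIMSEQ_le_const add.right_neutral)
qed

section \<open>Gaussian mollification of a Lipschitz function\<close>

lemma heat_lipschitz:
  fixes f :: "'a::euclidean_space \<Rightarrow> real"
  assumes f: "\<Lambda>-lipschitz_on UNIV f"
  shows "\<Lambda>-lipschitz_on UNIV (\<lambda>x. LINT y|std_gaussian. f (x + e *\<^sub>R y))"
proof (rule lipschitz_onI)
  fix x x' :: 'a
  note gf = exp_growth_lipschitz_affine(1)[OF f]
  have "(LINT y|std_gaussian. f (x + e *\<^sub>R y)) - (LINT y|std_gaussian. f (x' + e *\<^sub>R y))
      = (LINT y|std_gaussian. f (x + e *\<^sub>R y) - f (x' + e *\<^sub>R y))"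
    using exp_growth_integrable[OF gf[of x e]] exp_growth_integrable[OF gf[of x' e]] by simp
  also have "\<bar>\<dots>\<bar> \<le> (LINT y|std_gaussian. \<bar>f (x + e *\<^sub>R y) - f (x' + e *\<^sub>R y)\<bar>)"
    by (rule integral_abs_bound)
  also have "\<dots> \<le> (LINT y|(std_gaussian::'a measure). \<Lambda> * norm (x - x'))"
  proof (rule integral_mono)
    show "\<bar>f (x + e *\<^sub>R y) - f (x' + e *\<^sub>R y)\<bar> \<le> \<Lambda> * norm (x - x')" for y
      using lipschitz_bound[OF f, of "x + e *\<^sub>R y" "x' + e *\<^sub>R y"] by simp
  qed (auto intro!: exp_growth_integrable exp_growth_abs exp_growth_diff gf)
  finally show "dist (LINT y|std_gaussian. f (x + e *\<^sub>R y)) (LINT y|std_gaussian. f (x' + e *\<^sub>R y)) \<le> \<Lambda> * dist x x'"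
    by (simp add: gauss.prob_space[simplified] dist_norm)
qed (rule lipschitz_on_nonneg[OF f])

lemma heat_close:
  fixes f :: "'a::euclidean_space \<Rightarrow> real"
  assumes f: "\<Lambda>-lipschitz_on UNIV f" and e: "e \<ge> 0"
  shows "\<bar>(LINT y|std_gaussian. f (x + e *\<^sub>R y)) - f x\<bar> \<le> \<Lambda> * e * (LINT y|(std_gaussian::'a measure). norm y)"
proof -
  note gf = exp_growth_lipschitz_affine(1)[OF f]
  have "(LINT y|std_gaussian. f (x + e *\<^sub>R y)) - f x = (LINT y|std_gaussian. f (x + e *\<^sub>R y) - f x)"
    using exp_growth_integrable[OF gf[of x e]] by (simp add: gauss.prob_space[simplified])
  also have "\<bar>\<dots>\<bar> \<le> (LINT y|std_gaussian. \<bar>f (x + e *\<^sub>R y) - f x\<bar>)"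
    by (rule integral_abs_bound)
  also have "\<dots> \<le> (LINT y|(std_gaussian::'a measure). \<Lambda> * e * norm y)"
  proof (rule integral_mono)
    show "\<bar>f (x + e *\<^sub>R y) - f x\<bar> \<le> \<Lambda> * e * norm y" for y
      using lipschitz_bound[OF f, of "x + e *\<^sub>R y" x] e by simp
    show "integrable std_gaussian (\<lambda>y::'a. \<Lambda> * e * norm y)"
      by (intro exp_growth_integrable exp_growth_mult exp_growth_const exp_growth_norm)
  qed (auto intro!: exp_growth_integrable exp_growth_abs exp_growth_diff gf)
  finally show ?thesis by simp
qed

text \<open>No smoothness of \<open>f\<close> is used: with h = e k, the shift formula moves the
  displacement from \<open>f\<close> to the weight exp (<k, y> - |k|^2 / 2). The linear term of the
  weight in \<open>k\<close> yields the gradient \<open>w\<close> in the form of Stein's formula,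
  and the remainder is of order |k|^2.\<close>

lemma heat_quad:
  fixes f :: "'a::euclidean_space \<Rightarrow> real"
  assumes f: "\<Lambda>-lipschitz_on UNIV f" and e: "e > 0"
  defines "g \<equiv> \<lambda>x. LINT y|std_gaussian. f (x + e *\<^sub>R y)"
  obtains w W M where "w \<in> borel_measurable borel" "\<And>x. norm (w x) \<le> W" "M \<ge> 0"
    "\<And>x h. \<bar>g (x + h) - g x - w x \<bullet> h\<bar> \<le> M * (norm h)\<^sup>2"
proof -
  note [measurable] = lipschitz_measurable[OF f]
  have \<Lambda>: "\<Lambda> \<ge> 0" using f by (rule lipschitz_on_nonneg)
  define w where "w x = (1 / e) *\<^sub>R (LINT y|std_gaussian. (f (x + e *\<^sub>R y) - f x) *\<^sub>R y)" for x
  define W where "W = \<Lambda> * (LINT y|(std_gaussian::'a measure). (norm y)\<^sup>2)"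
  define B where "B = (LINT y|(std_gaussian::'a measure). \<Lambda> * norm y * ((norm y + 1)\<^sup>2 * exp (1 + 1 * norm y) + 1))"
  \<comment> \<open>The part \<open>B / e\<close> serves displacements up to length
    \<open>e\<close>; the part \<open>(\<Lambda> + W) / e\<close> serves longer ones, where the
    Lipschitz bounds are enough.\<close>
  define M where "M = (B + (\<Lambda> + W)) / e"
  have Df: "\<bar>f (x + e *\<^sub>R y) - f x\<bar> \<le> \<Lambda> * (e * norm y)" for x y
    using lipschitz_bound[OF f, of "x + e *\<^sub>R y" x] e by simp
  have gf: "exp_growth (\<lambda>y. f (x + e *\<^sub>R y))" for x by (rule exp_growth_lipschitz_affine[OF f])
  have gn2: "integrable std_gaussian (\<lambda>y::'a. (norm y)\<^sup>2)"
    by (intro exp_growth_integrable exp_growth_power exp_growth_norm)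
  have W0: "W \<ge> 0" unfolding W_def using \<Lambda> by simp
  have vb: "norm ((f (x + e *\<^sub>R y) - f x) *\<^sub>R y) \<le> (\<Lambda> * e) * (norm y)\<^sup>2" for x y
    using mult_right_mono[OF Df[of x y] norm_ge_zero[of y]] by (simp add: power2_eq_square mult_ac)
  have iv: "integrable std_gaussian (\<lambda>y. (f (x + e *\<^sub>R y) - f x) *\<^sub>R y)" for x
    by (rule Bochner_Integration.integrable_bound[OF integrable_mult_right[OF gn2, of "\<Lambda> * e"]])
       (use vb \<Lambda> e in auto)
  show thesis
  proof (rule that[of w W M])
    show "w \<in> borel_measurable borel" unfolding w_def by measurable
    show wW: "norm (w x) \<le> W" for x
    proof -
      have "norm (LINT y|std_gaussian. (f (x + e *\<^sub>R y) - f x) *\<^sub>R y)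
          \<le> (LINT y|std_gaussian. norm ((f (x + e *\<^sub>R y) - f x) *\<^sub>R y))"
        by (rule integral_norm_bound)
      also have "\<dots> \<le> (LINT y|(std_gaussian::'a measure). (\<Lambda> * e) * (norm y)\<^sup>2)"
        by (intro integral_mono integrable_norm iv vb integrable_mult_right gn2)
      finally show ?thesis using e by (simp add: w_def W_def field_simps)
    qed
    have "0 \<le> B" unfolding B_def using \<Lambda> by (intro integral_nonneg_AE) auto
    thus "M \<ge> 0" unfolding M_def using \<Lambda> W0 e by simp
    fix x h :: 'a
    define k where "k = (1 / e) *\<^sub>R h"
    have h: "h = e *\<^sub>R k" using e by (simp add: k_def)
    show "\<bar>g (x + h) - g x - w x \<bullet> h\<bar> \<le> M * (norm h)\<^sup>2"
    proof (cases "norm k \<le> 1")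
      case True
      define r where "r y = exp (k \<bullet> y - (norm k)\<^sup>2 / 2) - 1 - k \<bullet> y" for y
      have rb: "\<bar>r y\<bar> \<le> (norm k)\<^sup>2 * ((norm y + 1)\<^sup>2 * exp (1 + 1 * norm y) + 1)" for y
      proof -
        define s where "s = k \<bullet> y - (norm k)\<^sup>2 / 2"
        have "(norm k)\<^sup>2 \<le> norm k * 1" unfolding power2_eq_square using True by (intro mult_left_mono) auto
        hence s: "\<bar>s\<bar> \<le> norm k * (norm y + 1)"
          using Cauchy_Schwarz_ineq2[of k y] zero_le_power2[of "norm k"]
            distrib_left[of "norm k" "norm y" 1]
          unfolding s_def abs_le_iff by linarith
        hence s1: "\<bar>s\<bar> \<le> 1 + norm y"
          using mult_right_mono[OF True, of "norm y + 1"] by simp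
        have "s\<^sup>2 \<le> (norm k * (norm y + 1))\<^sup>2" using s by (metis abs_ge_zero power2_abs power_mono)
        hence "s\<^sup>2 * exp \<bar>s\<bar> \<le> (norm k * (norm y + 1))\<^sup>2 * exp (1 + norm y)"
          using s1 by (intro mult_mono) auto
        moreover have "0 \<le> s\<^sup>2 * exp \<bar>s\<bar>" by simp
        moreover have "r y = (exp s - 1 - s) - (norm k)\<^sup>2 / 2"
          by (simp add: r_def s_def)
        hence "\<bar>r y\<bar> \<le> s\<^sup>2 / 2 * exp \<bar>s\<bar> + (norm k)\<^sup>2 / 2"
          using exp_taylor2[of s] zero_le_power2[of "norm k"] unfolding abs_le_iff by linarith
        moreover have "(norm k * (norm y + 1))\<^sup>2 * exp (1 + norm y) + (norm k)\<^sup>2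
            = (norm k)\<^sup>2 * ((norm y + 1)\<^sup>2 * exp (1 + 1 * norm y) + 1)"
          by (simp only: power_mult_distrib) (simp add: algebra_simps)
        ultimately show ?thesis using zero_le_power2[of "norm k"] by linarith
      qed
      have gE: "exp_growth (\<lambda>y. exp (k \<bullet> y - (norm k)\<^sup>2 / 2))"
      proof (rule exp_growth_bound[OF exp_growth_exp_linear])
        show "\<bar>exp (k \<bullet> y - (norm k)\<^sup>2 / 2)\<bar> \<le> exp (0 + norm k * norm y)" for y
          using norm_cauchy_schwarz[of k y] zero_le_power2[of "norm k"] by (simp, linarith)
      qed simp
      have gr: "exp_growth r" unfolding r_def[abs_def]
        by (intro exp_growth_diff gE exp_growth_const exp_growth_inner)
      have gd: "exp_growth (\<lambda>y. f (x + e *\<^sub>R y) - f x)" by (intro exp_growth_diff gf exp_growth_const)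
      have "g (x + h) = (LINT y|std_gaussian. f (x + e *\<^sub>R (y + k)))"
        unfolding g_def h by (simp add: scaleR_add_right add_ac)
      also have "\<dots> = (LINT y|std_gaussian. f (x + e *\<^sub>R y) * exp (k \<bullet> y - (norm k)\<^sup>2 / 2))"
        by (rule integral_gauss_shift) measurable
      finally have g1: "g (x + h) = (LINT y|std_gaussian. f (x + e *\<^sub>R y) * exp (k \<bullet> y - (norm k)\<^sup>2 / 2))" .
      \<comment> \<open>The weight has mean one, so the constant \<open>f x\<close> can be
        subtracted from \<open>f\<close>. The difference is at most
        \<open>\<Lambda> * (e * norm y)\<close>, which makes the estimate uniform in
        \<open>x\<close>.\<close>
      have "(LINT y|std_gaussian. f x * exp (k \<bullet> y - (norm k)\<^sup>2 / 2)) = f x"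
        using integral_gauss_shift[of "\<lambda>_. f x" k] by (simp add: gauss.prob_space[simplified])
      hence g2: "g (x + h) - f x = (LINT y|std_gaussian. (f (x + e *\<^sub>R y) - f x) * exp (k \<bullet> y - (norm k)\<^sup>2 / 2))"
        unfolding g1 left_diff_distrib
        using exp_growth_integrable[OF exp_growth_mult[OF gf gE]] exp_growth_integrable[OF exp_growth_mult[OF exp_growth_const gE]]
        by simp
      have g3: "g x - f x = (LINT y|std_gaussian. f (x + e *\<^sub>R y) - f x)"
        unfolding g_def using exp_growth_integrable[OF gf] by (simp add: gauss.prob_space[simplified])
      have g4: "w x \<bullet> h = (LINT y|std_gaussian. (f (x + e *\<^sub>R y) - f x) * (k \<bullet> y))"
      proof -
        have "(LINT y|std_gaussian. (f (x + e *\<^sub>R y) - f x) *\<^sub>R y) \<bullet> k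
            = (LINT y|std_gaussian. ((f (x + e *\<^sub>R y) - f x) *\<^sub>R y) \<bullet> k)"
          by (rule integral_inner_left[symmetric]) (rule iv)
        thus ?thesis unfolding w_def h using e by (simp add: inner_commute)
      qed
      have "g (x + h) - g x - w x \<bullet> h = (LINT y|std_gaussian. (f (x + e *\<^sub>R y) - f x) * r y)"
      proof -
        have "(LINT y|std_gaussian. (f (x + e *\<^sub>R y) - f x) * r y)
           = (LINT y|std_gaussian. (f (x + e *\<^sub>R y) - f x) * exp (k \<bullet> y - (norm k)\<^sup>2 / 2)
                - (f (x + e *\<^sub>R y) - f x) - (f (x + e *\<^sub>R y) - f x) * (k \<bullet> y))"
          by (simp add: r_def algebra_simps)
        also have "\<dots> = (g (x + h) - f x) - (g x - f x) - w x \<bullet> h"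
          unfolding g2 g3 g4
          using exp_growth_integrable[OF exp_growth_mult[OF gd gE]] exp_growth_integrable[OF gd]
            exp_growth_integrable[OF exp_growth_mult[OF gd exp_growth_inner[of k]]]
          by (subst Bochner_Integration.integral_diff Bochner_Integration.integral_diff;
              simp only: Bochner_Integration.integrable_diff)+
        finally show ?thesis by simp
      qed
      also have "\<bar>\<dots>\<bar> \<le> (LINT y|std_gaussian. \<bar>(f (x + e *\<^sub>R y) - f x) * r y\<bar>)"
        by (rule integral_abs_bound)
      also have "\<dots> \<le> (LINT y|(std_gaussian::'a measure). (e * (norm k)\<^sup>2) * (\<Lambda> * norm y * ((norm y + 1)\<^sup>2 * exp (1 + 1 * norm y) + 1)))"
      proof (rule integral_mono)
        fix y
        have "\<bar>(f (x + e *\<^sub>R y) - f x) * r y\<bar> \<le> (\<Lambda> * (e * norm y)) * ((norm k)\<^sup>2 * ((norm y + 1)\<^sup>2 * exp (1 + 1 * norm y) + 1))"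
          unfolding abs_mult using \<Lambda> e by (intro mult_mono Df rb) auto
        thus "\<bar>(f (x + e *\<^sub>R y) - f x) * r y\<bar> \<le> (e * (norm k)\<^sup>2) * (\<Lambda> * norm y * ((norm y + 1)\<^sup>2 * exp (1 + 1 * norm y) + 1))"
          by (simp only: mult_ac)
      next
        show "integrable std_gaussian (\<lambda>y. \<bar>(f (x + e *\<^sub>R y) - f x) * r y\<bar>)"
          by (intro exp_growth_integrable exp_growth_abs exp_growth_mult gd gr)
        show "integrable std_gaussian (\<lambda>y::'a. (e * (norm k)\<^sup>2) * (\<Lambda> * norm y * ((norm y + 1)\<^sup>2 * exp (1 + 1 * norm y) + 1)))"
          by (intro exp_growth_integrable exp_growth_mult exp_growth_const exp_growth_norm exp_growth_add exp_growth_power exp_growth_exp_linear)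
      qed
      also have "\<dots> = e * (norm k)\<^sup>2 * B" by (simp add: B_def)
      also have "\<dots> \<le> e * (norm k)\<^sup>2 * (B + (\<Lambda> + W))"
        using \<Lambda> W0 e by (intro mult_left_mono) auto
      also have "\<dots> = M * (norm h)\<^sup>2"
        using e by (simp add: M_def h power_mult_distrib power2_eq_square)
      finally show ?thesis .
    next
      case False
      have "\<bar>g (x + h) - g x\<bar> \<le> \<Lambda> * norm h"
        unfolding g_def using lipschitz_bound[OF heat_lipschitz[OF f, of e], of "x + h" x] by simp
      moreover have "\<bar>w x \<bullet> h\<bar> \<le> W * norm h"
        using Cauchy_Schwarz_ineq2[of "w x" h] mult_right_mono[OF wW[of x] norm_ge_zero[of h]] by linarith
      ultimately have "\<bar>g (x + h) - g x - w x \<bullet> h\<bar> \<le> (\<Lambda> + W) * norm h"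
        by (simp add: algebra_simps)
      also have "\<dots> = (\<Lambda> + W) * e * norm k" using e by (simp add: h)
      also have "\<dots> \<le> (\<Lambda> + W) * e * (norm k)\<^sup>2"
        using False \<Lambda> W0 e by (intro mult_left_mono self_le_power) auto
      also have "\<dots> \<le> e * (norm k)\<^sup>2 * (B + (\<Lambda> + W))"
        using \<open>0 \<le> B\<close> e by (simp add: algebra_simps)
      also have "\<dots> = M * (norm h)\<^sup>2"
        using e by (simp add: M_def h power_mult_distrib power2_eq_square)
      finally show ?thesis .
    qed
  qed
qed

lemma log_heat_mono_add:
  fixes f g :: "'a::euclidean_space \<Rightarrow> real"
  assumes f: "\<Lambda>-lipschitz_on UNIV f" and g: "\<Lambda>'-lipschitz_on UNIV g"
    and le: "\<And>x. f x \<le> g x + c"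
  shows "log_heat \<sigma> f x \<le> log_heat \<sigma> g x + c"
proof -
  have "(LINT y|std_gaussian. exp (f (x + \<sigma> *\<^sub>R y))) \<le> (LINT y|std_gaussian. exp (g (x + \<sigma> *\<^sub>R y)) * exp c)"
    using le by (intro integral_mono exp_growth_integrable exp_growth_mult exp_growth_const
        exp_growth_lipschitz_affine[OF f] exp_growth_lipschitz_affine[OF g]) (simp add: exp_add[symmetric])
  hence "log_heat \<sigma> f x \<le> ln ((LINT y|std_gaussian. exp (g (x + \<sigma> *\<^sub>R y))) * exp c)"
    unfolding log_heat_def using integral_exp_lipschitz_pos[OF f] integral_exp_lipschitz_pos[OF g]
    by (intro ln_mono) auto
  also have "\<dots> = log_heat \<sigma> g x + c"
    unfolding log_heat_def using integral_exp_lipschitz_pos[OF g, of x \<sigma>] by (simp add: ln_mult)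
  finally show ?thesis .
qed

text \<open>Mollification at scale \<open>e\<close> preserves the Lipschitz constant and, by
  averaging, the increment bound by \<open>S\<close>; it moves \<open>f\<close> by at most
  \<open>\<Lambda> * e * m\<close>. Since the smooth case contains no second-order constant,
  \<open>e\<close> may tend to zero.\<close>

lemma log_heat_width:
  fixes f :: "'a::euclidean_space \<Rightarrow> real"
  assumes f: "\<Lambda>-lipschitz_on UNIV f"
    and S: "exp_growth S" "\<And>x b c. c \<ge> 0 \<Longrightarrow> f (x + c *\<^sub>R b) \<le> f x + c * S b"
    and a: "a \<ge> 1"
  shows "log_heat a f 0 \<le> log_heat 1 (\<lambda>x. a\<^sup>2 * f x) 0 / a\<^sup>2 + (a - 1) * (LINT y|std_gaussian. S y)"
    (is "_ \<le> ?R")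
proof -
  define m where "m = (LINT y|(std_gaussian::'a measure). norm y)"
  \<comment> \<open>The factor 2 counts both sides: the left value changes by
    \<open>\<Lambda> * e * m\<close>, the right one by a^2 times as much, which the division by a^2
    undoes.\<close>
  have "log_heat a f 0 \<le> ?R + 2 * (\<Lambda> * (1 / real (Suc n)) * m)" for n
  proof -
    define e where "e = 1 / real (Suc n)"
    have e: "e > 0" by (simp add: e_def)
    define g where "g x = (LINT y|std_gaussian. f (x + e *\<^sub>R y))" for x
    have g: "\<Lambda>-lipschitz_on UNIV g" unfolding g_def by (rule heat_lipschitz[OF f])
    have cl: "\<bar>g x - f x\<bar> \<le> \<Lambda> * e * m" for x
      unfolding g_def m_def by (rule heat_close[OF f]) (use e in simp)
    have gS: "g (x + c *\<^sub>R b) \<le> g x + c * S b" if "c \<ge> 0" for x b c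
    proof -
      note gf = exp_growth_integrable[OF exp_growth_lipschitz_affine(1)[OF f]]
      have "g (x + c *\<^sub>R b) \<le> (LINT y|std_gaussian. f (x + e *\<^sub>R y) + c * S b)"
        unfolding g_def
      proof (rule integral_mono)
        show "f (x + c *\<^sub>R b + e *\<^sub>R y) \<le> f (x + e *\<^sub>R y) + c * S b" for y
          using S(2)[OF that, of "x + e *\<^sub>R y" b] by (simp add: add_ac)
      qed (auto intro!: gf)
      also have "\<dots> = g x + c * S b"
        unfolding g_def using gf[of x e] by (simp add: gauss.prob_space[simplified])
      finally show ?thesis .
    qed
    have F: "(\<bar>a\<^sup>2\<bar> * \<Lambda>)-lipschitz_on UNIV (\<lambda>x. a\<^sup>2 * f x)" "(\<bar>a\<^sup>2\<bar> * \<Lambda>)-lipschitz_on UNIV (\<lambda>x. a\<^sup>2 * g x)"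
      by (intro lipschitz_on_cmult_real f g)+
    obtain w W M where q: "w \<in> borel_measurable borel" "\<And>x. norm (w x) \<le> W" "M \<ge> 0"
      "\<And>x h. \<bar>g (x + h) - g x - w x \<bullet> h\<bar> \<le> M * (norm h)\<^sup>2"
      using heat_quad[OF f e] unfolding g_def by blast
    have "log_heat a f 0 \<le> log_heat a g 0 + \<Lambda> * e * m"
      by (rule log_heat_mono_add[OF f g]) (use cl in \<open>smt (verit)\<close>)
    also have "log_heat a g 0 \<le> log_heat 1 (\<lambda>x. a\<^sup>2 * g x) 0 / a\<^sup>2 + (a - 1) * (LINT y|std_gaussian. S y)"
      by (rule log_heat_width_smooth[OF g q S(1) gS a])
    also have "log_heat 1 (\<lambda>x. a\<^sup>2 * g x) 0 \<le> log_heat 1 (\<lambda>x. a\<^sup>2 * f x) 0 + a\<^sup>2 * (\<Lambda> * e * m)"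
    proof (rule log_heat_mono_add[OF F(2,1)])
      fix x
      have "a\<^sup>2 * g x \<le> a\<^sup>2 * (f x + \<Lambda> * e * m)" using cl[of x] by (intro mult_left_mono) auto
      thus "a\<^sup>2 * g x \<le> a\<^sup>2 * f x + a\<^sup>2 * (\<Lambda> * e * m)" by (simp add: distrib_left)
    qed
    finally show ?thesis
      using a by (simp add: add_divide_distrib divide_right_mono e_def)
  qed
  moreover have "(\<lambda>n. ?R + 2 * (\<Lambda> * (1 / real (Suc n)) * m)) \<longlonglongrightarrow> ?R + 2 * (\<Lambda> * 0 * m)"
    by (intro tendsto_intros LIMSEQ_Suc[OF lim_1_over_n])
  ultimately show ?thesis
    by (metis (mono_tags, lifting) LIMSEQ_le_const add.right_neutral mult_zero_left mult_zero_right)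
qed

section \<open>Differentiating the comparison at equal noise levels\<close>

lemma curve_derivative_sequence:
  fixes f :: "'a::euclidean_space \<Rightarrow> real" and p :: "real \<Rightarrow> 'a"
  assumes f: "(f has_derivative (\<lambda>h. v \<bullet> h)) (at x)"
    and p: "(p has_vector_derivative u) (at 0)" "p 0 = x"
    and h: "filterlim h (at 0) sequentially"
  shows "(\<lambda>k. (f (p (h k)) - f x) / h k) \<longlonglongrightarrow> v \<bullet> u"
proof -
  have "((\<lambda>t. f (p t)) has_derivative (\<lambda>t. v \<bullet> (t *\<^sub>R u))) (at 0)"
    using p f by (intro has_derivative_compose[of p _ _ _ f, simplified]) (auto simp: has_vector_derivative_def)
  hence "((\<lambda>t. f (p t)) has_real_derivative v \<bullet> u) (at 0)"
    unfolding has_field_derivative_def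
    by (rule has_derivative_eq_rhs) (simp add: fun_eq_iff mult.commute)
  hence "((\<lambda>t. (f (p t) - f x) / t) \<longlongrightarrow> v \<bullet> u) (at 0)"
    using p(2) by (simp add: DERIV_def)
  thus ?thesis using h by (rule filterlim_compose)
qed

lemma integral_tilt:
  fixes f \<phi> :: "'a::euclidean_space \<Rightarrow> real"
  assumes [measurable]: "f \<in> borel_measurable borel" "\<phi> \<in> borel_measurable borel"
  shows "(LINT x|gauss_tilt f. \<phi> x) = (LINT x|std_gaussian. exp (f x) * \<phi> x)"
    and "integrable (gauss_tilt f) \<phi> \<longleftrightarrow> integrable std_gaussian (\<lambda>x. exp (f x) * \<phi> x)"
  unfolding gauss_tilt_def by (simp_all add: integral_density integrable_density)

lemma prob_tilt_integral:
  fixes f :: "'a::euclidean_space \<Rightarrow> real"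
  assumes [measurable]: "f \<in> borel_measurable borel" and "prob_space (gauss_tilt f)"
  shows "(LINT x|std_gaussian. exp (f x)) = 1"
proof -
  interpret prob_space "gauss_tilt f" by fact
  have "(LINT x|gauss_tilt f. 1) = (1::real)" by (simp add: prob_space)
  thus ?thesis by (subst (asm) integral_tilt(1)) simp_all
qed

text \<open>With a = 1 + h both sides of \<open>log_heat_width\<close> vanish at h = 0, because exp
  f has mean one. The logarithms need not be differentiated: Jensen's inequality under the tilted
  measure bounds the left one from below by h times the mean of \<open>L k\<close>, and ln t \<le> t
  - 1 bounds the right one from above by h times the mean of \<open>U k\<close>. Dominated
  convergence handles these difference quotients.\<close>

lemma tilt_drift_le_width:
  fixes f :: "'a::euclidean_space \<Rightarrow> real"
  assumes f: "\<Lambda>-lipschitz_on UNIV f"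
    and grad: "\<And>x. (f has_derivative (\<lambda>h. gradf x \<bullet> h)) (at x)"
    and S: "exp_growth S" "\<And>x b c. c \<ge> 0 \<Longrightarrow> f (x + c *\<^sub>R b) \<le> f x + c * S b"
    and prob: "prob_space (gauss_tilt f)"
    and [measurable]: "gradf \<in> borel_measurable borel"
  shows "(LINT x|gauss_tilt f. gradf x \<bullet> x) \<le> 2 * (LINT x|gauss_tilt f. f x) + (LINT y|std_gaussian. S y)"
proof -
  note [measurable] = lipschitz_measurable[OF f]
  have \<Lambda>: "\<Lambda> \<ge> 0" using f by (rule lipschitz_on_nonneg)
  interpret T: prob_space "gauss_tilt f" by fact
  have [simp, measurable_cong]: "sets (gauss_tilt f) = sets borel" by (simp add: gauss_tilt_def)
  have [simp]: "space (gauss_tilt f) = UNIV" by (simp add: gauss_tilt_def)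
  note Z = prob_tilt_integral[OF lipschitz_measurable[OF f] prob]
  define h where "h k = 1 / real (Suc k)" for k
  have h0: "h k > 0" "h k \<le> 1" for k by (simp_all add: h_def)
  define L where "L k x = (f (x + h k *\<^sub>R x) - f x) / h k" for k x
  \<comment> \<open>The exponent contains 2 h + h^2 = (1 + h)^2 - 1: this is the difference quotient
    of exp (a^2 f) at a = 1, divided by exp f.\<close>
  define U where "U k x = (exp ((2 * h k + (h k)\<^sup>2) * f x) - 1) / h k" for k x
  have [measurable]: "L k \<in> borel_measurable borel" "U k \<in> borel_measurable borel" for k
    unfolding L_def U_def by measurable
  have Lb: "\<bar>L k x\<bar> \<le> \<Lambda> * norm x" for k x
    using lipschitz_bound[OF f, of "x + h k *\<^sub>R x" x] h0[of k] by (simp add: L_def field_simps)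
  have Ub: "\<bar>U k x\<bar> \<le> 3 * \<bar>f x\<bar> * exp (3 * \<bar>f x\<bar>)" for k x
  proof -
    define t where "t = (2 * h k + (h k)\<^sup>2) * f x"
    have "(h k)\<^sup>2 \<le> h k * 1" unfolding power2_eq_square using h0[of k] by (intro mult_left_mono) auto
    hence c: "2 * h k + (h k)\<^sup>2 \<le> h k * 3" by simp
    hence t: "\<bar>t\<bar> \<le> h k * 3 * \<bar>f x\<bar>"
      unfolding t_def abs_mult using h0[of k] by (intro mult_right_mono) auto
    also have "\<dots> \<le> 1 * 3 * \<bar>f x\<bar>" using h0[of k] by (intro mult_right_mono) auto
    finally have t3: "exp \<bar>t\<bar> \<le> exp (3 * \<bar>f x\<bar>)" by simp
    have "\<bar>exp t - 1\<bar> \<le> (h k * 3 * \<bar>f x\<bar>) * exp (3 * \<bar>f x\<bar>)"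
      by (rule order_trans[OF abs_exp_minus_one_le mult_mono[OF t t3]]) (use h0[of k] in auto)
    hence "\<bar>exp t - 1\<bar> / h k \<le> 3 * \<bar>f x\<bar> * exp (3 * \<bar>f x\<bar>)"
      using h0[of k] by (simp add: field_simps)
    thus ?thesis using h0[of k] by (simp add: U_def t_def)
  qed
  have ge: "exp_growth (\<lambda>x. exp (f x))" by (rule exp_growth_lipschitz(2)[OF f])
  have gf: "exp_growth f" by (rule exp_growth_lipschitz(1)[OF f])
  have g3: "exp_growth (\<lambda>x. exp (3 * \<bar>f x\<bar>))"
  proof (rule exp_growth_bound[of "\<lambda>x. exp (3 * f x) + exp ((-3) * f x)"])
    show "exp_growth (\<lambda>x. exp (3 * f x) + exp ((-3) * f x))"
      by (intro exp_growth_add exp_growth_lipschitz(3)[OF f])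
    show "\<bar>exp (3 * \<bar>f x\<bar>)\<bar> \<le> exp (3 * f x) + exp ((-3) * f x)" for x
      by (cases "f x \<ge> 0") simp_all
  qed simp
  have gU: "exp_growth (\<lambda>x. 3 * \<bar>f x\<bar> * exp (3 * \<bar>f x\<bar>))"
    by (intro exp_growth_mult exp_growth_const exp_growth_abs gf g3)
  have gL: "exp_growth (\<lambda>x::'a. \<Lambda> * norm x)"
    by (intro exp_growth_mult exp_growth_const exp_growth_norm)
  have tilt_int: "integrable (gauss_tilt f) \<phi>" if "exp_growth \<phi>" for \<phi>
    using that exp_growth_measurable[OF that]
    by (subst integral_tilt(2)) (auto intro!: exp_growth_integrable exp_growth_mult ge)
  have gLk: "exp_growth (L k)" for k using exp_growth_bound[OF gL _ Lb] by simp
  have gUk: "exp_growth (U k)" for k using exp_growth_bound[OF gU _ Ub] by simp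
  have main: "(LINT x|gauss_tilt f. L k x)
      \<le> (LINT x|gauss_tilt f. U k x) / (1 + h k)\<^sup>2 + (LINT y|std_gaussian. S y)" for k
  proof -
    let ?a = "1 + h k"
    have a: "?a \<ge> 1" using h0[of k] by simp
    have Lf: "x + h k *\<^sub>R x = ?a *\<^sub>R x" for x :: 'a by (simp add: scaleR_add_left)
    have "h k * (LINT x|gauss_tilt f. L k x) = (LINT x|gauss_tilt f. h k * L k x)" by simp
    also have "(\<lambda>x. h k * L k x) = (\<lambda>x. f (?a *\<^sub>R x) - f x)"
      using h0[of k] by (simp add: L_def Lf fun_eq_iff)
    also have "(LINT x|gauss_tilt f. f (?a *\<^sub>R x) - f x)
        \<le> ln (LINT x|gauss_tilt f. exp (f (?a *\<^sub>R x) - f x))"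
    proof (rule T.expectation_le_ln_exp)
      show "integrable (gauss_tilt f) (\<lambda>x. f (?a *\<^sub>R x) - f x)"
        by (intro tilt_int exp_growth_diff gf exp_growth_affine'(2))
      show "integrable (gauss_tilt f) (\<lambda>x. exp (f (?a *\<^sub>R x) - f x))"
      proof (subst integral_tilt(2))
        show "integrable std_gaussian (\<lambda>x. exp (f x) * exp (f (?a *\<^sub>R x) - f x))"
          using exp_growth_integrable[OF exp_growth_affine'(2)[OF ge, of ?a]]
          by (simp add: exp_add[symmetric])
      qed simp_all
    qed
    also have "(LINT x|gauss_tilt f. exp (f (?a *\<^sub>R x) - f x)) = (LINT x|std_gaussian. exp (f (?a *\<^sub>R x)))"
      by (subst integral_tilt(1)) (simp_all add: exp_add[symmetric])
    also have "ln \<dots> = log_heat ?a f 0" by (simp add: log_heat_def)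
    also have "\<dots> \<le> log_heat 1 (\<lambda>x. ?a\<^sup>2 * f x) 0 / ?a\<^sup>2 + (?a - 1) * (LINT y|std_gaussian. S y)"
      by (rule log_heat_width[OF f S a])
    also have "log_heat 1 (\<lambda>x. ?a\<^sup>2 * f x) 0 \<le> h k * (LINT x|gauss_tilt f. U k x)"
    proof -
      have "log_heat 1 (\<lambda>x. ?a\<^sup>2 * f x) 0 \<le> (LINT x|std_gaussian. exp (?a\<^sup>2 * f x)) - 1"
        using ln_le_minus_one[OF gauss.expectation_exp_pos[of "\<lambda>x. ?a\<^sup>2 * f x"]]
          exp_growth_integrable[OF exp_growth_lipschitz(3)[OF f, of "?a\<^sup>2"]] exp_growth_integrable[OF gf]
        by (simp add: log_heat_def)
      also have "\<dots> = (LINT x|std_gaussian. exp (?a\<^sup>2 * f x) - exp (f x))"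
        using exp_growth_integrable[OF exp_growth_lipschitz(3)[OF f, of "?a\<^sup>2"]] exp_growth_integrable[OF ge] Z
        by simp
      also have "\<dots> = (LINT x|std_gaussian. exp (f x) * (h k * U k x))"
      proof (rule Bochner_Integration.integral_cong[OF refl])
        fix x
        have "?a\<^sup>2 * f x = f x + (2 * h k + (h k)\<^sup>2) * f x" by (simp add: power2_eq_square algebra_simps)
        hence "exp (?a\<^sup>2 * f x) = exp (f x) * exp ((2 * h k + (h k)\<^sup>2) * f x)"
          by (simp only: exp_add)
        moreover have "h k * U k x = exp ((2 * h k + (h k)\<^sup>2) * f x) - 1"
          using h0(1)[of k] by (simp add: U_def)
        ultimately show "exp (?a\<^sup>2 * f x) - exp (f x) = exp (f x) * (h k * U k x)"
          by (simp only: right_diff_distrib mult_1_right)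
      qed
      also have "\<dots> = (LINT x|gauss_tilt f. h k * U k x)"
        by (rule integral_tilt(1)[where \<phi> = "\<lambda>x. h k * U k x", symmetric]) measurable
      finally show ?thesis by simp
    qed
    finally have "h k * (LINT x|gauss_tilt f. L k x)
        \<le> h k * ((LINT x|gauss_tilt f. U k x) / ?a\<^sup>2 + (LINT y|std_gaussian. S y))"
      using h0[of k] by (simp add: divide_right_mono distrib_left)
    thus ?thesis using h0[of k] by simp
  qed
  have hlim: "h \<longlonglongrightarrow> 0" unfolding h_def by (intro LIMSEQ_Suc[OF lim_1_over_n])
  have hat: "filterlim h (at 0) sequentially" unfolding h_def by (rule inverse_Suc_at_0)
  have lim1: "(\<lambda>k. LINT x|gauss_tilt f. L k x) \<longlonglongrightarrow> (LINT x|gauss_tilt f. gradf x \<bullet> x)"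
  proof (rule integral_dominated_convergence)
    show "integrable (gauss_tilt f) (\<lambda>x. \<Lambda> * norm x)" by (rule tilt_int[OF gL])
    show "AE x in gauss_tilt f. (\<lambda>k. L k x) \<longlonglongrightarrow> gradf x \<bullet> x"
    proof (rule AE_I2)
      fix x :: 'a
      have "((\<lambda>t. x + t *\<^sub>R x) has_vector_derivative x) (at 0)"
        by (auto intro!: derivative_eq_intros)
      from curve_derivative_sequence[where p = "\<lambda>t. x + t *\<^sub>R x", OF grad[of x] this _ hat]
      show "(\<lambda>k. L k x) \<longlonglongrightarrow> gradf x \<bullet> x" by (simp add: L_def)
    qed
  qed (use Lb in auto)
  have lim2: "(\<lambda>k. LINT x|gauss_tilt f. U k x) \<longlonglongrightarrow> (LINT x|gauss_tilt f. 2 * f x)"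
  proof (rule integral_dominated_convergence)
    show "integrable (gauss_tilt f) (\<lambda>x. 3 * \<bar>f x\<bar> * exp (3 * \<bar>f x\<bar>))" by (rule tilt_int[OF gU])
    show "AE x in gauss_tilt f. (\<lambda>k. U k x) \<longlonglongrightarrow> 2 * f x"
    proof (rule AE_I2)
      fix x :: 'a
      have "((\<lambda>t. exp ((2 * t + t\<^sup>2) * f x)) has_real_derivative
          exp ((2 * 0 + 0\<^sup>2) * f x) * ((2 + 2 * 0) * f x)) (at 0)"
        by (rule derivative_eq_intros refl | simp)+
      hence "((\<lambda>t. (exp ((2 * t + t\<^sup>2) * f x) - 1) / t) \<longlongrightarrow> 2 * f x) (at 0)"
        unfolding DERIV_def by simp
      from filterlim_compose[OF this hat]
      show "(\<lambda>k. U k x) \<longlonglongrightarrow> 2 * f x" unfolding U_def .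
    qed
    show "AE x in gauss_tilt f. norm (U k x) \<le> 3 * \<bar>f x\<bar> * exp (3 * \<bar>f x\<bar>)" for k
      by (rule AE_I2) (use Ub in simp)
  qed measurable
  have "(\<lambda>k. (LINT x|gauss_tilt f. U k x) / (1 + h k)\<^sup>2 + (LINT y|std_gaussian. S y))
      \<longlonglongrightarrow> (LINT x|gauss_tilt f. 2 * f x) / (1 + 0)\<^sup>2 + (LINT y|std_gaussian. S y)"
    by (rule tendsto_add[OF tendsto_divide[OF lim2 tendsto_power[OF tendsto_add[OF tendsto_const hlim]]] tendsto_const]) simp
  hence "(LINT x|gauss_tilt f. gradf x \<bullet> x)
      \<le> (LINT x|gauss_tilt f. 2 * f x) / (1 + 0)\<^sup>2 + (LINT y|std_gaussian. S y)"
    by (rule LIMSEQ_le[OF lim1]) (use main in blast)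
  thus ?thesis by simp
qed

section \<open>Pointwise lower bounds on the Laplacian\<close>

text \<open>This is how the Laplacian meets the heat flow: by the covariance identity, the mean of
  the quadratic form of the Hessian is its trace.\<close>

lemma integral_gauss_quadratic:
  fixes A :: "'a::euclidean_space \<Rightarrow> 'a"
  assumes "linear A"
  shows "(LINT y|std_gaussian. A y \<bullet> y) = (\<Sum>b\<in>Basis. A b \<bullet> b)"
proof -
  have "A y \<bullet> y = (\<Sum>b\<in>Basis. (b \<bullet> y) * (A b \<bullet> y))" for y
  proof -
    have "A y = A (\<Sum>b\<in>Basis. (y \<bullet> b) *\<^sub>R b)" by (simp add: euclidean_representation)
    also have "\<dots> = (\<Sum>b\<in>Basis. (y \<bullet> b) *\<^sub>R A b)"
      by (simp add: linear_sum[OF assms] linear_cmul[OF assms])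
    finally have "A y \<bullet> y = (\<Sum>b\<in>Basis. (y \<bullet> b) *\<^sub>R A b) \<bullet> y" by (rule arg_cong)
    thus ?thesis by (simp only: inner_sum_left inner_scaleR_left inner_commute[of y])
  qed
  hence "(LINT y|std_gaussian. A y \<bullet> y) = (\<Sum>b\<in>Basis. LINT y|std_gaussian. (b \<bullet> y) * (A b \<bullet> y))"
    by (simp, intro Bochner_Integration.integral_sum exp_growth_integrable exp_growth_mult exp_growth_inner)
  also have "\<dots> = (\<Sum>b\<in>Basis. A b \<bullet> b)"
    unfolding integral_gauss_inner_inner by (simp add: inner_commute)
  finally show ?thesis .
qed

lemma integral_gauss_norm_sq:
  "(LINT y|(std_gaussian :: 'a::euclidean_space measure). (norm (x + s *\<^sub>R y))\<^sup>2) = (norm x)\<^sup>2 + s\<^sup>2 * DIM('a)"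
proof -
  have "(LINT y|(std_gaussian :: 'a measure). y \<bullet> y) = (\<Sum>b\<in>(Basis::'a set). b \<bullet> b)"
    using integral_gauss_quadratic[of "id :: 'a \<Rightarrow> 'a"] by (simp add: linear_id)
  hence 1: "(LINT y|(std_gaussian :: 'a measure). (norm y)\<^sup>2) = DIM('a)"
    by (simp add: power2_norm_eq_inner)
  have "(LINT y|std_gaussian. (norm (x + s *\<^sub>R y))\<^sup>2)
      = (LINT y|std_gaussian. (norm x)\<^sup>2 + (2 * s) * (x \<bullet> y) + s\<^sup>2 * (norm y)\<^sup>2)"
    unfolding power2_norm_eq_inner
    by (intro Bochner_Integration.integral_cong refl)
       (simp add: inner_add inner_commute power2_eq_square algebra_simps)
  also have "\<dots> = (norm x)\<^sup>2 + (2 * s) * (LINT y|std_gaussian. x \<bullet> y) + s\<^sup>2 * (LINT y|(std_gaussian :: 'a measure). (norm y)\<^sup>2)"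
    using exp_growth_integrable[OF exp_growth_inner[of x]]
      exp_growth_integrable[OF exp_growth_power[OF exp_growth_norm[where 'a = 'a], of 2]]
    by (simp add: gauss.prob_space[simplified])
  finally show ?thesis by (simp add: 1 integral_gauss_inner)
qed

lemma has_real_derivative_along_line:
  fixes f :: "'a::euclidean_space \<Rightarrow> real"
  assumes grad: "\<And>x. (f has_derivative (\<lambda>h. gradf x \<bullet> h)) (at x)"
  shows "((\<lambda>t. f (x + t *\<^sub>R h)) has_real_derivative gradf (x + t *\<^sub>R h) \<bullet> h) (at t)"
proof -
  have "((\<lambda>t. x + t *\<^sub>R h) has_derivative (\<lambda>s. s *\<^sub>R h)) (at t)"
    by (auto intro!: derivative_eq_intros)
  from has_derivative_compose[OF this grad]
  have "((\<lambda>t. f (x + t *\<^sub>R h)) has_derivative (\<lambda>s. gradf (x + t *\<^sub>R h) \<bullet> (s *\<^sub>R h))) (at t)" .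
  thus ?thesis
    unfolding has_field_derivative_def
    by (rule has_derivative_eq_rhs) (simp add: fun_eq_iff mult.commute)
qed

text \<open>Peano form of the remainder. The mean value theorem along the segment leaves the
  first-order error of the gradient at \<open>x\<close>, so differentiability of
  \<open>gradf\<close> at this single point suffices and continuity of the Hessian does not
  enter.\<close>

lemma second_order_taylor:
  fixes f :: "'a::euclidean_space \<Rightarrow> real"
  assumes grad: "\<And>x. (f has_derivative (\<lambda>h. gradf x \<bullet> h)) (at x)"
    and hess: "(gradf has_derivative A) (at x)" and "e > 0"
  obtains d where "d > 0"
    "\<And>h. norm h < d \<Longrightarrow> \<bar>f (x + h) - f x - gradf x \<bullet> h - A h \<bullet> h / 2\<bar> \<le> e * (norm h)\<^sup>2"
proof -
  have A: "bounded_linear A" using hess by (rule has_derivative_bounded_linear)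
  obtain d where d: "d > 0" "\<And>y. norm (y - x) < d \<Longrightarrow> norm (gradf y - gradf x - A (y - x)) \<le> e * norm (y - x)"
    using hess \<open>e > 0\<close> unfolding has_derivative_at_alt by blast
  show thesis
  proof (rule that[OF d(1)])
    fix h :: 'a assume h: "norm h < d"
    define \<phi> where "\<phi> t = f (x + t *\<^sub>R h) - t * (gradf x \<bullet> h) - t\<^sup>2 / 2 * (A h \<bullet> h)" for t
    define \<phi>' where "\<phi>' t = gradf (x + t *\<^sub>R h) \<bullet> h - gradf x \<bullet> h - t * (A h \<bullet> h)" for t
    have "(\<phi> has_real_derivative \<phi>' t) (at t)" for t
      unfolding \<phi>_def \<phi>'_def
      by (auto intro!: derivative_eq_intros has_real_derivative_along_line[OF grad])
    from MVT2[of 0 1 \<phi> \<phi>'] this obtain t where t: "0 < t" "t < 1" "\<phi> 1 - \<phi> 0 = \<phi>' t" by auto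
    have "\<phi>' t = (gradf (x + t *\<^sub>R h) - gradf x - A (t *\<^sub>R h)) \<bullet> h"
      using linear_cmul[OF bounded_linear.linear[OF A]] by (simp add: \<phi>'_def inner_diff_left)
    also have "\<bar>\<dots>\<bar> \<le> norm (gradf (x + t *\<^sub>R h) - gradf x - A (t *\<^sub>R h)) * norm h"
      by (rule Cauchy_Schwarz_ineq2)
    also have "\<dots> \<le> (e * norm (t *\<^sub>R h)) * norm h"
    proof (rule mult_right_mono)
      have "t * norm h \<le> 1 * norm h" using t by (intro mult_right_mono) auto
      hence "norm (x + t *\<^sub>R h - x) < d" using h t by simp
      from d(2)[OF this] show "norm (gradf (x + t *\<^sub>R h) - gradf x - A (t *\<^sub>R h)) \<le> e * norm (t *\<^sub>R h)"
        by simp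
    qed simp
    also have "\<dots> = t * (e * (norm h)\<^sup>2)" using t by (simp add: power2_eq_square)
    also have "\<dots> \<le> 1 * (e * (norm h)\<^sup>2)" using t \<open>e > 0\<close> by (intro mult_right_mono) auto
    finally have "\<bar>\<phi> 1 - \<phi> 0\<bar> \<le> e * (norm h)\<^sup>2" using t by simp
    thus "\<bar>f (x + h) - f x - gradf x \<bullet> h - A h \<bullet> h / 2\<bar> \<le> e * (norm h)\<^sup>2"
      by (simp add: \<phi>_def algebra_simps)
  qed
qed

text \<open>In the Taylor expansion the linear term has mean zero and the quadratic one contributes
  half the trace. Dominated convergence requires a bound C |h|^2 for all \<open>h\<close>, obtained
  from Taylor near 0 and from Lipschitz growth elsewhere.\<close>

lemma heat_second_order:
  fixes f :: "'a::euclidean_space \<Rightarrow> real"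
  assumes f: "\<Lambda>-lipschitz_on UNIV f"
    and grad: "\<And>x. (f has_derivative (\<lambda>h. gradf x \<bullet> h)) (at x)"
    and hess: "(gradf has_derivative A) (at x)"
    and s: "s \<longlonglongrightarrow> 0" "\<And>k. s k > 0"
  shows "(\<lambda>k. ((LINT y|std_gaussian. f (x + s k *\<^sub>R y)) - f x) / (s k)\<^sup>2) \<longlonglongrightarrow> (\<Sum>b\<in>Basis. A b \<bullet> b) / 2"
proof -
  note [measurable] = lipschitz_measurable[OF f]
  have \<Lambda>: "\<Lambda> \<ge> 0" using f by (rule lipschitz_on_nonneg)
  have A: "bounded_linear A" using hess by (rule has_derivative_bounded_linear)
  note [measurable] = borel_measurable_continuous_onI[OF linear_continuous_on[OF A]]
  obtain NA where NA: "NA \<ge> 0" "\<And>h. norm (A h) \<le> norm h * NA"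
    using bounded_linear.nonneg_bounded[OF A] by blast
  obtain d where d: "d > 0"
    "\<And>h. norm h < d \<Longrightarrow> \<bar>f (x + h) - f x - gradf x \<bullet> h - A h \<bullet> h / 2\<bar> \<le> 1 * (norm h)\<^sup>2"
    using second_order_taylor[OF grad hess, of 1] by auto
  define R where "R h = f (x + h) - f x - gradf x \<bullet> h" for h
  \<comment> \<open>The part \<open>1 + NA\<close> is for \<open>norm h < d\<close>; the last
    summand converts linear growth into quadratic growth for \<open>norm h \<ge> d\<close>.\<close>
  define C where "C = 1 + NA + (\<Lambda> + norm (gradf x)) / d"
  have Ah: "\<bar>A h \<bullet> h\<bar> \<le> NA * (norm h)\<^sup>2" for h
    using order_trans[OF Cauchy_Schwarz_ineq2 mult_right_mono[OF NA(2)[of h] norm_ge_zero[of h]]]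
    by (simp add: power2_eq_square mult_ac)
  have Rb: "\<bar>R h\<bar> \<le> C * (norm h)\<^sup>2" for h
  proof (cases "norm h < d")
    case True
    have "\<bar>R h\<bar> \<le> 1 * (norm h)\<^sup>2 + \<bar>A h \<bullet> h\<bar> / 2" using d(2)[OF True] unfolding R_def by linarith
    also have "\<dots> \<le> 1 * (norm h)\<^sup>2 + NA * (norm h)\<^sup>2" using Ah[of h] by linarith
    also have "\<dots> \<le> C * (norm h)\<^sup>2"
      unfolding C_def distrib_right[symmetric] using \<Lambda> d(1) by (intro mult_right_mono) auto
    finally show ?thesis .
  next
    case False
    have "\<bar>R h\<bar> \<le> \<Lambda> * norm h + norm (gradf x) * norm h"
      using lipschitz_bound[OF f, of "x + h" x] Cauchy_Schwarz_ineq2[of "gradf x" h] unfolding R_def by simp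
    also have "\<dots> = (\<Lambda> + norm (gradf x)) / d * (d * norm h)" using d(1) by (simp add: field_simps)
    also have "\<dots> \<le> (\<Lambda> + norm (gradf x)) / d * (norm h)\<^sup>2"
      unfolding power2_eq_square using False \<Lambda> d(1) by (intro mult_left_mono mult_right_mono) auto
    also have "\<dots> \<le> C * (norm h)\<^sup>2" unfolding C_def using NA by (intro mult_right_mono) auto
    finally show ?thesis .
  qed
  have "(\<lambda>k. LINT y|std_gaussian. R (s k *\<^sub>R y) / (s k)\<^sup>2) \<longlonglongrightarrow> (LINT y|std_gaussian. A y \<bullet> y / 2)"
  proof (rule integral_dominated_convergence)
    show "integrable std_gaussian (\<lambda>y::'a. C * (norm y)\<^sup>2)"
      by (intro exp_growth_integrable exp_growth_mult exp_growth_const exp_growth_power exp_growth_norm)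
    show "AE y in std_gaussian. norm (R (s k *\<^sub>R y) / (s k)\<^sup>2) \<le> C * (norm y)\<^sup>2" for k
    proof (rule AE_I2)
      show "norm (R (s k *\<^sub>R y) / (s k)\<^sup>2) \<le> C * (norm y)\<^sup>2" for y
        using Rb[of "s k *\<^sub>R y"] s(2)[of k] by (simp add: power_mult_distrib field_simps)
    qed
    show "AE y in std_gaussian. (\<lambda>k. R (s k *\<^sub>R y) / (s k)\<^sup>2) \<longlonglongrightarrow> A y \<bullet> y / 2"
    proof (rule AE_I2, rule LIMSEQ_I)
      fix y :: 'a and r :: real assume r: "r > 0"
      \<comment> \<open>The summand 1 keeps the divisor in \<open>e\<close> positive even if
        \<open>y = 0\<close>.\<close>
      define D where "D = (norm y)\<^sup>2 + 1"
      have D: "D > 0" by (simp add: D_def add_nonneg_pos)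
      define e where "e = r / (2 * D)"
      have e: "e > 0" using r D by (simp add: e_def)
      obtain d where d: "d > 0"
        "\<And>h. norm h < d \<Longrightarrow> \<bar>f (x + h) - f x - gradf x \<bullet> h - A h \<bullet> h / 2\<bar> \<le> e * (norm h)\<^sup>2"
        using second_order_taylor[OF grad hess e] by auto
      have "(\<lambda>k. s k *\<^sub>R y) \<longlonglongrightarrow> 0 *\<^sub>R y" by (intro tendsto_intros s)
      then obtain K where K: "\<And>k. k \<ge> K \<Longrightarrow> norm (s k *\<^sub>R y) < d"
        using LIMSEQ_D[OF _ d(1), of "\<lambda>k. s k *\<^sub>R y" 0] by auto
      have "norm (R (s k *\<^sub>R y) / (s k)\<^sup>2 - A y \<bullet> y / 2) < r" if "k \<ge> K" for k
      proof -
        have "\<bar>R (s k *\<^sub>R y) - A (s k *\<^sub>R y) \<bullet> (s k *\<^sub>R y) / 2\<bar> \<le> e * (norm (s k *\<^sub>R y))\<^sup>2"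
          using d(2)[OF K[OF that]] by (simp add: R_def)
        hence "\<bar>R (s k *\<^sub>R y) - (s k)\<^sup>2 * (A y \<bullet> y / 2)\<bar> \<le> (s k)\<^sup>2 * (e * (norm y)\<^sup>2)"
          using linear_cmul[OF bounded_linear.linear[OF A], of "s k" y]
          by (simp add: power_mult_distrib power2_eq_square[of "s k"] mult_ac)
        moreover have "R (s k *\<^sub>R y) / (s k)\<^sup>2 - A y \<bullet> y / 2 = (R (s k *\<^sub>R y) - (s k)\<^sup>2 * (A y \<bullet> y / 2)) / (s k)\<^sup>2"
          using s(2)[of k] by (simp add: diff_divide_distrib)
        ultimately have "\<bar>R (s k *\<^sub>R y) / (s k)\<^sup>2 - A y \<bullet> y / 2\<bar> \<le> e * (norm y)\<^sup>2"
          using s(2)[of k] by (simp add: abs_divide pos_divide_le_eq mult.commute)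
        also have "\<dots> \<le> e * D" using e by (simp add: D_def)
        also have "\<dots> = r / 2" using D by (simp add: e_def)
        also have "\<dots> < r" using r by simp
        finally show ?thesis by simp
      qed
      thus "\<exists>no. \<forall>n\<ge>no. norm (R (s n *\<^sub>R y) / (s n)\<^sup>2 - A y \<bullet> y / 2) < r" by blast
    qed
  qed (simp_all add: R_def)
  moreover have "(LINT y|std_gaussian. R (s k *\<^sub>R y) / (s k)\<^sup>2)
      = ((LINT y|std_gaussian. f (x + s k *\<^sub>R y)) - f x) / (s k)\<^sup>2" for k
    unfolding R_def
    using exp_growth_integrable[OF exp_growth_lipschitz_affine(1)[OF f, of x "s k"]]
      exp_growth_integrable[OF exp_growth_inner[of "s k *\<^sub>R gradf x"]]
      integral_gauss_inner[of "s k *\<^sub>R gradf x"]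
    by (simp add: gauss.prob_space[simplified])
  moreover have "(LINT y|std_gaussian. A y \<bullet> y / 2) = (\<Sum>b\<in>Basis. A b \<bullet> b) / 2"
    using integral_gauss_quadratic[OF bounded_linear.linear[OF A]] by simp
  ultimately show ?thesis by (simp only:)
qed

text \<open>Parametrised by the standard deviation, the heat flow of a Lipschitz function is jointly
  Lipschitz down to 0; in the time variable it is in general only Hoelder of order 1/2 there. The
  maximum principle needs continuity on a compact set that includes time zero.\<close>

lemma heat_jointly_continuous:
  fixes f :: "'a::euclidean_space \<Rightarrow> real"
  assumes f: "\<Lambda>-lipschitz_on UNIV f"
  shows "continuous_on UNIV (\<lambda>p :: real \<times> 'a. LINT y|std_gaussian. f (snd p + fst p *\<^sub>R y))"
proof -
  let ?m = "LINT y|(std_gaussian::'a measure). norm y"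
  have \<Lambda>: "\<Lambda> \<ge> 0" using f by (rule lipschitz_on_nonneg)
  note gf = exp_growth_lipschitz_affine(1)[OF f]
  have gm: "integrable std_gaussian (norm :: 'a \<Rightarrow> real)"
    by (intro exp_growth_integrable exp_growth_norm)
  have m0: "?m \<ge> 0" by simp
  have "(\<Lambda> * (1 + ?m))-lipschitz_on UNIV (\<lambda>p :: real \<times> 'a. LINT y|std_gaussian. f (snd p + fst p *\<^sub>R y))"
  proof (rule lipschitz_onI)
    fix p q :: "real \<times> 'a"
    have "(LINT y|std_gaussian. f (snd p + fst p *\<^sub>R y)) - (LINT y|std_gaussian. f (snd q + fst q *\<^sub>R y))
        = (LINT y|std_gaussian. f (snd p + fst p *\<^sub>R y) - f (snd q + fst q *\<^sub>R y))"
      using exp_growth_integrable[OF gf] by simp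
    also have "\<bar>\<dots>\<bar> \<le> (LINT y|std_gaussian. \<bar>f (snd p + fst p *\<^sub>R y) - f (snd q + fst q *\<^sub>R y)\<bar>)"
      by (rule integral_abs_bound)
    also have "\<dots> \<le> (LINT y|(std_gaussian::'a measure). \<Lambda> * dist p q * (1 + norm y))"
    proof (rule integral_mono)
      fix y :: 'a
      have "norm (snd p + fst p *\<^sub>R y - (snd q + fst q *\<^sub>R y)) \<le> norm (snd p - snd q) + norm ((fst p - fst q) *\<^sub>R y)"
        by (rule order_trans[OF _ norm_triangle_ineq]) (simp add: algebra_simps)
      also have "\<dots> \<le> dist p q + dist p q * norm y"
        using dist_fst_le[of p q] dist_snd_le[of p q]
        by (auto simp: dist_norm intro!: add_mono mult_right_mono)
      finally have "\<Lambda> * norm (snd p + fst p *\<^sub>R y - (snd q + fst q *\<^sub>R y)) \<le> \<Lambda> * (dist p q + dist p q * norm y)"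
        using \<Lambda> by (rule mult_left_mono)
      thus "\<bar>f (snd p + fst p *\<^sub>R y) - f (snd q + fst q *\<^sub>R y)\<bar> \<le> \<Lambda> * dist p q * (1 + norm y)"
        by (intro order_trans[OF lipschitz_bound[OF f]]) (simp add: algebra_simps)
    next
      show "integrable std_gaussian (\<lambda>y::'a. \<Lambda> * dist p q * (1 + norm y))" using gm by simp
    qed (intro exp_growth_integrable exp_growth_abs exp_growth_diff gf)
    also have "\<dots> = \<Lambda> * (1 + ?m) * dist p q"
      using gm by (simp add: gauss.prob_space[simplified])
    finally show "dist (LINT y|std_gaussian. f (snd p + fst p *\<^sub>R y)) (LINT y|std_gaussian. f (snd q + fst q *\<^sub>R y))
        \<le> \<Lambda> * (1 + ?m) * dist p q" by (simp add: dist_norm)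
  qed (use \<Lambda> m0 in auto)
  thus ?thesis by (rule lipschitz_on_continuous_on)
qed

text \<open>Parabolic maximum principle with the penalty \<open>e (|x|\<^sup>2 + 2 (n + 1) r\<^sup>2)\<close>, where \<open>r\<close> is the square root of
  time: at a negative minimum the semigroup property bounds the second-order difference quotient of
  \<open>f\<close> by \<open>L/2 - e (n + 2)\<close>. Only a pointwise second derivative of \<open>f\<close> is needed.\<close>
lemma heat_minus_id_ge:
  fixes f :: "'a::euclidean_space \<Rightarrow> real"
  assumes f: "\<Lambda>-lipschitz_on UNIV f"
    and grad: "\<And>x. (f has_derivative (\<lambda>h. gradf x \<bullet> h)) (at x)"
    and hess: "\<And>x. (gradf has_derivative hessf x) (at x)"
    and L: "\<And>x. L \<le> laplacian hessf x" and T: "T \<ge> 0"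
  shows "f x + L * T\<^sup>2 / 2 \<le> (LINT y|std_gaussian. f (x + T *\<^sub>R y))"
proof -
  let ?n = "real DIM('a)"
  define G where "G p = (LINT y|std_gaussian. f (snd p + fst p *\<^sub>R y))" for p :: "real \<times> 'a"
  define m where "m = (LINT y|(std_gaussian::'a measure). norm y)"
  note gf = exp_growth_lipschitz_affine(1)[OF f]
  have \<Lambda>: "\<Lambda> \<ge> 0" using f by (rule lipschitz_on_nonneg)
  have m0: "m \<ge> 0" by (simp add: m_def)
  have key: "G (r, x) - f x - L * r\<^sup>2 / 2 + e * ((norm x)\<^sup>2 + 2 * (?n + 1) * r\<^sup>2) \<ge> 0"
    if e: "e > 0" and r: "0 \<le> r" "r \<le> T" for e r x
  proof (rule ccontr)
    define u where "u p = G p - f (snd p) - L * (fst p)\<^sup>2 / 2 + e * ((norm (snd p))\<^sup>2 + 2 * (?n + 1) * (fst p)\<^sup>2)"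
      for p :: "real \<times> 'a"
    assume "\<not> ?thesis"
    hence neg: "u (r, x) < 0" by (simp add: u_def)
    \<comment> \<open>\<open>B\<close> bounds the unpenalised part of \<open>u\<close> for all r
      \<le> T. Outside the ball of radius \<open>\<rho>\<close> the penalty e |x|^2 outweighs it, so
      a negative minimum over \<open>K\<close> is a minimum over all of space.\<close>
    define B where "B = \<Lambda> * T * m + \<bar>L\<bar> * T\<^sup>2 / 2"
    define \<rho> where "\<rho> = sqrt (B / e)"
    have B0: "B \<ge> 0" unfolding B_def using \<Lambda> T m0 by simp
    have far: "u (r, x) \<ge> 0" if "0 \<le> r" "r \<le> T" "norm x > \<rho>" for r x
    proof -
      have "\<bar>G (r, x) - f x\<bar> \<le> \<Lambda> * r * m"
        unfolding G_def m_def using heat_close[OF f that(1), of x] by simp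
      also have "\<dots> \<le> \<Lambda> * T * m" using \<Lambda> m0 that by (intro mult_right_mono mult_left_mono) auto
      finally have 1: "\<bar>G (r, x) - f x\<bar> \<le> \<Lambda> * T * m" .
      have "r\<^sup>2 \<le> T\<^sup>2" using that by (intro power_mono) auto
      hence "\<bar>L\<bar> * r\<^sup>2 \<le> \<bar>L\<bar> * T\<^sup>2" by (intro mult_left_mono) auto
      hence 2: "L * r\<^sup>2 / 2 \<le> \<bar>L\<bar> * T\<^sup>2 / 2"
        using mult_right_mono[OF abs_ge_self[of L], of "r\<^sup>2"] by simp
      have "\<rho>\<^sup>2 \<le> (norm x)\<^sup>2" using that B0 e by (intro power_mono) (auto simp: \<rho>_def)
      hence "B / e \<le> (norm x)\<^sup>2" using B0 e by (simp add: \<rho>_def)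
      hence 3: "B \<le> e * (norm x)\<^sup>2" using e by (simp add: field_simps)
      have 4: "0 \<le> e * (2 * (?n + 1) * r\<^sup>2)" using e by simp
      show ?thesis unfolding u_def using 1 2 3 4 by (simp add: B_def distrib_left)
    qed
    define K where "K = {0..T} \<times> cball (0::'a) \<rho>"
    have rxK: "(r, x) \<in> K" using neg far[OF r, of x] r by (force simp: K_def)
    have cu: "continuous_on K u"
    proof -
      have "continuous_on K G" unfolding G_def
        using heat_jointly_continuous[OF f] continuous_on_subset by blast
      moreover have "continuous_on K (\<lambda>p. f (snd p))"
        by (rule continuous_on_compose2[OF lipschitz_on_continuous_on[OF f]]) (auto intro!: continuous_intros)
      ultimately show ?thesis unfolding u_def by (intro continuous_intros) auto
    qed
    have "compact K" unfolding K_def by (intro compact_Times) auto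
    then obtain p where p: "p \<in> K" "\<And>q. q \<in> K \<Longrightarrow> u p \<le> u q"
      using continuous_attains_inf[OF _ _ cu] rxK by blast
    obtain r0 x0 where p0: "p = (r0, x0)" by force
    define \<mu> where "\<mu> = u (r0, x0)"
    have \<mu>neg: "\<mu> < 0" using p(2)[OF rxK] neg by (simp add: \<mu>_def p0)
    have r0: "0 \<le> r0" "r0 \<le> T" using p(1) by (auto simp: K_def p0)
    have glob: "\<mu> \<le> u (q, z)" if "0 \<le> q" "q \<le> T" for q z
      using p(2)[of "(q, z)"] far[OF that, of z] \<mu>neg that by (cases "norm z \<le> \<rho>") (auto simp: K_def p0 \<mu>_def)
    \<comment> \<open>At \<open>r = 0\<close> the heat flow equals \<open>f\<close> and
      \<open>u\<close> is the nonnegative penalty. A negative minimum thus sits at positive time,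
      which leaves room to go back by \<open>s k\<close>.\<close>
    have "r0 \<noteq> 0"
    proof
      assume "r0 = 0"
      hence "u (r0, x0) = e * (norm x0)\<^sup>2" by (simp add: u_def G_def gauss.prob_space[simplified])
      thus False using \<mu>neg e by (simp add: \<mu>_def mult_less_0_iff)
    qed
    hence r0pos: "r0 > 0" using r0 by simp
    define s where "s k = r0 / real (Suc k)" for k
    have s: "s k > 0" "s k \<le> r0" for k using r0pos by (simp_all add: s_def field_simps)
    have "((LINT y|std_gaussian. f (x0 + s k *\<^sub>R y)) - f x0) / (s k)\<^sup>2 \<le> L / 2 - e * (?n + 2)" for k
    proof -
      \<comment> \<open>This splits the variance r0^2 into those of \<open>s k\<close> and
        \<open>q\<close>: the value of \<open>G\<close> at \<open>(r0, x0)\<close> is the Gaussian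
        mean of \<open>G (q, x0 + s k y)\<close>, each of which is bounded below by
        minimality.\<close>
      define q where "q = sqrt (r0\<^sup>2 - (s k)\<^sup>2)"
      have "(s k)\<^sup>2 \<le> r0\<^sup>2" using s[of k] by (intro power_mono) auto
      hence q2: "q\<^sup>2 = r0\<^sup>2 - (s k)\<^sup>2" by (simp add: q_def)
      have q0: "0 \<le> q" by (simp add: q_def \<open>(s k)\<^sup>2 \<le> r0\<^sup>2\<close>)
      have "q\<^sup>2 \<le> r0\<^sup>2" using q2 by simp
      hence "q \<le> r0" using r0(1) by (rule power2_le_imp_le)
      hence qT: "q \<le> T" using r0 by simp
      let ?low = "\<lambda>z::'a. \<mu> + f z + L * q\<^sup>2 / 2 - e * (norm z)\<^sup>2 - e * (2 * (?n + 1) * q\<^sup>2)"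
      have low: "?low z \<le> G (q, z)" for z
        using glob[OF q0 qT, of z] by (simp add: u_def distrib_left)
      have gn: "integrable std_gaussian (\<lambda>y::'a. (norm (x0 + s k *\<^sub>R y))\<^sup>2)"
        by (intro exp_growth_integrable exp_growth_power exp_growth_affine[where \<phi> = norm] exp_growth_norm)
      have G_lip: "\<Lambda>-lipschitz_on UNIV (\<lambda>z. G (q, z))"
        unfolding G_def using heat_lipschitz[OF f] by simp
      have "(LINT y|std_gaussian. ?low (x0 + s k *\<^sub>R y)) \<le> (LINT y|std_gaussian. G (q, x0 + s k *\<^sub>R y))"
        using low gn exp_growth_integrable[OF gf[of x0 "s k"]]
          exp_growth_integrable[OF exp_growth_lipschitz_affine(1)[OF G_lip, of x0 "s k"]]
        by (intro integral_mono) auto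
      also have "\<dots> = G (r0, x0)"
        unfolding G_def fst_conv snd_conv
        using s[of k] q0 r0 q2 by (intro gauss_convolution exp_growth_lipschitz(1)[OF f]) auto
      also have "(LINT y|std_gaussian. ?low (x0 + s k *\<^sub>R y))
          = \<mu> + (LINT y|std_gaussian. f (x0 + s k *\<^sub>R y)) + L * q\<^sup>2 / 2
             - e * ((norm x0)\<^sup>2 + (s k)\<^sup>2 * ?n) - e * (2 * (?n + 1) * q\<^sup>2)"
        using gn exp_growth_integrable[OF gf[of x0 "s k"]]
        by (simp add: integral_gauss_norm_sq gauss.prob_space[simplified])
      also have "G (r0, x0) = \<mu> + f x0 + L * r0\<^sup>2 / 2 - e * ((norm x0)\<^sup>2 + 2 * (?n + 1) * r0\<^sup>2)"
        by (simp add: \<mu>_def u_def)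
      \<comment> \<open>Averaging |z|^2 adds n s^2, while the time penalty decreases by 2 (n + 1)
        s^2. The surplus n + 2 is positive, which makes the later contradiction strict.\<close>
      finally have "(LINT y|std_gaussian. f (x0 + s k *\<^sub>R y)) - f x0 \<le> (L / 2 - e * (?n + 2)) * (s k)\<^sup>2"
        unfolding q2 by (simp add: algebra_simps diff_divide_distrib)
      thus ?thesis using s[of k] by (simp add: pos_divide_le_eq)
    qed
    moreover have "s \<longlonglongrightarrow> 0" unfolding s_def by (intro LIMSEQ_Suc lim_const_over_n)
    hence "(\<lambda>k. ((LINT y|std_gaussian. f (x0 + s k *\<^sub>R y)) - f x0) / (s k)\<^sup>2) \<longlonglongrightarrow> (\<Sum>b\<in>Basis. hessf x0 b \<bullet> b) / 2"
      using s by (intro heat_second_order[OF f grad hess]) auto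
    ultimately have "(\<Sum>b\<in>Basis. hessf x0 b \<bullet> b) / 2 \<le> L / 2 - e * (?n + 2)"
      by (intro LIMSEQ_le_const2) auto
    moreover have "0 < e * (?n + 2)" using e by (intro mult_pos_pos) auto
    ultimately show False using L[of x0] by (simp add: laplacian_def)
  qed
  have "f x + L * T\<^sup>2 / 2 - G (T, x) \<le> 0"
  proof (rule field_le_epsilon)
    fix e :: real assume e: "e > 0"
    \<comment> \<open>The summand 1 makes \<open>c\<close> positive, and a penalty of weight
      \<open>e / c\<close> is then at most \<open>e\<close> at the point
      \<open>(T, x)\<close>.\<close>
    define c where "c = (norm x)\<^sup>2 + 2 * (?n + 1) * T\<^sup>2 + 1"
    have c: "c > 0" unfolding c_def by (intro add_nonneg_pos add_nonneg_nonneg mult_nonneg_nonneg) auto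
    have "e / c * (c - 1) \<le> e" using c e by (simp add: field_simps)
    moreover have "(norm x)\<^sup>2 + 2 * (?n + 1) * T\<^sup>2 = c - 1" by (simp add: c_def)
    ultimately show "f x + L * T\<^sup>2 / 2 - G (T, x) \<le> 0 + e"
      using key[of "e / c" T x] c e T by simp
  qed
  thus ?thesis by (simp add: G_def)
qed

section \<open>Dirichlet form\<close>

text \<open>Comparing \<open>f\<close> with its heat flow at the correlated pair \<open>(X, c X + s G)\<close>, which is exchangeable,
  replaces an integration by parts, for which the Laplacian would have to be integrable.\<close>

lemma dirichlet_form_le:
  fixes f :: "'a::euclidean_space \<Rightarrow> real"
  assumes f: "\<Lambda>-lipschitz_on UNIV f"
    and low: "\<And>x T. T \<ge> 0 \<Longrightarrow> f x + L * T\<^sup>2 / 2 \<le> (LINT y|std_gaussian. f (x + T *\<^sub>R y))"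
    and prob: "prob_space (gauss_tilt f)"
    and cs: "c\<^sup>2 + s\<^sup>2 = 1" "s > 0"
  shows "(LINT z|(std_gaussian \<Otimes>\<^sub>M std_gaussian). (case z of (x, y) \<Rightarrow>
            (f (c *\<^sub>R x + s *\<^sub>R y) - f x) * (exp (f (c *\<^sub>R x + s *\<^sub>R y)) - exp (f x))))
       \<le> - L * s\<^sup>2 - 2 * (LINT x|gauss_tilt f. f (c *\<^sub>R x) - f x)"
proof -
  note [measurable] = lipschitz_measurable[OF f]
  have \<Lambda>: "\<Lambda> \<ge> 0" using f by (rule lipschitz_on_nonneg)
  let ?P = "std_gaussian \<Otimes>\<^sub>M std_gaussian :: ('a \<times> 'a) measure"
  let ?Y = "\<lambda>x y. c *\<^sub>R x + s *\<^sub>R y :: 'a"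
  have Z: "(LINT x|std_gaussian. exp (f x)) = 1"
    by (rule prob_tilt_integral[OF lipschitz_measurable[OF f] prob])
  have "c\<^sup>2 \<le> 1" "s\<^sup>2 \<le> 1" using cs zero_le_power2[of c] zero_le_power2[of s] by linarith+
  hence c1: "\<bar>c\<bar> \<le> 1" "s \<le> 1" using cs(2) by (simp_all add: abs_square_le_1 power_le_one_iff abs_le_square_iff)
  have Yn: "norm (?Y x y) \<le> norm x + norm y" for x y
  proof -
    have "norm (?Y x y) \<le> \<bar>c\<bar> * norm x + s * norm y" using cs(2) by (intro norm_triangle_le) simp
    also have "\<dots> \<le> 1 * norm x + 1 * norm y" using c1 by (intro add_mono mult_right_mono) auto
    finally show ?thesis by simp
  qed
  have fn: "\<bar>f z\<bar> \<le> \<bar>f 0\<bar> + \<Lambda> * (norm x + norm y)" if "norm z \<le> norm x + norm y" for x y z :: 'a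
    using lipschitz_growth[OF f, of z] mult_left_mono[OF that \<Lambda>] by linarith
  have prod_int: "integrable ?P (\<lambda>(x, y). f (p x y) * exp (f (q x y)))"
    if [measurable]: "(\<lambda>(x, y). p x y) \<in> borel \<Otimes>\<^sub>M borel \<rightarrow>\<^sub>M borel" "(\<lambda>(x, y). q x y) \<in> borel \<Otimes>\<^sub>M borel \<rightarrow>\<^sub>M borel"
      and n: "\<And>x y. norm (p x y) \<le> norm x + norm y" "\<And>x y. norm (q x y) \<le> norm x + norm y"
    for p q :: "'a \<Rightarrow> 'a \<Rightarrow> 'a"
  proof (rule pair_growth_integrable)
    fix x y :: 'a
    let ?E = "\<bar>f 0\<bar> + \<Lambda> * (norm x + norm y)"
    have "\<bar>f (p x y)\<bar> \<le> exp ?E"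
      using fn[OF n(1)[of x y]] exp_ge_add_one_self[of ?E] by linarith
    moreover have "exp (f (q x y)) \<le> exp ?E"
      using fn[OF n(2)[of x y]] by simp
    ultimately have "\<bar>f (p x y) * exp (f (q x y))\<bar> \<le> exp ?E * exp ?E"
      unfolding abs_mult by (intro mult_mono) auto
    thus "\<bar>f (p x y) * exp (f (q x y))\<bar> \<le> exp (2 * \<bar>f 0\<bar> + (2 * \<Lambda>) * (norm x + norm y))"
      by (simp add: exp_add[symmetric] algebra_simps)
  qed measurable
  have m: "(\<lambda>(x, y). ?Y x y) \<in> borel \<Otimes>\<^sub>M borel \<rightarrow>\<^sub>M borel"
    "(\<lambda>(x, y). x) \<in> (borel :: 'a measure) \<Otimes>\<^sub>M (borel :: 'a measure) \<rightarrow>\<^sub>M borel"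
    by measurable
  have n: "norm x \<le> norm x + norm y" for x y :: 'a by simp
  note i = prod_int[OF m(1,2) Yn n] prod_int[OF m(2,2) n n] prod_int[OF m(1,1) Yn Yn] prod_int[OF m(2,1) n Yn]
  have i1: "integrable ?P (\<lambda>(x, y). (f (?Y x y) - f x) * exp (f x))"
    "integrable ?P (\<lambda>(x, y). (f (?Y x y) - f x) * exp (f (?Y x y)))"
    using Bochner_Integration.integrable_diff[OF i(1,2)] Bochner_Integration.integrable_diff[OF i(3,4)]
    by (simp_all add: case_prod_unfold left_diff_distrib)
  define I1 where "I1 = (LINT z|?P. (case z of (x, y) \<Rightarrow> (f (?Y x y) - f x) * exp (f x)))"
  \<comment> \<open>The increment of \<open>f\<close> is antisymmetric in the pair, so exchanging
    the entries turns the integral weighted at the new point into minus the one weighted at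
    \<open>x\<close>. The Dirichlet form is therefore -2 times \<open>I1\<close>.\<close>
  have swap: "(LINT z|?P. (case z of (x, y) \<Rightarrow> (f (?Y x y) - f x) * exp (f (?Y x y)))) = - I1"
  proof -
    let ?\<Phi> = "\<lambda>(a, b). (f b - f a) * exp (f b)"
    have [measurable]: "(\<lambda>(x, y). (x, ?Y x y)) \<in> ?P \<rightarrow>\<^sub>M borel" "(\<lambda>(x, y). (?Y x y, x)) \<in> ?P \<rightarrow>\<^sub>M borel"
      "fst \<in> (borel :: ('a \<times> 'a) measure) \<rightarrow>\<^sub>M borel" "snd \<in> (borel :: ('a \<times> 'a) measure) \<rightarrow>\<^sub>M borel"
      unfolding borel_prod[symmetric] by measurable
    have [measurable]: "?\<Phi> \<in> borel_measurable (borel :: ('a \<times> 'a) measure)"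
      unfolding case_prod_unfold by measurable
    have "(LINT z|?P. (case z of (x, y) \<Rightarrow> (f (?Y x y) - f x) * exp (f (?Y x y))))
        = (LINT w|distr ?P borel (\<lambda>(x, y). (x, ?Y x y)). ?\<Phi> w)"
      by (subst integral_distr) (auto simp: case_prod_unfold)
    also have "\<dots> = (LINT z|?P. (case z of (x, y) \<Rightarrow> (f x - f (?Y x y)) * exp (f x)))"
      unfolding gauss_exchangeable[OF cs]
      by (subst integral_distr) (auto simp: case_prod_unfold)
    also have "\<dots> = (LINT z|?P. - (case z of (x, y) \<Rightarrow> (f (?Y x y) - f x) * exp (f x)))"
      by (intro Bochner_Integration.integral_cong refl) (auto simp: algebra_simps)
    also have "\<dots> = - I1" unfolding I1_def by simp
    finally show ?thesis .
  qed
  have "(LINT z|?P. (case z of (x, y) \<Rightarrow> (f (?Y x y) - f x) * (exp (f (?Y x y)) - exp (f x))))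
      = (LINT z|?P. (case z of (x, y) \<Rightarrow> (f (?Y x y) - f x) * exp (f (?Y x y)))
           - (case z of (x, y) \<Rightarrow> (f (?Y x y) - f x) * exp (f x)))"
    by (intro Bochner_Integration.integral_cong refl) (auto simp: right_diff_distrib)
  also have "\<dots> = - 2 * I1"
    unfolding Bochner_Integration.integral_diff[OF i1(2,1)] swap by (simp add: I1_def)
  finally have eq: "(LINT z|?P. (case z of (x, y) \<Rightarrow> (f (?Y x y) - f x) * (exp (f (?Y x y)) - exp (f x)))) = - 2 * I1" .
  have "L * s\<^sup>2 / 2 + (LINT x|gauss_tilt f. f (c *\<^sub>R x) - f x) \<le> I1"
  proof -
    note gf = exp_growth_lipschitz_affine(1)[OF f]
    have ge: "exp_growth (\<lambda>x. exp (f x))" by (rule exp_growth_lipschitz(2)[OF f])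
    have gc: "exp_growth (\<lambda>x. f (c *\<^sub>R x))" using gf[of 0 c] by simp
    have gh: "exp_growth (\<lambda>x. LINT y|std_gaussian. f (c *\<^sub>R x + s *\<^sub>R y))"
      using exp_growth_lipschitz_affine(1)[OF heat_lipschitz[OF f, of s], of 0 c] by simp
    have "L * s\<^sup>2 / 2 + (LINT x|gauss_tilt f. f (c *\<^sub>R x) - f x)
        = (LINT x|std_gaussian. exp (f x) * (L * s\<^sup>2 / 2)) + (LINT x|std_gaussian. exp (f x) * (f (c *\<^sub>R x) - f x))"
      by (simp add: Z integral_tilt)
    also have "\<dots> = (LINT x|std_gaussian. exp (f x) * (L * s\<^sup>2 / 2) + exp (f x) * (f (c *\<^sub>R x) - f x))"
      by (intro Bochner_Integration.integral_add[symmetric] exp_growth_integrable exp_growth_mult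
          exp_growth_const exp_growth_diff ge gc exp_growth_lipschitz(1)[OF f])
    \<comment> \<open>For fixed \<open>x\<close> the integral over \<open>y\<close> is the heat flow
      started at \<open>c x\<close>; its lower bound there leaves f (c x) - f x as the drift
      term.\<close>
    also have "\<dots> \<le> (LINT x|std_gaussian. exp (f x) * ((LINT y|std_gaussian. f (c *\<^sub>R x + s *\<^sub>R y)) - f x))"
    proof (rule integral_mono)
      fix x :: 'a
      have "exp (f x) * (L * s\<^sup>2 / 2 + (f (c *\<^sub>R x) - f x)) \<le> exp (f x) * ((LINT y|std_gaussian. f (c *\<^sub>R x + s *\<^sub>R y)) - f x)"
        using low[of s "c *\<^sub>R x"] cs(2) by (intro mult_left_mono) auto
      thus "exp (f x) * (L * s\<^sup>2 / 2) + exp (f x) * (f (c *\<^sub>R x) - f x)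
          \<le> exp (f x) * ((LINT y|std_gaussian. f (c *\<^sub>R x + s *\<^sub>R y)) - f x)"
        by (simp add: distrib_left)
    qed (intro exp_growth_integrable exp_growth_add exp_growth_mult
          exp_growth_const exp_growth_diff ge gc gh exp_growth_lipschitz(1)[OF f])+
    also have "\<dots> = (LINT x|std_gaussian. (LINT y|std_gaussian. (f (c *\<^sub>R x + s *\<^sub>R y) - f x) * exp (f x)))"
      using exp_growth_integrable[OF gf] by (simp add: gauss.prob_space[simplified] mult.commute)
    also have "\<dots> = I1" unfolding I1_def by (rule pair_integral_fst[OF i1(1)])
    finally show ?thesis .
  qed
  thus ?thesis unfolding eq by simp
qed

text \<open>The Dirichlet form estimate is divided by s^2 with c = sqrt (1 - s^2). The left side
  tends to the Fisher information, as the covariance identity evaluates the integral over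
  \<open>y\<close>. On the right c = 1 - s^2 / 2 + ..., so (f (c x) - f x) / s^2 tends to - <gradf
  x, x> / 2.\<close>

lemma fisher_plus_laplacian_bound:
  fixes f :: "'a::euclidean_space \<Rightarrow> real"
  assumes f: "\<Lambda>-lipschitz_on UNIV f"
    and grad: "\<And>x. (f has_derivative (\<lambda>h. gradf x \<bullet> h)) (at x)"
    and low: "\<And>x T. T \<ge> 0 \<Longrightarrow> f x + L * T\<^sup>2 / 2 \<le> (LINT y|std_gaussian. f (x + T *\<^sub>R y))"
    and prob: "prob_space (gauss_tilt f)"
    and gm [measurable]: "gradf \<in> borel_measurable borel" and gb: "\<And>x. norm (gradf x) \<le> \<Lambda>"
  shows "fisher_info f gradf + L \<le> (LINT x|gauss_tilt f. gradf x \<bullet> x)"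
proof -
  note [measurable] = lipschitz_measurable[OF f]
  have \<Lambda>: "\<Lambda> \<ge> 0" using f by (rule lipschitz_on_nonneg)
  let ?P = "std_gaussian \<Otimes>\<^sub>M std_gaussian :: ('a \<times> 'a) measure"
  have [simp, measurable_cong]: "sets (gauss_tilt f) = sets borel" by (simp add: gauss_tilt_def)
  have [simp]: "space (gauss_tilt f) = UNIV" by (simp add: gauss_tilt_def)
  define s where "s k = 1 / real (Suc k)" for k
  define c where "c k = sqrt (1 - (s k)\<^sup>2)" for k
  have s: "s k > 0" "s k \<le> 1" for k by (simp_all add: s_def)
  have s2: "(s k)\<^sup>2 \<le> 1" for k using s[of k] by (simp add: power_le_one)
  have c2: "(c k)\<^sup>2 = 1 - (s k)\<^sup>2" for k using s2[of k] by (simp add: c_def)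
  have cs: "(c k)\<^sup>2 + (s k)\<^sup>2 = 1" for k by (simp add: c2)
  have c01: "0 \<le> c k" "c k \<le> 1" for k using s2[of k] by (simp_all add: c_def)
  \<comment> \<open>From c^2 \<le> c follows 1 - c \<le> 1 - c^2: the contraction is of second order
    in \<open>s\<close>, so \<open>E k\<close> stays bounded after division by s^2.\<close>
  have c1: "1 - c k \<le> (s k)\<^sup>2" for k
    using mult_left_mono[OF c01(2,1), of k k] c2[of k] by (simp add: power2_eq_square)
  have c1': "1 - c k \<le> s k" for k
    using c1[of k] power_decreasing[of 1 2 "s k"] s[of k] by simp
  have slim: "s \<longlonglongrightarrow> 0" unfolding s_def by (intro LIMSEQ_Suc[OF lim_1_over_n])
  have sat: "filterlim s (at 0) sequentially" unfolding s_def by (rule inverse_Suc_at_0)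
  define Y where "Y k x y = c k *\<^sub>R x + s k *\<^sub>R y" for k and x y :: 'a
  define D1 where "D1 k x y = (f (Y k x y) - f x) / s k" for k x y
  define D2 where "D2 k x y = (exp (f (Y k x y)) - exp (f x)) / s k" for k x y
  have D1b: "\<bar>D1 k x y\<bar> \<le> \<Lambda> * (norm x + norm y)" for k x y
  proof -
    have "norm (Y k x y - x) = norm ((1 - c k) *\<^sub>R (- x) + s k *\<^sub>R y)"
      by (simp add: Y_def algebra_simps)
    also have "\<dots> \<le> (1 - c k) * norm x + s k * norm y"
      using s[of k] c01[of k] by (intro norm_triangle_le) simp
    also have "\<dots> \<le> s k * norm x + s k * norm y" using c1'[of k] by (intro add_mono mult_right_mono) auto
    finally have "\<Lambda> * norm (Y k x y - x) \<le> \<Lambda> * (s k * norm x + s k * norm y)"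
      using \<Lambda> by (rule mult_left_mono)
    hence "\<bar>f (Y k x y) - f x\<bar> \<le> \<Lambda> * (norm x + norm y) * s k"
      using lipschitz_bound[OF f, of "Y k x y" x] by (simp add: algebra_simps)
    thus ?thesis using s(1)[of k] by (simp add: D1_def abs_divide pos_divide_le_eq)
  qed
  have D12: "D2 k x y = exp (f x) * ((exp (s k * D1 k x y) - 1) / s k)" for k x y
  proof -
    have "exp (f (Y k x y)) = exp (f x) * exp (s k * D1 k x y)"
      using s(1)[of k] by (simp add: D1_def exp_add[symmetric])
    thus ?thesis by (simp add: D2_def algebra_simps)
  qed
  \<comment> \<open>Four factors exp n are spent: one for \<open>D1\<close>, one for
    \<open>exp (f x)\<close> and two for \<open>n * exp n\<close>. Hence the constant
    \<open>4 * \<Lambda>\<close>.\<close>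
  have Db: "\<bar>D1 k x y * D2 k x y\<bar> \<le> exp (\<bar>f 0\<bar> + (4 * \<Lambda>) * (norm x + norm y))" for k x y
  proof -
    define n where "n = \<Lambda> * (norm x + norm y)"
    have n0: "n \<ge> 0" unfolding n_def using \<Lambda> by simp
    have d1: "\<bar>D1 k x y\<bar> \<le> n" unfolding n_def by (rule D1b)
    have "s k * \<bar>D1 k x y\<bar> \<le> 1 * n" using s[of k] d1 n0 by (intro mult_mono) auto
    hence "\<bar>s k * D1 k x y\<bar> * exp \<bar>s k * D1 k x y\<bar> \<le> (s k * n) * exp n"
      using s[of k] d1 n0 unfolding abs_mult by (intro mult_mono) auto
    hence "\<bar>exp (s k * D1 k x y) - 1\<bar> \<le> (n * exp n) * s k"
      using abs_exp_minus_one_le[of "s k * D1 k x y"] by (simp add: mult_ac)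
    hence e1: "\<bar>(exp (s k * D1 k x y) - 1) / s k\<bar> \<le> n * exp n"
      using s(1)[of k] by (simp add: abs_divide pos_divide_le_eq)
    have "\<bar>f x\<bar> \<le> \<bar>f 0\<bar> + n"
      using lipschitz_growth[OF f, of x] mult_left_mono[OF _ \<Lambda>, of "norm x" "norm x + norm y"] by (simp add: n_def)
    hence e2: "exp (f x) \<le> exp (\<bar>f 0\<bar> + n)" by simp
    have nn: "n \<le> exp n" using exp_ge_add_one_self[of n] by linarith
    have "\<bar>D1 k x y * D2 k x y\<bar> \<le> n * (exp (\<bar>f 0\<bar> + n) * (n * exp n))"
      unfolding D12 abs_mult using d1 e1 e2 n0 by (intro mult_mono) (auto simp: abs_mult)
    also have "\<dots> \<le> exp n * (exp (\<bar>f 0\<bar> + n) * (exp n * exp n))"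
      using nn n0 by (intro mult_mono) auto
    also have "\<dots> = exp (\<bar>f 0\<bar> + (4 * \<Lambda>) * (norm x + norm y))"
      by (simp add: n_def exp_add[symmetric] algebra_simps)
    finally show ?thesis .
  qed
  have lim1: "(\<lambda>k. LINT z|?P. (case z of (x, y) \<Rightarrow> D1 k x y * D2 k x y))
      \<longlonglongrightarrow> (LINT z|?P. (case z of (x, y) \<Rightarrow> (gradf x \<bullet> y) * ((exp (f x) *\<^sub>R gradf x) \<bullet> y)))"
  proof (rule integral_dominated_convergence)
    show "integrable ?P (\<lambda>(x, y). exp (\<bar>f 0\<bar> + (4 * \<Lambda>) * (norm x + norm y)))"
      by (rule pair_growth_integrable[where c = "4 * \<Lambda>" and C = "\<bar>f 0\<bar>"]) auto
    show "AE z in ?P. norm (case z of (x, y) \<Rightarrow> D1 k x y * D2 k x y)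
        \<le> (case z of (x, y) \<Rightarrow> exp (\<bar>f 0\<bar> + (4 * \<Lambda>) * (norm x + norm y)))" for k
      using Db[of k] by (intro AE_I2) (auto split: prod.splits)
    show "AE z in ?P. (\<lambda>k. case z of (x, y) \<Rightarrow> D1 k x y * D2 k x y)
        \<longlonglongrightarrow> (case z of (x, y) \<Rightarrow> (gradf x \<bullet> y) * ((exp (f x) *\<^sub>R gradf x) \<bullet> y))"
    proof (rule AE_I2)
      fix z :: "'a \<times> 'a"
      obtain x y where z: "z = (x, y)" by force
      have sq: "((\<lambda>t::real. sqrt (1 - t\<^sup>2)) has_real_derivative 0) (at 0)"
        by (auto intro!: derivative_eq_intros)
      have curve: "((\<lambda>t. sqrt (1 - t\<^sup>2) *\<^sub>R x + t *\<^sub>R y) has_vector_derivative y) (at 0)"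
        by (rule derivative_eq_intros sq | simp)+
      have exp_grad: "((\<lambda>x. exp (f x)) has_derivative (\<lambda>h. (exp (f x) *\<^sub>R gradf x) \<bullet> h)) (at x)"
        by (rule has_derivative_eq_rhs[OF has_derivative_exp[OF grad]]) (simp add: fun_eq_iff)
      have "(\<lambda>k. D1 k x y) \<longlonglongrightarrow> gradf x \<bullet> y"
        using curve_derivative_sequence[where p = "\<lambda>t. sqrt (1 - t\<^sup>2) *\<^sub>R x + t *\<^sub>R y", OF grad[of x] curve _ sat]
        by (simp add: D1_def Y_def c_def)
      moreover have "(\<lambda>k. D2 k x y) \<longlonglongrightarrow> (exp (f x) *\<^sub>R gradf x) \<bullet> y"
        using curve_derivative_sequence[where p = "\<lambda>t. sqrt (1 - t\<^sup>2) *\<^sub>R x + t *\<^sub>R y", OF exp_grad curve _ sat]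
        by (simp add: D2_def Y_def c_def)
      ultimately show "(\<lambda>k. case z of (x, y) \<Rightarrow> D1 k x y * D2 k x y)
        \<longlonglongrightarrow> (case z of (x, y) \<Rightarrow> (gradf x \<bullet> y) * ((exp (f x) *\<^sub>R gradf x) \<bullet> y))"
        unfolding z prod.case by (rule tendsto_mult)
    qed
  qed (simp_all add: D1_def D2_def Y_def)
  have lim1_eq: "(LINT z|?P. (case z of (x, y) \<Rightarrow> (gradf x \<bullet> y) * ((exp (f x) *\<^sub>R gradf x) \<bullet> y)))
      = fisher_info f gradf"
  proof -
    have "integrable ?P (\<lambda>(x, y). (gradf x \<bullet> y) * ((exp (f x) *\<^sub>R gradf x) \<bullet> y))"
    proof (rule pair_growth_integrable[where c = "4 * \<Lambda>" and C = "\<bar>f 0\<bar>"])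
      fix x y :: 'a
      define n where "n = \<Lambda> * (norm x + norm y)"
      have n0: "n \<ge> 0" unfolding n_def using \<Lambda> by simp
      have "\<bar>gradf x \<bullet> y\<bar> \<le> \<Lambda> * norm y"
        using Cauchy_Schwarz_ineq2[of "gradf x" y] mult_right_mono[OF gb[of x] norm_ge_zero[of y]] by linarith
      also have "\<dots> \<le> n" unfolding n_def using \<Lambda> by (intro mult_left_mono) auto
      also have "n \<le> exp n" using exp_ge_add_one_self[of n] by linarith
      finally have g: "\<bar>gradf x \<bullet> y\<bar> \<le> exp n" .
      have "\<bar>f x\<bar> \<le> \<bar>f 0\<bar> + n"
        using lipschitz_growth[OF f, of x] mult_left_mono[OF _ \<Lambda>, of "norm x" "norm x + norm y"] by (simp add: n_def)
      hence e: "exp (f x) \<le> exp (\<bar>f 0\<bar> + n)" by simp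
      have "\<bar>(gradf x \<bullet> y) * ((exp (f x) *\<^sub>R gradf x) \<bullet> y)\<bar> = \<bar>gradf x \<bullet> y\<bar> * (exp (f x) * \<bar>gradf x \<bullet> y\<bar>)"
        by (simp add: abs_mult)
      also have "\<dots> \<le> exp n * (exp (\<bar>f 0\<bar> + n) * exp n)"
        using g e by (intro mult_mono) auto
      also have "\<dots> \<le> exp (\<bar>f 0\<bar> + (4 * \<Lambda>) * (norm x + norm y))"
        using n0 by (simp add: n_def exp_add[symmetric] algebra_simps)
      finally show "\<bar>(gradf x \<bullet> y) * ((exp (f x) *\<^sub>R gradf x) \<bullet> y)\<bar>
          \<le> exp (\<bar>f 0\<bar> + (4 * \<Lambda>) * (norm x + norm y))" .
    qed measurable
    hence "(LINT z|?P. (case z of (x, y) \<Rightarrow> (gradf x \<bullet> y) * ((exp (f x) *\<^sub>R gradf x) \<bullet> y)))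
       = (LINT x|std_gaussian. (LINT y|std_gaussian. (gradf x \<bullet> y) * ((exp (f x) *\<^sub>R gradf x) \<bullet> y)))"
      by (rule pair_integral_fst[symmetric])
    also have "\<dots> = (LINT x|std_gaussian. exp (f x) * (norm (gradf x))\<^sup>2)"
      unfolding integral_gauss_inner_inner by (simp add: power2_norm_eq_inner)
    also have "\<dots> = fisher_info f gradf"
      unfolding fisher_info_def by (subst integral_tilt(1)) simp_all
    finally show ?thesis .
  qed
  define E where "E k x = (f (c k *\<^sub>R x) - f x) / (s k)\<^sup>2" for k x
  have Eb: "\<bar>E k x\<bar> \<le> \<Lambda> * norm x" for k x
  proof -
    have "norm (c k *\<^sub>R x - x) = (1 - c k) * norm x"
      using c01[of k] by (simp add: scaleR_left_diff_distrib[of "c k" 1 x, simplified, symmetric] abs_if)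
    also have "\<dots> \<le> (s k)\<^sup>2 * norm x" using c1[of k] by (intro mult_right_mono) auto
    finally have "\<bar>f (c k *\<^sub>R x) - f x\<bar> \<le> \<Lambda> * norm x * (s k)\<^sup>2"
      using lipschitz_bound[OF f, of "c k *\<^sub>R x" x] mult_left_mono[OF _ \<Lambda>, of "norm (c k *\<^sub>R x - x)" "(s k)\<^sup>2 * norm x"]
      by (simp add: mult_ac)
    thus ?thesis using s(1)[of k] by (simp add: E_def abs_divide pos_divide_le_eq)
  qed
  have lim2: "(\<lambda>k. LINT x|gauss_tilt f. E k x) \<longlonglongrightarrow> (LINT x|gauss_tilt f. - (gradf x \<bullet> x) / 2)"
  proof (rule integral_dominated_convergence)
    have "integrable std_gaussian (\<lambda>x. exp (f x) * (\<Lambda> * norm x))"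
      by (intro exp_growth_integrable exp_growth_mult exp_growth_const exp_growth_norm exp_growth_lipschitz(2)[OF f])
    thus "integrable (gauss_tilt f) (\<lambda>x. \<Lambda> * norm x)"
      by (subst integral_tilt(2)) simp_all
    show "AE x in gauss_tilt f. norm (E k x) \<le> \<Lambda> * norm x" for k
      using Eb by simp
    show "AE x in gauss_tilt f. (\<lambda>k. E k x) \<longlonglongrightarrow> - (gradf x \<bullet> x) / 2"
    proof (rule AE_I2)
      fix x :: 'a
      \<comment> \<open>This curve is parametrised by s^2; in the parameter \<open>s\<close> its
        velocity at 0 would vanish and the quotient by s^2 would not be a first derivative.\<close>
      have sq: "((\<lambda>t::real. sqrt (1 - t)) has_real_derivative - (1 / 2)) (at 0)"
        by (auto intro!: derivative_eq_intros)
      have curve: "((\<lambda>t. sqrt (1 - t) *\<^sub>R x) has_vector_derivative (- (1 / 2)) *\<^sub>R x) (at 0)"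
        by (rule derivative_eq_intros sq | simp)+
      have "filterlim (\<lambda>k. (s k)\<^sup>2) (at 0) sequentially"
        unfolding filterlim_at using tendsto_power[OF slim, of 2] s by (simp add: less_imp_neq[symmetric])
      from curve_derivative_sequence[where p = "\<lambda>t. sqrt (1 - t) *\<^sub>R x", OF grad[of x] curve _ this]
      show "(\<lambda>k. E k x) \<longlonglongrightarrow> - (gradf x \<bullet> x) / 2" by (simp add: E_def c_def)
    qed
  qed (simp_all add: E_def)
  have main: "(LINT z|?P. (case z of (x, y) \<Rightarrow> D1 k x y * D2 k x y)) \<le> - L - 2 * (LINT x|gauss_tilt f. E k x)" for k
  proof -
    have "(LINT z|?P. (case z of (x, y) \<Rightarrow> D1 k x y * D2 k x y))
       = (LINT z|?P. (case z of (x, y) \<Rightarrow> (f (Y k x y) - f x) * (exp (f (Y k x y)) - exp (f x)))) / (s k)\<^sup>2"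
      unfolding integral_divide_zero[symmetric]
      by (intro Bochner_Integration.integral_cong refl) (auto simp: D1_def D2_def power2_eq_square)
    also have "\<dots> \<le> (- L * (s k)\<^sup>2 - 2 * (LINT x|gauss_tilt f. f (c k *\<^sub>R x) - f x)) / (s k)\<^sup>2"
      unfolding Y_def by (intro divide_right_mono dirichlet_form_le[OF f low prob cs s(1)]) auto
    also have "\<dots> = - L - 2 * (LINT x|gauss_tilt f. E k x)"
      unfolding E_def integral_divide_zero using s(1)[of k] by (simp add: diff_divide_distrib)
    finally show ?thesis .
  qed
  have "(\<lambda>k. - L - 2 * (LINT x|gauss_tilt f. E k x)) \<longlonglongrightarrow> - L - 2 * (LINT x|gauss_tilt f. - (gradf x \<bullet> x) / 2)"
    by (intro tendsto_diff tendsto_mult tendsto_const lim2)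
  hence "fisher_info f gradf \<le> - L - 2 * (LINT x|gauss_tilt f. - (gradf x \<bullet> x) / 2)"
    unfolding lim1_eq[symmetric] by (rule LIMSEQ_le[OF lim1]) (use main in blast)
  thus ?thesis by simp
qed

section \<open>Finite Gaussian width and conclusion\<close>

lemma gradient_mvt:
  fixes f :: "'a::euclidean_space \<Rightarrow> real"
  assumes grad: "\<And>x. (f has_derivative (\<lambda>h. gradf x \<bullet> h)) (at x)"
  obtains z where "f (x + h) - f x = gradf z \<bullet> h"
  using MVT2[of 0 1 "\<lambda>t. f (x + t *\<^sub>R h)" "\<lambda>t. gradf (x + t *\<^sub>R h) \<bullet> h"]
    has_real_derivative_along_line[OF grad] that by force

text \<open>The directions in which \<open>K\<close> has a finite support function form a convex cone. A cone of full
  measure is everything, since \<open>w = g + (w - g)\<close> for almost every \<open>g\<close>.\<close>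
lemma bounded_if_AE_support_finite:
  fixes K :: "'a::euclidean_space set"
  assumes AE: "AE g in std_gaussian. (SUP x\<in>K. ereal (x \<bullet> g)) < \<infinity>"
  shows "bounded K"
proof -
  let ?P = "\<lambda>g. (SUP x\<in>K. ereal (x \<bullet> g)) < \<infinity>"
  \<comment> \<open>Gaussian and Lebesgue measure have the same null sets, and only the latter is
    invariant under g \<mapsto> w - g.\<close>
  have AE1: "AE g in lborel. ?P g"
    using AE unfolding std_gaussian_eq by (subst (asm) AE_density) auto
  have "\<exists>B. \<forall>x\<in>K. x \<bullet> w \<le> B" for w
  proof -
    have "distr lborel borel (\<lambda>g::'a. w - g) = lborel"
      using lborel_affine[of "-1" w] by (simp add: density_1)
    hence "AE g in distr lborel borel (\<lambda>g. w - g). ?P g" using AE1 by (simp only:)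
    hence "AE g in lborel. ?P (w - g)" by (rule AE_distrD[rotated]) simp
    with AE1 have "AE g in lborel. ?P g \<and> ?P (w - g)" by (rule AE_conjI)
    hence "AE g in std_gaussian. ?P g \<and> ?P (w - g)"
      unfolding std_gaussian_eq by (subst AE_density) auto
    then obtain g where g: "?P g" "?P (w - g)"
      using eventually_happens'[OF gauss.ae_filter_bot] by blast
    have fin: "\<exists>B. y \<le> ereal B" if "y < \<infinity>" for y
      using that by (cases y) auto
    obtain B1 B2 where B: "(SUP x\<in>K. ereal (x \<bullet> g)) \<le> ereal B1" "(SUP x\<in>K. ereal (x \<bullet> (w - g))) \<le> ereal B2"
      using fin[OF g(1)] fin[OF g(2)] by blast
    have "x \<bullet> w \<le> B1 + B2" if "x \<in> K" for x
    proof -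
      have "ereal (x \<bullet> g) \<le> ereal B1" by (rule order_trans[OF SUP_upper[OF that] B(1)])
      moreover have "ereal (x \<bullet> (w - g)) \<le> ereal B2" by (rule order_trans[OF SUP_upper[OF that] B(2)])
      ultimately show ?thesis by (simp add: inner_diff_right)
    qed
    thus ?thesis by blast
  qed
  then obtain B where B: "\<And>w x. x \<in> K \<Longrightarrow> x \<bullet> w \<le> B w" by metis
  show ?thesis unfolding bounded_iff
  proof (intro exI ballI)
    fix x assume x: "x \<in> K"
    have "norm x \<le> (\<Sum>b\<in>Basis. \<bar>x \<bullet> b\<bar>)" by (rule norm_le_l1)
    also have "\<dots> \<le> (\<Sum>b\<in>Basis. max (B b) (B (- b)))"
    proof (rule sum_mono)
      show "\<bar>x \<bullet> b\<bar> \<le> max (B b) (B (- b))" for b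
        using B[OF x, of b] B[OF x, of "- b"] by (auto simp: abs_le_iff)
    qed
    finally show "norm x \<le> (\<Sum>b\<in>Basis. max (B b) (B (- b)))" .
  qed
qed

text \<open>A real upper bound rules out the infinite branch of the definition, which leaves the
  conditions and the value of the other one.\<close>

lemma gaussian_width_finiteD:
  fixes K :: "'a::euclidean_space set"
  assumes "gaussian_width K \<le> ereal d"
  shows "AE g in std_gaussian. \<bar>SUP x\<in>K. ereal (x \<bullet> g)\<bar> \<noteq> \<infinity>"
    and "integrable std_gaussian (\<lambda>g. real_of_ereal (SUP x\<in>K. ereal (x \<bullet> g)))"
    and "(LINT g|std_gaussian. real_of_ereal (SUP x\<in>K. ereal (x \<bullet> g))) \<le> d"
  using assms unfolding gaussian_width_def Let_def by (auto split: if_splits)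

text \<open>Under the tilted measure exp (- f) has mean one, so it suffices to integrate 1 - exp (-
  t) \<le> t.\<close>

lemma KL_gauss_nonneg:
  fixes f :: "'a::euclidean_space \<Rightarrow> real"
  assumes f: "\<Lambda>-lipschitz_on UNIV f" and prob: "prob_space (gauss_tilt f)"
  shows "KL_gauss f \<ge> 0"
proof -
  note [measurable] = lipschitz_measurable[OF f]
  interpret T: prob_space "gauss_tilt f" by fact
  have i1: "integrable (gauss_tilt f) f"
    by (subst integral_tilt(2)) (auto intro!: exp_growth_integrable exp_growth_mult exp_growth_lipschitz(1,2)[OF f])
  have i2: "integrable (gauss_tilt f) (\<lambda>x. exp (- f x))" and e: "(LINT x|gauss_tilt f. exp (- f x)) = 1"
    by (simp_all add: integral_tilt exp_minus gauss.prob_space[simplified])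
  have "(LINT x|gauss_tilt f. 1 - exp (- f x)) \<le> (LINT x|gauss_tilt f. f x)"
  proof (rule integral_mono)
    show "1 - exp (- f x) \<le> f x" for x using exp_ge_add_one_self[of "- f x"] by linarith
  qed (use i1 i2 in auto)
  thus ?thesis using i2 e T.prob_space by (simp add: KL_gauss_def)
qed

text \<open>The exponents add up to one, so the minimum is the product of its own two powers, each
  of which is monotone.\<close>

lemma min_le_powr_mean:
  fixes d I :: real
  assumes "d \<ge> 0" "I \<ge> 0"
  shows "min d I \<le> d powr (2/3) * I powr (1/3)"
proof -
  have *: "t = t powr (2/3) * t powr (1/3)" if "t \<ge> 0" for t :: real
    using that by (simp flip: powr_add)
  have "min d I = min d I powr (2/3) * min d I powr (1/3)" using assms by (intro *) simp
  also have "\<dots> \<le> d powr (2/3) * I powr (1/3)"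
    using assms by (intro mult_mono powr_mono2) auto
  finally show ?thesis .
qed

text \<open>The real parameters \<open>d\<close> and \<open>L\<close> stand for the width and the
  infimum of the Laplacian. If both are finite they may be inserted themselves; otherwise the
  right-hand side is infinite and no such parameters exist.\<close>

theorem theorem1p7:
  fixes f :: "'a::euclidean_space \<Rightarrow> real"
    and gradf :: "'a \<Rightarrow> 'a"
    and hessf :: "'a \<Rightarrow> 'a \<Rightarrow> 'a"
  assumes grad: "\<And>x. (f has_derivative (\<lambda>h. inner (gradf x) h)) (at x)"
    and hess: "\<And>x. (gradf has_derivative hessf x) (at x)"
    and prob: "prob_space (gauss_tilt f)"
    and int_KL: "integrable (gauss_tilt f) f"
    and int_I: "integrable (gauss_tilt f) (\<lambda>x. (norm (gradf x))\<^sup>2)"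
  shows "\<forall>d L. gaussian_width (range gradf) \<le> ereal d \<longrightarrow>
           (\<forall>x. L \<le> laplacian hessf x) \<longrightarrow>
           fisher_info f gradf - 2 * KL_gauss f
             \<le> 2 * d powr (2/3) * fisher_info f gradf powr (1/3) + max (- L) 0"
proof (intro allI impI)
  fix d L
  assume d: "gaussian_width (range gradf) \<le> ereal d" and L: "\<forall>x. L \<le> laplacian hessf x"
  define SS where "SS g = (SUP x\<in>range gradf. ereal (x \<bullet> g))" for g
  define S where "S g = real_of_ereal (SS g)" for g
  have S: "AE g in std_gaussian. \<bar>SS g\<bar> \<noteq> \<infinity>" "integrable std_gaussian S" "(LINT g|std_gaussian. S g) \<le> d"
    using gaussian_width_finiteD[OF d] unfolding S_def SS_def by simp_all
  have "AE g in std_gaussian. SS g < \<infinity>" using S(1) by (rule AE_mp) auto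
  hence "bounded (range gradf)" unfolding SS_def by (rule bounded_if_AE_support_finite)
  then obtain \<Lambda> where gb: "\<And>x. norm (gradf x) \<le> \<Lambda>" unfolding bounded_iff by auto
  have \<Lambda>: "\<Lambda> \<ge> 0" using order_trans[OF norm_ge_zero gb] .
  have gbi: "gradf z \<bullet> g \<le> \<Lambda> * norm g" for z g
    using norm_cauchy_schwarz[of "gradf z" g] mult_right_mono[OF gb[of z] norm_ge_zero[of g]] by linarith
  \<comment> \<open>The width gives finiteness only almost everywhere. With bounded gradients it
    holds for every \<open>g\<close>, as required by the increment bound of \<open>f\<close> in all
    directions.\<close>
  have SS: "SS g = ereal (S g)" for g
  proof -
    have "SS g \<le> ereal (\<Lambda> * norm g)" unfolding SS_def by (rule SUP_least) (use gbi in auto)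
    moreover have "ereal (gradf 0 \<bullet> g) \<le> SS g" unfolding SS_def by (rule SUP_upper) simp
    ultimately have "\<bar>SS g\<bar> \<noteq> \<infinity>" by auto
    thus ?thesis by (simp add: S_def ereal_real)
  qed
  have S_ge: "gradf z \<bullet> g \<le> S g" for z g
  proof -
    have "ereal (gradf z \<bullet> g) \<le> SS g" unfolding SS_def by (rule SUP_upper) simp
    thus ?thesis by (simp add: SS)
  qed
  have S_le: "S g \<le> \<Lambda> * norm g" for g
  proof -
    have "SS g \<le> ereal (\<Lambda> * norm g)" unfolding SS_def by (rule SUP_least) (use gbi in auto)
    thus ?thesis by (simp add: SS)
  qed
  have S_growth: "exp_growth S"
  proof (rule exp_growth_bound[of "\<lambda>g. \<Lambda> * norm g"])
    show "exp_growth (\<lambda>g::'a. \<Lambda> * norm g)" by (intro exp_growth_mult exp_growth_const exp_growth_norm)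
    \<comment> \<open>\<open>S\<close> comes from a supremum over a possibly uncountable set; its
      measurability is read off the integrability contained in the finite width.\<close>
    have "S \<in> borel_measurable std_gaussian" using S(2) by (rule borel_measurable_integrable)
    thus "S \<in> borel_measurable borel" by simp
    show "\<bar>S g\<bar> \<le> \<Lambda> * norm g" for g
      using S_le[of g] S_ge[of 0 g] gbi[of 0 "- g"] by (simp add: abs_le_iff)
  qed
  have f_S: "f (x + c *\<^sub>R b) \<le> f x + c * S b" if "c \<ge> 0" for x b c
  proof -
    obtain z where "f (x + c *\<^sub>R b) - f x = gradf z \<bullet> (c *\<^sub>R b)" using gradient_mvt[OF grad] by blast
    also have "\<dots> \<le> c * S b" using mult_left_mono[OF S_ge that, of z b] by simp
    finally show ?thesis by simp
  qed
  have f: "\<Lambda>-lipschitz_on UNIV f"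
  proof (rule lipschitz_onI[OF _ \<Lambda>])
    fix x y
    obtain z where z: "f (x + (y - x)) - f x = gradf z \<bullet> (y - x)" using gradient_mvt[OF grad] by blast
    have "\<bar>gradf z \<bullet> (y - x)\<bar> \<le> \<Lambda> * norm (y - x)"
      using gbi[of z "y - x"] gbi[of z "x - y"] by (simp add: abs_le_iff inner_diff_right norm_minus_commute)
    thus "dist (f x) (f y) \<le> \<Lambda> * dist x y"
      using z by (simp add: dist_norm norm_minus_commute abs_minus_commute)
  qed
  have gm: "gradf \<in> borel_measurable borel"
    by (intro borel_measurable_continuous_onI continuous_at_imp_continuous_on ballI has_derivative_continuous[OF hess])
  have low: "f x + L * T\<^sup>2 / 2 \<le> (LINT y|std_gaussian. f (x + T *\<^sub>R y))" if "T \<ge> 0" for x T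
    using L that by (intro heat_minus_id_ge[OF f grad hess]) auto
  define I where "I = fisher_info f gradf"
  have I0: "I \<ge> 0" unfolding I_def fisher_info_def by simp
  have KL0: "KL_gauss f \<ge> 0" by (rule KL_gauss_nonneg[OF f prob])
  \<comment> \<open>\<open>S\<close> dominates a linear functional, whose Gaussian mean is zero;
    this gives the sign of \<open>d\<close> needed for its powers.\<close>
  have "0 = (LINT g|std_gaussian. gradf 0 \<bullet> g)" by (simp add: integral_gauss_inner)
  also have "\<dots> \<le> (LINT g|std_gaussian. S g)"
    using S_ge by (intro integral_mono S(2) exp_growth_integrable exp_growth_inner)
  finally have d0: "d \<ge> 0" using S(3) by simp
  have "I + L \<le> (LINT x|gauss_tilt f. gradf x \<bullet> x)"
    unfolding I_def by (rule fisher_plus_laplacian_bound[OF f grad low prob gm gb])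
  also have "\<dots> \<le> 2 * KL_gauss f + (LINT g|std_gaussian. S g)"
    unfolding KL_gauss_def by (rule tilt_drift_le_width[OF f grad S_growth f_S prob gm])
  finally have "I - 2 * KL_gauss f \<le> d - L" using S(3) by simp
  moreover have "I - 2 * KL_gauss f \<le> I" using KL0 by simp
  ultimately have "I - 2 * KL_gauss f \<le> min d I + max (- L) 0" by linarith
  also have "min d I \<le> d powr (2/3) * I powr (1/3)" by (rule min_le_powr_mean[OF d0 I0])
  also have "d powr (2/3) * I powr (1/3) \<le> 2 * d powr (2/3) * I powr (1/3)" by simp
  finally show "fisher_info f gradf - 2 * KL_gauss f
      \<le> 2 * d powr (2/3) * fisher_info f gradf powr (1/3) + max (- L) 0"
    unfolding I_def by simp
qed

end
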